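(* The following problem can be solved in polynomial time. Input: a finite ground set $E$ with $|E|=n$; disjoint subsets $Q,R\subseteq E$ with $|R|=p\ge 1$; subsets $S_1,\dots,S_k\subseteq E$ ($0\le k\le n$) whose characteristic vectors are linearly independent; a vector $a\in\mathbb{R}^R$; and a number $b\in\mathbb{R}$. Task: decide whether $a(S)\ge b$ holds for all $S\subseteq R$ such that $S\cup Q\notin \mathrm{span}\{S_1,\dots,S_k\}$, and if not, output a set $S\subseteq R$ with $S\cup Q\notin\mathrm{span}\{S_1,\dots,S_k\}$ and $a(S)<b$.
   Context: Subsets of $E$ are identified with their characteristic vectors in $\mathbb{R}^E$; thus $T\in\mathrm{span}\{S_1,\dots,S_k\}$ means that the characteristic vector of $T$ lies in the linear span of the characteristic vectors of $S_1,\dots,S_k$ (the span of the empty family is $\{0\}$). For $S\subseteq R$, $a(S)=\sum_{e\in S}a_e$. Polynomial time is with respect to the encoding length of the input, with numerical data rational. *)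

theory Defs
  imports
    "HOL-Computational_Algebra.Polynomial"
    "Jordan_Normal_Form.VS_Connect"
begin

section \<open>Deterministic multi-tape Turing machines\<close>

text \<open>
  States are the numbers below \<open>num_states\<close>, the initial state is \<open>0\<close> and the unique halting
  state is \<open>num_states\<close> itself. Tape symbols are the numbers below \<open>num_syms\<close>, with \<open>0\<close> the blank.
  Tapes are infinite in both directions. Tape \<open>0\<close> initially carries the input, tape \<open>1\<close> carries
  the output on halting; both words start at cell \<open>0\<close>, and all other cells are blank.
\<close>

datatype move = Left | Stay | Right

record tm =
  num_tapes :: nat
  num_syms :: nat
  num_states :: nat
  trans :: "nat \<Rightarrow> nat list \<Rightarrow> nat \<times> (nat \<times> move) list"

text \<open>The transition function matters only on the finite domain over which this predicate
  ranges, so a machine is a finite object. Symbols \<open>1\<close>, \<open>2\<close>, \<open>3\<close> are used by the encodings.\<close>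

definition wf_tm :: "tm \<Rightarrow> bool" where
  "wf_tm M \<longleftrightarrow> num_tapes M \<ge> 2 \<and> num_syms M \<ge> 4 \<and>
     (\<forall>q < num_states M. \<forall>ss. length ss = num_tapes M \<and> set ss \<subseteq> {..<num_syms M} \<longrightarrow>
        fst (trans M q ss) \<le> num_states M \<and>
        length (snd (trans M q ss)) = num_tapes M \<and>
        fst ` set (snd (trans M q ss)) \<subseteq> {..<num_syms M})"

type_synonym tape = "(int \<Rightarrow> nat) \<times> int"  \<comment> \<open>cell contents and head position\<close>

type_synonym config = "nat \<times> tape list"

fun offset :: "move \<Rightarrow> int" where
  "offset Left = -1"
| "offset Stay = 0"
| "offset Right = 1"

definition act :: "nat \<times> move \<Rightarrow> tape \<Rightarrow> tape" where
  "act = (\<lambda>(s, d) (c, h). (c(h := s), h + offset d))"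

definition step :: "tm \<Rightarrow> config \<Rightarrow> config" where
  "step M = (\<lambda>(q, ts).
     if q \<ge> num_states M then (q, ts)
     else let (q', as) = trans M q (map (\<lambda>(c, h). c h) ts) in (q', map2 act as ts))"

definition word_cells :: "nat list \<Rightarrow> int \<Rightarrow> nat" where
  "word_cells w i = (if 0 \<le> i \<and> i < int (length w) then w ! nat i else 0)"

definition init_config :: "tm \<Rightarrow> nat list \<Rightarrow> config" where
  "init_config M w = (0, (word_cells w, 0) # replicate (num_tapes M - 1) (word_cells [], 0))"

definition computes_within :: "tm \<Rightarrow> nat list \<Rightarrow> nat list \<Rightarrow> nat \<Rightarrow> bool" where
  "computes_within M x y T \<longleftrightarrow>
     (\<exists>t \<le> T. case (step M ^^ t) (init_config M x) of
        (q, ts) \<Rightarrow> q = num_states M \<and> fst (ts ! 1) = word_cells y)"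

text \<open>
  A search problem is given by its set of instances, the relation between instances and correct
  answers, and encodings of both. Nothing is required of the machine on words that do not encode
  an instance.
\<close>

definition poly_time_solvable ::
  "'i set \<Rightarrow> ('i \<Rightarrow> 'o \<Rightarrow> bool) \<Rightarrow> ('i \<Rightarrow> nat list) \<Rightarrow> ('i \<Rightarrow> 'o \<Rightarrow> nat list) \<Rightarrow> bool" where
  "poly_time_solvable I correct enc_in enc_out \<longleftrightarrow>
     (\<exists>M (p :: nat poly). wf_tm M \<and>
        (\<forall>x \<in> I. \<exists>y. correct x y \<and>
           computes_within M (enc_in x) (enc_out x y) (poly p (length (enc_in x)))))"


section \<open>Encodings\<close>

definition enc_bit :: "bool \<Rightarrow> nat" where
  "enc_bit v = (if v then 2 else 1)"

definition sep :: nat where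
  "sep = 3"

text \<open>Binary representation, least significant bit first.\<close>

fun nat_bits :: "nat \<Rightarrow> bool list" where
  "nat_bits m = (if m = 0 then [] else odd m # nat_bits (m div 2))"

declare nat_bits.simps [simp del]

definition enc_nat :: "nat \<Rightarrow> nat list" where
  "enc_nat m = map enc_bit (nat_bits m) @ [sep]"

text \<open>Sign bit and absolute value of the numerator, then the denominator, in lowest terms.\<close>

definition enc_rat :: "rat \<Rightarrow> nat list" where
  "enc_rat r = (case quotient_of r of
     (z, d) \<Rightarrow> enc_bit (z < 0) # enc_nat (nat \<bar>z\<bar>) @ enc_nat (nat d))"

definition enc_set :: "nat \<Rightarrow> nat set \<Rightarrow> nat list" where
  "enc_set n A = map (\<lambda>i. enc_bit (i \<in> A)) [0..<n] @ [sep]"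


section \<open>The problem\<close>

text \<open>The ground set \<open>E\<close> is \<open>{..<n}\<close> and \<open>\<real>\<^sup>E\<close> is \<open>carrier_vec n\<close>.\<close>

definition char_vector :: "nat \<Rightarrow> nat set \<Rightarrow> real vec" where
  "char_vector n A = vec n (\<lambda>i. if i \<in> A then 1 else 0)"

definition vec_span :: "nat \<Rightarrow> real vec set \<Rightarrow> real vec set" where
  "vec_span n V = LinearCombinations.module.span class_ring (module_vec TYPE(real) n) V"

definition lin_indep_family :: "nat \<Rightarrow> real vec list \<Rightarrow> bool" where
  "lin_indep_family n vs \<longleftrightarrow>
     distinct vs \<and> \<not> LinearCombinations.module.lin_dep class_ring (module_vec TYPE(real) n) (set vs)"

record problem_instance =
  ground_size :: nat
  Q_set :: "nat set"
  R_set :: "nat set"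
  S_sets :: "nat set list"
  weight :: "nat \<Rightarrow> rat"  \<comment> \<open>only the values on \<open>R_set\<close> are used\<close>
  bound :: rat

definition instances :: "problem_instance set" where
  "instances = {x.
     Q_set x \<subseteq> {..<ground_size x} \<and>
     R_set x \<subseteq> {..<ground_size x} \<and>
     Q_set x \<inter> R_set x = {} \<and>
     card (R_set x) \<ge> 1 \<and>
     length (S_sets x) \<le> ground_size x \<and>
     (\<forall>S \<in> set (S_sets x). S \<subseteq> {..<ground_size x}) \<and>
     lin_indep_family (ground_size x) (map (char_vector (ground_size x)) (S_sets x))}"

text \<open>The size \<open>n\<close> and the number \<open>k\<close> of sets are implicit in the encoding: each subset of \<open>E\<close> is
  written as \<open>n\<close> bits. The weights are listed for the elements of \<open>R\<close> in increasing order.\<close>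

definition enc_instance :: "problem_instance \<Rightarrow> nat list" where
  "enc_instance x =
     enc_set (ground_size x) (Q_set x) @
     enc_set (ground_size x) (R_set x) @
     concat (map (\<lambda>e. enc_rat (weight x e)) (sorted_list_of_set (R_set x))) @
     enc_rat (bound x) @
     concat (map (enc_set (ground_size x)) (S_sets x))"

definition admissible :: "problem_instance \<Rightarrow> nat set \<Rightarrow> bool" where
  "admissible x S \<longleftrightarrow> S \<subseteq> R_set x \<and>
     char_vector (ground_size x) (S \<union> Q_set x)
       \<notin> vec_span (ground_size x) (char_vector (ground_size x) ` set (S_sets x))"

text \<open>The answer \<open>None\<close> asserts that the inequality holds for all admissible sets; \<open>Some S\<close> denies
  this and exhibits a violating set.\<close>

definition correct_answer :: "problem_instance \<Rightarrow> nat set option \<Rightarrow> bool" where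
  "correct_answer x r = (case r of
     None \<Rightarrow> \<forall>S. admissible x S \<longrightarrow> (\<Sum>e\<in>S. weight x e) \<ge> bound x
   | Some S \<Rightarrow> admissible x S \<and> (\<Sum>e\<in>S. weight x e) < bound x)"

definition enc_answer :: "problem_instance \<Rightarrow> nat set option \<Rightarrow> nat list" where
  "enc_answer x r = (case r of
     None \<Rightarrow> [enc_bit True]
   | Some S \<Rightarrow> enc_bit False # enc_set (ground_size x) S)"

end

theory Submission
  imports Defs "Jordan_Normal_Form.Determinant"
begin

text \<open>
  Let \<open>N\<close> be the set of elements of \<open>R\<close> of negative weight, which minimises \<open>a\<close>. If \<open>N \<union> Q\<close> is in the
  span and \<open>S \<union> Q\<close> is not, then for some \<open>e\<close> in the symmetric difference of \<open>N\<close> and \<open>S\<close> the unit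
  vector of \<open>e\<close> is not in the span either, so that flipping \<open>e\<close> in \<open>N\<close> gives an admissible set of weight
  \<open>a(N) + \<bar>a\<^sub>e\<bar> \<le> a(S)\<close>. Hence it suffices to test \<open>N\<close> and the sets obtained from it by one flip.

  To test membership in the span, the rows \<open>S\<^sub>1, \<dots>, S\<^sub>k\<close> and the new row are eliminated, by cross
  multiplication, modulo every \<open>m\<close> below a polynomial bound. Success for one \<open>m\<close> proves independence.
  Conversely, if the rows are independent, then a prime \<open>m\<close> can fail only if it divides the Gram determinant,
  and this number is too small to be divisible by all primes below the bound. All numbers in the
  elimination are small, so they may be kept in unary.

  Polynomial time on Turing machines is obtained from a class of functions on algebraic data
  types, coded as trees in prefix notation on the top of a stack. It contains the
  constructors and destructors and is closed under composition, case distinction, and folds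
  whose accumulators stay polynomially bounded.
\<close>


section \<open>Structured programs on tapes\<close>

text \<open>Elimination over the rationals would call for division of large integers and for a size
  bound on all intermediate entries. Working modulo \<open>m\<close> removes both obstacles, and
  cross multiplication avoids inverses as well, so composite \<open>m\<close> do no harm and no
  primality test is run: primality enters only the argument that some \<open>m\<close> succeeds. The
  independence of the given sets is what turns non-membership in the span into independence of
  \<open>k + 1\<close> rows. The supply of primes needs no deep number theory: it rests on the lower
  bound \<open>2 ^ t\<close> for a common multiple of \<open>1, ..., 2 t\<close>. The weights are
  arbitrary rationals and have to stay in binary. Their sums are kept as unreduced fractions, whose
  bit length grows by the lengths of the new numerator and denominator. Both computations shape the
  class of functions. A fold is harmless if each round adds a polynomial amount to its accumulator,
  but a constant factor per round may already be exponential; hence additive growth, or an absolute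
  size bound, is what has to be shown for each fold.\<close>

datatype com =
    Act nat "nat list \<Rightarrow> nat" move
  | Seq com com
  | Cond "nat list \<Rightarrow> bool" com com
  | While "nat list \<Rightarrow> bool" com

abbreviation read_heads :: "tape list \<Rightarrow> nat list" where
  "read_heads ts \<equiv> map (\<lambda>(c, h). c h) ts"

text \<open>Written symbols are reduced modulo \<open>6\<close>, so that every program is a machine over six symbols.\<close>

definition do_act :: "nat \<Rightarrow> (nat list \<Rightarrow> nat) \<Rightarrow> move \<Rightarrow> tape list \<Rightarrow> tape list" where
  "do_act j f d ts = ts[j := act (f (read_heads ts) mod 6, d) (ts ! j)]"

text \<open>Every action, test and sequencing is charged one unit, so that the time is exactly the
  number of transitions of the compiled machine.\<close>

inductive exec :: "com \<Rightarrow> tape list \<Rightarrow> nat \<Rightarrow> tape list \<Rightarrow> bool" where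
  exec_Act: "exec (Act j f d) ts 1 (do_act j f d ts)"
| exec_Seq: "exec c ts t1 ts1 \<Longrightarrow> exec d ts1 t2 ts2 \<Longrightarrow> exec (Seq c d) ts (1 + t1 + t2) ts2"
| exec_CondT: "P (read_heads ts) \<Longrightarrow> exec c ts t ts1 \<Longrightarrow> exec (Cond P c d) ts (1 + t) ts1"
| exec_CondF: "\<not> P (read_heads ts) \<Longrightarrow> exec d ts t ts1 \<Longrightarrow> exec (Cond P c d) ts (1 + t) ts1"
| exec_WhileF: "\<not> P (read_heads ts) \<Longrightarrow> exec (While P c) ts 1 ts"
| exec_WhileT: "P (read_heads ts) \<Longrightarrow> exec c ts t1 ts1 \<Longrightarrow> exec (While P c) ts1 t2 ts2
    \<Longrightarrow> exec (While P c) ts (1 + t1 + t2) ts2"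

section \<open>Compilation to Turing machines\<close>

text \<open>The control states of the machine are the continuations, i.e. stacks of programs that
  remain to be run, that are reachable from the initial one; there are only finitely many.\<close>

fun control :: "com list \<Rightarrow> nat list \<Rightarrow> com list" where
  "control [] ss = []"
| "control (Act j f d # k) ss = k"
| "control (Seq c d # k) ss = c # d # k"
| "control (Cond P c d # k) ss = (if P ss then c # k else d # k)"
| "control (While P c # k) ss = (if P ss then c # While P c # k else k)"

fun tapes_step :: "com list \<Rightarrow> tape list \<Rightarrow> tape list" where
  "tapes_step (Act j f d # k) ts = do_act j f d ts"
| "tapes_step k ts = ts"

definition cstep :: "com list \<times> tape list \<Rightarrow> com list \<times> tape list" where
  "cstep = (\<lambda>(k, ts). (control k (read_heads ts), tapes_step k ts))"

lemma cstep_simps [simp]: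
  "cstep (Act j f m # k, ts) = (k, do_act j f m ts)"
  "cstep (Seq c d # k, ts) = (c # d # k, ts)"
  "cstep (Cond P c d # k, ts) = (if P (read_heads ts) then c # k else d # k, ts)"
  "cstep (While P c # k, ts) = (if P (read_heads ts) then c # While P c # k else k, ts)"
  by (simp_all add: cstep_def)

lemma exec_cstep: "exec c ts t ts' \<Longrightarrow> (cstep ^^ t) (c # k, ts) = (k, ts')"
proof (induction arbitrary: k rule: exec.induct)
  case (exec_Seq c ts t1 ts1 d t2 ts2)
  have "(cstep ^^ (t2 + t1 + 1)) (Seq c d # k, ts) = (k, ts2)"
    unfolding funpow_add using exec_Seq.IH by simp
  then show ?case by (simp add: add_ac)
next
  case (exec_WhileT P ts c t1 ts1 t2 ts2)
  have "(cstep ^^ (t2 + t1 + 1)) (While P c # k, ts) = (k, ts2)"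
    unfolding funpow_add using exec_WhileT by simp
  then show ?case by (simp add: add_ac)
qed (simp_all add: funpow_swap1)

text \<open>Both branches of a test are included whatever the test says, so this contains every
  continuation met while \<open>c\<close> runs on top of \<open>k\<close>. The exit \<open>k\<close>
  itself is left out; it becomes the halting state.\<close>

fun conts :: "com \<Rightarrow> com list \<Rightarrow> com list set" where
  "conts (Act j f d) k = {Act j f d # k}"
| "conts (Seq c d) k = insert (Seq c d # k) (conts c (d # k) \<union> conts d k)"
| "conts (Cond P c d) k = insert (Cond P c d # k) (conts c k \<union> conts d k)"
| "conts (While P c) k = insert (While P c # k) (conts c (While P c # k))"

lemma finite_conts: "finite (conts c k)"
  by (induction c arbitrary: k) auto

lemma conts_self [simp]: "c # k \<in> conts c k"
  by (cases c) auto

lemma conts_not_end: "l \<in> conts c k \<Longrightarrow> length k < length l"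
  by (induction c arbitrary: k) fastforce+

lemma control_conts: "l \<in> conts c k \<Longrightarrow> control l ss \<in> insert k (conts c k)"
proof (induction c arbitrary: k)
  case (Seq c d)
  then show ?case by (auto dest!: Seq.IH)
next
  case (Cond P c d)
  then show ?case by (auto dest!: Cond.IH)
next
  case (While P c)
  show ?case
  \<comment> \<open>The loop body exits to the loop itself, which already belongs to the set; only
    the failing test leaves to \<open>k\<close>.\<close>
  proof (cases "l = While P c # k")
    case True
    then show ?thesis by simp
  next
    case False
    then have "l \<in> conts c (While P c # k)" using While.prems by simp
    then show ?thesis using While.IH by fastforce
  qed
qed auto

definition machine :: "nat \<Rightarrow> (nat \<Rightarrow> com list) \<Rightarrow> (com list \<Rightarrow> nat) \<Rightarrow> nat \<Rightarrow> tm" where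
  "machine K cont idx N =
     \<lparr>num_tapes = K, num_syms = 6, num_states = N,
      trans = (\<lambda>q ss. (idx (control (cont q) ss),
         case cont q of
           Act j f d # k \<Rightarrow> map (\<lambda>i. if i = j then (f ss mod 6, d) else (ss ! i, Stay)) [0..<K]
         | _ \<Rightarrow> map (\<lambda>i. (ss ! i, Stay)) [0..<K]))\<rparr>"

lemma act_stay: "act (fst t (snd t), Stay) t = t"
  by (cases t) (simp add: act_def)

lemma map2_act_stay:
  "length ts = K \<Longrightarrow> map2 act (map (\<lambda>i. (read_heads ts ! i, Stay)) [0..<K]) ts = ts"
  by (rule nth_equalityI) (auto simp: split_beta act_stay)

lemma map2_act_one:
  "length ts = K \<Longrightarrow>
     map2 act (map (\<lambda>i. if i = j then (f (read_heads ts) mod 6, d) else (read_heads ts ! i, Stay)) [0..<K]) ts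
       = do_act j f d ts"
  by (rule nth_equalityI) (auto simp: split_beta act_stay do_act_def nth_list_update)

lemma length_tapes_step [simp]: "length (tapes_step k ts) = length ts"
  by (cases "(k, ts)" rule: tapes_step.cases) (auto simp: do_act_def)

lemma machine_step:
  assumes "length ts = K" "q < N"
  shows "step (machine K cont idx N) (q, ts) =
    (idx (control (cont q) (read_heads ts)), tapes_step (cont q) ts)"
  using assms map2_act_one[OF assms(1)] map2_act_stay[OF assms(1)]
  by (auto simp: step_def machine_def split: list.splits com.splits)

text \<open>Meets the conventions on states: the initial continuation gets \<open>0\<close>, the
  empty one gets the largest number, which is the halting state, and all others lie in
  between.\<close>

lemma ex_numbering:
  assumes "finite A" "a \<in> A" "z \<notin> A"
  obtains idx :: "'a \<Rightarrow> nat" and N where "bij_betw idx (insert z A) {..N}" "idx a = 0" "idx z = N"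
proof -
  obtain g where g: "bij_betw g (A - {a}) {..<card (A - {a})}"
    using assms(1) ex_bij_betw_finite_nat[of "A - {a}"] by (auto simp: atLeast0LessThan)
  let ?n = "card (A - {a})"
  define idx where "idx x = (if x = a then 0 else if x = z then Suc ?n else Suc (g x))" for x
  have "bij_betw idx (insert z A) {..Suc ?n}"
  proof (rule bij_betw_imageI)
    have lt: "g x < ?n" if "x \<in> A - {a}" for x
      using g that by (auto simp: bij_betw_def)
    show "inj_on idx (insert z A)"
    proof (rule inj_onI)
      fix x y assume xy: "x \<in> insert z A" "y \<in> insert z A" "idx x = idx y"
      have idx_cases: "idx u = 0 \<and> u = a \<or> idx u = Suc ?n \<and> u = z \<or>
          idx u = Suc (g u) \<and> u \<in> A - {a} \<and> g u < ?n" if "u \<in> insert z A" for u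
        using that lt[of u] assms(2,3) unfolding idx_def by auto
      show "x = y"
        using idx_cases[OF xy(1)] idx_cases[OF xy(2)] xy(3) inj_onD[OF bij_betw_imp_inj_on[OF g], of x y]
        by (elim disjE conjE) simp_all
    qed
    have "idx ` (A - {a}) = Suc ` {..<?n}"
    proof -
      have "idx ` (A - {a}) = (\<lambda>x. Suc (g x)) ` (A - {a})"
        using assms(3) by (intro image_cong) (auto simp: idx_def)
      also have "\<dots> = Suc ` {..<?n}"
        using g by (simp add: bij_betw_def flip: image_image)
      finally show ?thesis .
    qed
    moreover have "insert z A = insert z (insert a (A - {a}))" using assms(2) by auto
    ultimately have "idx ` insert z A = insert (Suc ?n) (insert 0 (Suc ` {..<?n}))"
      using assms(2,3) by (auto simp: idx_def)
    also have "\<dots> = {..Suc ?n}"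
      by (auto simp: image_Suc_lessThan)
    finally show "idx ` insert z A = {..Suc ?n}" .
  qed
  moreover have "idx a = 0" "idx z = Suc ?n"
    using assms(2,3) by (auto simp: idx_def)
  ultimately show ?thesis by (rule that)
qed

theorem compile:
  assumes "2 \<le> K"
  obtains M where "wf_tm M" "num_tapes M = K"
    "\<And>ts t ts'. exec c ts t ts' \<Longrightarrow> length ts = K \<Longrightarrow>
       (step M ^^ t) (0, ts) = (num_states M, ts')"
proof -
  define A where "A = conts c []"
  have "finite A" "[c] \<in> A" "[] \<notin> A"
    using finite_conts conts_not_end[of "[]" c "[]"] by (auto simp: A_def)
  then obtain idx :: "com list \<Rightarrow> nat" and N where idx: "bij_betw idx (insert [] A) {..N}" "idx [c] = 0" "idx [] = N"
    by (rule ex_numbering)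
  define cont :: "nat \<Rightarrow> com list" where "cont = inv_into (insert [] A) idx"
  have cont_idx: "cont (idx l) = l" if "l \<in> insert [] A" for l
    using bij_betw_inv_into_left[OF idx(1) that] by (simp add: cont_def)
  have cont_in: "cont q \<in> insert [] A" if "q \<le> N" for q
    using bij_betw_inv_into[OF idx(1)] that by (auto simp: cont_def bij_betw_def)
  have idx_cont: "idx (cont q) = q" if "q \<le> N" for q
    using bij_betw_inv_into_right[OF idx(1)] that by (simp add: cont_def)
  have idx_le: "idx l \<le> N" if "l \<in> insert [] A" for l
    using idx(1) that by (auto simp: bij_betw_def)
  have control_in: "control l ss \<in> insert [] A" if "l \<in> insert [] A" for l ss
    using that control_conts[of l c "[]" ss] by (auto simp: A_def)
  define M where "M = machine K cont idx N"
  have "wf_tm M"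
    unfolding wf_tm_def
  proof (intro conjI allI impI)
    fix q ss assume q: "q < num_states M" and ss: "length ss = num_tapes M \<and> set ss \<subseteq> {..<num_syms M}"
    show "fst (trans M q ss) \<le> num_states M"
      using q cont_in[of q] by (auto simp: M_def machine_def intro!: idx_le control_in)
    show "length (snd (trans M q ss)) = num_tapes M"
      by (auto simp: M_def machine_def split: list.splits com.splits)
    have "ss ! i < 6" if "i < K" for i
      using ss that nth_mem[of i ss] by (auto simp: M_def machine_def simp del: nth_mem)
    then show "fst ` set (snd (trans M q ss)) \<subseteq> {..<num_syms M}"
      by (auto simp: M_def machine_def split: list.splits com.splits)
  qed (use assms in \<open>auto simp: M_def machine_def\<close>)
  moreover have "num_tapes M = K" by (simp add: M_def machine_def)
  moreover have "(step M ^^ t) (0, ts) = (num_states M, ts')"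
    if "exec c ts t ts'" "length ts = K" for ts t ts'
  proof -
    have sim: "\<exists>l us. (cstep ^^ n) ([c], ts) = (l, us) \<and> l \<in> insert [] A \<and> length us = K \<and>
        (step M ^^ n) (0, ts) = (idx l, us)" for n
    proof (induction n)
      case 0
      then show ?case using that \<open>[c] \<in> A\<close> idx by auto
    next
      case (Suc n)
      then obtain l us where IH: "(cstep ^^ n) ([c], ts) = (l, us)" "l \<in> insert [] A" "length us = K"
        "(step M ^^ n) (0, ts) = (idx l, us)" by auto
      \<comment> \<open>At the empty continuation both sides stand still. Any other continuation has
        a number different from \<open>N\<close>, hence a number below it, and the transition
        function applies.\<close>
      have "step M (idx l, us) = (idx (control l (read_heads us)), tapes_step l us)"
      proof (cases "l = []")
        case True
        then show ?thesis using idx by (auto simp: step_def M_def machine_def)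
      next
        case False
        then have "idx l \<noteq> N"
          using cont_idx[OF IH(2)] cont_idx[of "[]"] idx(3) by auto
        then have "idx l < N" using idx_le[OF IH(2)] by simp
        then show ?thesis using cont_idx[OF IH(2)] machine_step[OF IH(3), of "idx l" N cont idx]
          by (simp add: M_def)
      qed
      then show ?case
        using IH control_in[OF IH(2)] by (auto simp: cstep_def)
    qed
    show ?thesis
      using sim[of t] exec_cstep[OF that(1), of "[]"] idx(3)
      by (auto simp: M_def machine_def)
  qed
  ultimately show ?thesis by (rule that)
qed


section \<open>Tapes as stacks\<close>

text \<open>A tape is read as a stack that starts at the head and extends to the right; the cells to the
  left of the head are arbitrary. Tape \<open>1\<close> is reserved for the output.\<close>

definition is_stack :: "tape \<Rightarrow> nat list \<Rightarrow> bool" where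
  "is_stack t w \<longleftrightarrow> (\<forall>i\<ge>0. fst t (snd t + i) = word_cells w i)"

definition top_sym :: "nat list \<Rightarrow> nat" where
  "top_sym w = (case w of [] \<Rightarrow> 0 | a # _ \<Rightarrow> a)"

lemma top_sym_simps [simp]: "top_sym [] = 0" "top_sym (a # w) = a"
  by (simp_all add: top_sym_def)

definition stack_ids :: "nat set" where
  "stack_ids = {0, 2, 3, 4}"

lemma stack_ids_simps [simp]:
  "0 \<in> stack_ids" "2 \<in> stack_ids" "3 \<in> stack_ids" "4 \<in> stack_ids"
  by (simp_all add: stack_ids_def)

definition holds :: "tape list \<Rightarrow> tape \<Rightarrow> (nat \<Rightarrow> nat list) \<Rightarrow> bool" where
  "holds ts out s \<longleftrightarrow> length ts = 5 \<and> ts ! 1 = out \<and>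
     (\<forall>i \<in> stack_ids. is_stack (ts ! i) (s i) \<and> set (s i) \<subseteq> {..<6})"

text \<open>The quantification over all tapes that represent the stacks makes the garbage to the
  left of the heads irrelevant. The output tape is arbitrary but must come back unchanged, and the
  time is only an upper bound.\<close>

definition runs :: "com \<Rightarrow> (nat \<Rightarrow> nat list) \<Rightarrow> nat \<Rightarrow> (nat \<Rightarrow> nat list) \<Rightarrow> bool" where
  "runs c s t s' \<longleftrightarrow>
     (\<forall>ts out. holds ts out s \<longrightarrow> (\<exists>t' \<le> t. \<exists>ts'. exec c ts t' ts' \<and> holds ts' out s'))"

lemma read_heads_top:
  assumes "holds ts out s" "i \<in> stack_ids"
  shows "read_heads ts ! i = top_sym (s i)"
proof -
  have "i < length ts" "is_stack (ts ! i) (s i)"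
    using assms by (auto simp: holds_def stack_ids_def)
  then show ?thesis
    by (auto simp: is_stack_def word_cells_def split_beta hd_conv_nth top_sym_def split: list.splits dest!: spec[of _ 0])
qed

lemma holds_update:
  assumes "holds ts out s" "i \<in> stack_ids" "is_stack t w" "set w \<subseteq> {..<6}"
  shows "holds (ts[i := t]) out (s(i := w))"
  using assms by (auto simp: holds_def stack_ids_def nth_list_update)

lemma runs_weaken: "runs c s t s' \<Longrightarrow> t \<le> t' \<Longrightarrow> s' = s'' \<Longrightarrow> runs c s t' s''"
  unfolding runs_def by (meson le_trans)

lemma runs_Seq:
  assumes "runs c s t1 s1" "runs d s1 t2 s2"
  shows "runs (Seq c d) s (1 + t1 + t2) s2"
  unfolding runs_def
proof (intro allI impI)
  fix ts out assume "holds ts out s"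
  then obtain t1' ts1 where 1: "t1' \<le> t1" "exec c ts t1' ts1" "holds ts1 out s1"
    using assms(1) unfolding runs_def by blast
  then obtain t2' ts2 where 2: "t2' \<le> t2" "exec d ts1 t2' ts2" "holds ts2 out s2"
    using assms(2) unfolding runs_def by blast
  show "\<exists>t'\<le>1 + t1 + t2. \<exists>ts'. exec (Seq c d) ts t' ts' \<and> holds ts' out s2"
    using exec_Seq[OF 1(2) 2(2)] 1 2 by (intro exI[of _ "1 + t1' + t2'"]) auto
qed

definition on_top :: "nat \<Rightarrow> nat set \<Rightarrow> com \<Rightarrow> com \<Rightarrow> com" where
  "on_top i X = Cond (\<lambda>ss. ss ! i \<in> X)"

definition while_top :: "nat \<Rightarrow> nat set \<Rightarrow> com \<Rightarrow> com" where
  "while_top i X = While (\<lambda>ss. ss ! i \<in> X)"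

lemma runs_on_top:
  assumes "i \<in> stack_ids" "runs (if top_sym (s i) \<in> X then c else d) s t s'"
  shows "runs (on_top i X c d) s (1 + t) s'"
  unfolding runs_def
proof (intro allI impI)
  fix ts out assume h: "holds ts out s"
  then obtain t' ts' where 1: "t' \<le> t" "exec (if top_sym (s i) \<in> X then c else d) ts t' ts'" "holds ts' out s'"
    using assms(2) unfolding runs_def by blast
  have "exec (on_top i X c d) ts (1 + t') ts'"
    unfolding on_top_def
  proof (cases "read_heads ts ! i \<in> X")
    case True
    then show "exec (Cond (\<lambda>ss. ss ! i \<in> X) c d) ts (1 + t') ts'"
      using 1(2) read_heads_top[OF h assms(1)] by (intro exec_CondT) auto
  next
    case False
    then show "exec (Cond (\<lambda>ss. ss ! i \<in> X) c d) ts (1 + t') ts'"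
      using 1(2) read_heads_top[OF h assms(1)] by (intro exec_CondF) auto
  qed
  then show "\<exists>t'\<le>1 + t. \<exists>ts'. exec (on_top i X c d) ts t' ts' \<and> holds ts' out s'"
    using 1 by (intro exI[of _ "1 + t'"]) auto
qed

lemma runs_while_stop:
  assumes "i \<in> stack_ids" "top_sym (s i) \<notin> X"
  shows "runs (while_top i X c) s 1 s"
  unfolding runs_def while_top_def
  using assms read_heads_top exec_WhileF[of "\<lambda>ss. ss ! i \<in> X"] by (metis order_refl)

lemma runs_while_step:
  assumes "i \<in> stack_ids" "top_sym (s i) \<in> X" "runs c s t1 s1" "runs (while_top i X c) s1 t2 s2"
  shows "runs (while_top i X c) s (1 + t1 + t2) s2"
  unfolding runs_def
proof (intro allI impI)
  fix ts out assume h: "holds ts out s"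
  then obtain t1' ts1 where 1: "t1' \<le> t1" "exec c ts t1' ts1" "holds ts1 out s1"
    using assms(3) unfolding runs_def by blast
  then obtain t2' ts2 where 2: "t2' \<le> t2" "exec (while_top i X c) ts1 t2' ts2" "holds ts2 out s2"
    using assms(4) unfolding runs_def by blast
  have "read_heads ts ! i \<in> X" using read_heads_top[OF h assms(1)] assms(2) by simp
  then have "exec (while_top i X c) ts (1 + t1' + t2') ts2"
    using 1(2) 2(2) unfolding while_top_def by (intro exec_WhileT)
  then show "\<exists>t'\<le>1 + t1 + t2. \<exists>ts'. exec (while_top i X c) ts t' ts' \<and> holds ts' out s2"
    using 1 2 by (intro exI[of _ "1 + t1' + t2'"]) auto
qed

section \<open>Elementary stack operations\<close>

definition pop :: "nat \<Rightarrow> com" where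
  "pop i = Act i (\<lambda>ss. ss ! i) Right"

text \<open>An action writes before it moves, so a push takes two: the old top is written back while
  the head moves left, then the new symbol is written in place. Consequently \<open>f\<close> sees
  the heads after the move.\<close>

definition push_with :: "nat \<Rightarrow> (nat list \<Rightarrow> nat) \<Rightarrow> com" where
  "push_with i f = Seq (Act i (\<lambda>ss. ss ! i) Left) (Act i f Stay)"

definition push :: "nat \<Rightarrow> nat \<Rightarrow> com" where
  "push i a = push_with i (\<lambda>ss. a)"

definition copy_top :: "nat \<Rightarrow> nat \<Rightarrow> com" where
  "copy_top i j = push_with j (\<lambda>ss. ss ! i)"

lemma runs_pop:
  assumes "i \<in> stack_ids"
  shows "runs (pop i) s 1 (s(i := tl (s i)))"
  unfolding runs_def
proof (intro allI impI)
  fix ts out assume h: "holds ts out s"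
  obtain c p where t: "ts ! i = (c, p)" by force
  have st: "is_stack (c, p) (s i)" and sub: "set (s i) \<subseteq> {..<6}"
    using h assms t by (auto simp: holds_def)
  have "is_stack (act (a, Right) (c, p)) (tl (s i))" for a
    unfolding is_stack_def
  proof (intro allI impI)
    fix j :: int assume "0 \<le> j"
    then have "c (p + (j + 1)) = word_cells (s i) (j + 1)"
      using st unfolding is_stack_def by (metis add_nonneg_nonneg fst_conv snd_conv zero_le_one)
    then show "fst (act (a, Right) (c, p)) (snd (act (a, Right) (c, p)) + j) = word_cells (tl (s i)) j"
      using \<open>0 \<le> j\<close> by (cases "s i") (auto simp: act_def word_cells_def nat_add_distrib algebra_simps)
  qed
  moreover have "set (tl (s i)) \<subseteq> {..<6}" using sub by (cases "s i") auto
  ultimately have "holds (do_act i (\<lambda>ss. ss ! i) Right ts) out (s(i := tl (s i)))"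
    using holds_update[OF h assms] t by (simp add: do_act_def)
  then show "\<exists>t'\<le>1. \<exists>ts'. exec (pop i) ts t' ts' \<and> holds ts' out (s(i := tl (s i)))"
    unfolding pop_def using exec_Act by blast
qed

lemma runs_push_with:
  assumes i: "i \<in> stack_ids"
    and f: "\<And>ts out. holds ts out s \<Longrightarrow> f (read_heads (do_act i (\<lambda>ss. ss ! i) Left ts)) = a" "a < 6"
  shows "runs (push_with i f) s 3 (s(i := a # s i))"
  unfolding runs_def
proof (intro allI impI)
  fix ts out assume h: "holds ts out s"
  obtain c p where t: "ts ! i = (c, p)" by force
  have len: "i < length ts" using h i by (auto simp: holds_def stack_ids_def)
  have st: "is_stack (c, p) (s i)" and sub: "set (s i) \<subseteq> {..<6}"
    using h i t by (auto simp: holds_def)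
  have cp: "c p = top_sym (s i)" using read_heads_top[OF h i] len t by simp
  \<comment> \<open>Writing back reduces the symbol modulo \<open>6\<close>, which changes nothing
    only for symbols below \<open>6\<close>.\<close>
  then have "c p < 6" using sub by (cases "s i") auto
  define ts1 where "ts1 = do_act i (\<lambda>ss. ss ! i) Left ts"
  have "act (c p, Left) (c, p) = (c, p - 1)"
    by (auto simp: act_def)
  then have ts1: "ts1 = ts[i := (c, p - 1)]"
    using t len \<open>c p < 6\<close> by (simp add: ts1_def do_act_def)
  have "f (read_heads ts1) = a" using f(1)[OF h] by (simp add: ts1_def)
  then have ts2: "do_act i f Stay ts1 = ts[i := (c(p - 1 := a), p - 1)]"
    using f(2) len by (simp add: do_act_def ts1 act_def)
  have "is_stack (c(p - 1 := a), p - 1) (a # s i)"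
    unfolding is_stack_def
  proof (intro allI impI)
    fix j :: int assume "0 \<le> j"
    show "fst (c(p - 1 := a), p - 1) (snd (c(p - 1 := a), p - 1) + j) = word_cells (a # s i) j"
    proof (cases "j = 0")
      case False
      then have "c (p + (j - 1)) = word_cells (s i) (j - 1)"
        using st \<open>0 \<le> j\<close> unfolding is_stack_def fst_conv snd_conv by (metis diff_ge_0_iff_ge int_one_le_iff_zero_less le_less)
      then show ?thesis
        using \<open>0 \<le> j\<close> False by (auto simp: word_cells_def nth_Cons' nat_diff_distrib algebra_simps)
    qed (simp add: word_cells_def)
  qed
  then have "holds (do_act i f Stay ts1) out (s(i := a # s i))"
    using holds_update[OF h i] ts2 f(2) sub by simp
  moreover have "exec (push_with i f) ts (1 + 1 + 1) (do_act i f Stay ts1)"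
    unfolding push_with_def ts1_def by (rule exec_Seq[OF exec_Act exec_Act])
  ultimately show "\<exists>t'\<le>3. \<exists>ts'. exec (push_with i f) ts t' ts' \<and> holds ts' out (s(i := a # s i))"
    by (intro exI[of _ "1 + 1 + 1"]) auto
qed

lemma runs_push: "i \<in> stack_ids \<Longrightarrow> a < 6 \<Longrightarrow> runs (push i a) s 3 (s(i := a # s i))"
  unfolding push_def by (rule runs_push_with) auto

lemma runs_copy_top:
  assumes "i \<in> stack_ids" "j \<in> stack_ids" "i \<noteq> j" "top_sym (s i) < 6"
  shows "runs (copy_top i j) s 3 (s(j := top_sym (s i) # s j))"
  unfolding copy_top_def
proof (rule runs_push_with)
  fix ts out assume h: "holds ts out s"
  have "read_heads (do_act j (\<lambda>ss. ss ! j) Left ts) ! i = read_heads ts ! i"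
    using h assms by (auto simp: holds_def stack_ids_def do_act_def nth_list_update)
  then show "read_heads (do_act j (\<lambda>ss. ss ! j) Left ts) ! i = top_sym (s i)"
    using read_heads_top[OF h assms(1)] by simp
qed (use assms in auto)

section \<open>Trees on stacks\<close>

datatype tree = L1 | L2 | L3 | Node tree tree

fun code :: "tree \<Rightarrow> nat list" where
  "code L1 = [1]"
| "code L2 = [2]"
| "code L3 = [3]"
| "code (Node t u) = 4 # code t @ code u"

lemma code_symbols: "set (code t) \<subseteq> {1..<5}"
  by (induction t) auto

lemma length_code_pos: "0 < length (code t)"
  by (cases t) auto

fun copy_tops :: "nat \<Rightarrow> nat list \<Rightarrow> com" where
  "copy_tops i [] = pop i"
| "copy_tops i (j # js) = Seq (copy_top i j) (copy_tops i js)"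

text \<open>The symbol \<open>5\<close> separates the data that is being moved from the rest of a stack.\<close>

definition drain :: "nat \<Rightarrow> nat list \<Rightarrow> com" where
  "drain i js = Seq (while_top i (- {5}) (copy_tops i js)) (pop i)"

lemma runs_copy_tops:
  assumes "i \<in> stack_ids" "set js \<subseteq> stack_ids" "i \<notin> set js" "distinct js" "top_sym (s i) < 6"
  shows "runs (copy_tops i js) s (4 * length js + 1)
    (\<lambda>l. if l = i then tl (s i) else if l \<in> set js then top_sym (s i) # s l else s l)"
  using assms
proof (induction js arbitrary: s)
  case Nil
  then show ?case
    by (auto intro!: runs_weaken[OF runs_pop[OF Nil(1), of s]] simp: fun_eq_iff)
next
  case (Cons j js)
  let ?s = "s(j := top_sym (s i) # s j)"
  have "runs (copy_tops i js) ?s (4 * length js + 1)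
    (\<lambda>l. if l = i then tl (?s i) else if l \<in> set js then top_sym (?s i) # ?s l else ?s l)"
    using Cons.prems by (intro Cons.IH) auto
  moreover have "runs (copy_top i j) s 3 ?s"
    using Cons.prems by (intro runs_copy_top) auto
  ultimately show ?case
    using Cons.prems unfolding copy_tops.simps
    by (intro runs_weaken[OF runs_Seq]) (auto simp: fun_eq_iff)
qed

text \<open>Popping symbol by symbol reverses the word, hence \<open>rev w\<close>; every use of
  \<open>drain\<close> has to account for this reversal.\<close>

lemma runs_drain:
  assumes "i \<in> stack_ids" "set js \<subseteq> stack_ids" "i \<notin> set js" "distinct js"
    and "s i = w @ 5 # r" "set w \<subseteq> {1..<5}"
  shows "runs (drain i js) s ((4 * length js + 2) * length w + 3)
    (\<lambda>l. if l = i then r else if l \<in> set js then rev w @ s l else s l)"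
proof -
  let ?W = "while_top i (- {5}) (copy_tops i js)"
  have "runs ?W s ((4 * length js + 2) * length w + 1)
    (\<lambda>l. if l = i then 5 # r else if l \<in> set js then rev w @ s l else s l)"
    using assms
  proof (induction w arbitrary: s)
    case Nil
    then have "(\<lambda>l. if l = i then 5 # r else if l \<in> set js then rev [] @ s l else s l) = s"
      by (auto simp: fun_eq_iff)
    moreover have "runs ?W s 1 s" using Nil by (intro runs_while_stop) auto
    ultimately show ?case by simp
  next
    case (Cons a w)
    let ?s = "\<lambda>l. if l = i then tl (s i) else if l \<in> set js then top_sym (s i) # s l else s l"
    have "runs (copy_tops i js) s (4 * length js + 1) ?s"
      using Cons.prems by (intro runs_copy_tops) auto
    moreover have "runs ?W ?s ((4 * length js + 2) * length w + 1)
      (\<lambda>l. if l = i then 5 # r else if l \<in> set js then rev w @ ?s l else ?s l)"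
      using Cons.prems by (intro Cons.IH) auto
    moreover have "top_sym (s i) \<in> - {5}" using Cons.prems by auto
    ultimately have "runs ?W s (1 + (4 * length js + 1) + ((4 * length js + 2) * length w + 1))
      (\<lambda>l. if l = i then 5 # r else if l \<in> set js then rev w @ ?s l else ?s l)"
      using assms(1) by (intro runs_while_step)
    then show ?case
      by (rule runs_weaken) (use Cons.prems in \<open>auto simp: fun_eq_iff\<close>)
  qed
  moreover have "runs (pop i) (\<lambda>l. if l = i then 5 # r else if l \<in> set js then rev w @ s l else s l) 1
    (\<lambda>l. if l = i then r else if l \<in> set js then rev w @ s l else s l)"
    by (rule runs_weaken[OF runs_pop]) (use assms in \<open>auto simp: fun_eq_iff\<close>)
  ultimately show ?thesis
    unfolding drain_def by (rule runs_weaken[OF runs_Seq]) auto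
qed

text \<open>Stack \<open>4\<close> counts, in unary, the subtrees that remain to be read.\<close>

definition move_tree :: "nat \<Rightarrow> com" where
  "move_tree j = Seq (push j 5) (Seq (push 4 5) (Seq (push 4 1) (Seq
     (while_top 4 (- {5}) (Seq (copy_top 0 j)
        (on_top 0 {4} (Seq (pop 0) (push 4 1)) (Seq (pop 0) (pop 4))))) (pop 4))))"

text \<open>The loop does not stop after a subtree, so its remaining run is taken as a hypothesis
  with time \<open>T\<close> and result \<open>s'\<close>. In this form the two subtrees of a node
  can be chained inside one and the same loop. One round costs at most \<open>12\<close>.\<close>

lemma runs_move_tree_loop:
  assumes "j = 2 \<or> j = 3"
    and W: "W = while_top 4 (- {5}) (Seq (copy_top 0 j)
        (on_top 0 {4} (Seq (pop 0) (push 4 1)) (Seq (pop 0) (pop 4))))"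
  shows "s 0 = code t @ r \<Longrightarrow> s 4 = 1 # d \<Longrightarrow>
    runs W (s(0 := r, j := rev (code t) @ s j, 4 := d)) T s' \<Longrightarrow> runs W s (T + 12 * length (code t)) s'"
proof (induction t arbitrary: s r d T)
  have leaf: "runs W s (T + 12) s'"
    if "s 0 = a # r" "s 4 = 1 # d" "a \<in> {1, 2, 3}" "runs W (s(0 := r, j := a # s j, 4 := d)) T s'"
    for s r d T a
  proof -
    let ?s1 = "s(0 := r, j := a # s j, 4 := d)"
    have "runs (copy_top 0 j) s 3 (s(j := a # s j))"
      using that assms by (intro runs_weaken[OF runs_copy_top]) auto
    moreover have "runs (Seq (pop 0) (pop 4)) (s(j := a # s j)) (1 + 1 + 1) ?s1"
      using that(1,2) assms(1)
      by (intro runs_weaken[OF runs_Seq[OF runs_pop runs_pop]]) (auto simp: fun_eq_iff)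
    then have "runs (on_top 0 {4} (Seq (pop 0) (push 4 1)) (Seq (pop 0) (pop 4))) (s(j := a # s j)) (1 + (1 + 1 + 1)) ?s1"
      using that assms(1) by (intro runs_on_top) auto
    ultimately show ?thesis
      unfolding W by (intro runs_weaken[OF runs_while_step[OF _ _ runs_Seq that(4)[unfolded W]]]) (use that in auto)
  qed
  {
    case L1
    have "runs W (s(0 := r, j := 1 # s j, 4 := d)) T s'" using L1(3) by (simp only: code.simps rev.simps append.simps)
    from leaf[OF _ _ _ this] show ?case using L1(1,2) by simp
  next
    case L2
    have "runs W (s(0 := r, j := 2 # s j, 4 := d)) T s'" using L2(3) by (simp only: code.simps rev.simps append.simps)
    from leaf[OF _ _ _ this] show ?case using L2(1,2) by simp
  next
    case L3
    have "runs W (s(0 := r, j := 3 # s j, 4 := d)) T s'" using L3(3) by (simp only: code.simps rev.simps append.simps)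
    from leaf[OF _ _ _ this] show ?case using L3(1,2) by simp
  next
  case (Node t u)
  \<comment> \<open>The node symbol has been moved, and one pending subtree has become two.\<close>
  let ?s1 = "s(0 := code t @ code u @ r, j := 4 # s j, 4 := 1 # s 4)"
  have "runs (Seq (copy_top 0 j)
        (on_top 0 {4} (Seq (pop 0) (push 4 1)) (Seq (pop 0) (pop 4)))) s (1 + 3 + (1 + (1 + 1 + 3))) ?s1"
  proof (rule runs_weaken[OF runs_Seq])
    show "runs (copy_top 0 j) s 3 (s(j := 4 # s j))"
      using assms Node.prems by (intro runs_weaken[OF runs_copy_top]) auto
    have "runs (Seq (pop 0) (push 4 1)) (s(j := 4 # s j)) (1 + 1 + 3) ?s1"
      by (rule runs_weaken[OF runs_Seq[OF runs_pop runs_push]])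
        (use assms Node.prems in \<open>auto simp: fun_eq_iff\<close>)
    then show "runs (on_top 0 {4} (Seq (pop 0) (push 4 1)) (Seq (pop 0) (pop 4))) (s(j := 4 # s j))
        (1 + (1 + 1 + 3)) ?s1"
      using assms Node.prems by (intro runs_on_top) auto
  qed auto
  moreover have "runs W ?s1 (T + 12 * length (code u) + 12 * length (code t)) s'"
  proof (rule Node.IH(1))
    show "runs W (?s1(0 := code u @ r, j := rev (code t) @ ?s1 j, 4 := 1 # d)) (T + 12 * length (code u)) s'"
    proof (rule Node.IH(2))
      show "runs W (?s1(0 := code u @ r, j := rev (code t) @ ?s1 j, 4 := 1 # d,
          0 := r, j := rev (code u) @ (?s1(0 := code u @ r, j := rev (code t) @ ?s1 j, 4 := 1 # d)) j, 4 := d)) T s'"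
        by (rule back_subst[of "\<lambda>x. runs W x T s'", OF Node.prems(3)])
          (use assms(1) in \<open>auto simp: fun_eq_iff\<close>)
    qed (use assms(1) in auto)
  qed (use Node.prems assms(1) in auto)
  moreover have "top_sym (s 4) \<in> - {5}" using Node.prems by simp
  ultimately have "runs W s (1 + (1 + 3 + (1 + (1 + 1 + 3))) + (T + 12 * length (code u) + 12 * length (code t))) s'"
    unfolding W by (intro runs_while_step) simp_all
  then show ?case by (rule runs_weaken) simp_all
  }
qed

lemma runs_move_tree:
  assumes "j = 2 \<or> j = 3" "s 0 = code t @ r"
  shows "runs (move_tree j) s (12 * length (code t) + 15) (s(0 := r, j := rev (code t) @ 5 # s j))"
proof -
  let ?W = "while_top 4 (- {5}) (Seq (copy_top 0 j)
        (on_top 0 {4} (Seq (pop 0) (push 4 1)) (Seq (pop 0) (pop 4))))"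
  let ?s1 = "s(j := 5 # s j)" let ?s2 = "?s1(4 := 5 # s 4)" let ?s3 = "?s2(4 := 1 # 5 # s 4)"
  let ?s4 = "?s3(0 := r, j := rev (code t) @ ?s3 j, 4 := 5 # s 4)"
  have 1: "runs (push j 5) s 3 ?s1" "runs (push 4 5) ?s1 3 ?s2" "runs (push 4 1) ?s2 3 ?s3"
    using assms(1) by (auto intro!: runs_weaken[OF runs_push])
  have "runs ?W ?s4 1 ?s4"
    by (rule runs_while_stop) auto
  then have 2: "runs ?W ?s3 (1 + 12 * length (code t)) ?s4"
    by (rule runs_move_tree_loop[OF assms(1) refl, rotated 2]) (use assms in auto)
  have 3: "runs (pop 4) ?s4 1 (s(0 := r, j := rev (code t) @ 5 # s j))"
    by (rule runs_weaken[OF runs_pop]) (use assms(1) in \<open>auto simp: fun_eq_iff\<close>)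
  show ?thesis
    unfolding move_tree_def
    by (rule runs_weaken[OF runs_Seq[OF 1(1) runs_Seq[OF 1(2) runs_Seq[OF 1(3) runs_Seq[OF 2 3]]]]]) auto
qed

abbreviation above :: "nat list \<Rightarrow> (nat \<Rightarrow> nat list) \<Rightarrow> nat \<Rightarrow> nat list" where
  "above w s \<equiv> s(0 := w @ s 0)"

text \<open>The reversed code on stack \<open>2\<close> comes out in order on stacks
  \<open>0\<close> and \<open>3\<close>. The copy on stack \<open>3\<close> returns through stack
  \<open>2\<close>, because only two further reversals leave it in order on stack
  \<open>0\<close>.\<close>

definition duplicate :: com where
  "duplicate = Seq (move_tree 2) (Seq (push 3 5) (Seq (drain 2 [0, 3]) (Seq (push 2 5)
     (Seq (drain 3 [2]) (drain 2 [0])))))"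

definition swap :: com where
  "swap = Seq (move_tree 2) (Seq (move_tree 3) (Seq (drain 2 [0]) (drain 3 [0])))"

definition discard :: com where
  "discard = Seq (move_tree 2) (drain 2 [])"

lemma code_symbols': "set (rev (code t)) \<subseteq> {1..<5}"
  using code_symbols by simp

lemma runs_duplicate:
  "runs duplicate (above (code t) s) (34 * length (code t) + 35) (above (code t @ code t) s)"
proof -
  let ?c = "code t"
  let ?s1 = "s(2 := rev ?c @ 5 # s 2)" let ?s2 = "?s1(3 := 5 # s 3)"
  let ?s3 = "s(0 := ?c @ s 0, 3 := ?c @ 5 # s 3)" let ?s4 = "?s3(2 := 5 # s 2)"
  let ?s5 = "s(0 := ?c @ s 0, 2 := rev ?c @ 5 # s 2)"
  have 1: "runs (move_tree 2) (above ?c s) (12 * length ?c + 15) ?s1"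
    by (rule runs_weaken[OF runs_move_tree]) auto
  have 2: "runs (push 3 5) ?s1 3 ?s2"
    by (rule runs_weaken[OF runs_push]) auto
  have 3: "runs (drain 2 [0, 3]) ?s2 (10 * length ?c + 3) ?s3"
    by (rule runs_weaken[OF runs_drain[where w = "rev ?c" and r = "s 2"]]) (use code_symbols' in \<open>auto simp: fun_eq_iff\<close>)
  have 4: "runs (push 2 5) ?s3 3 ?s4"
    by (rule runs_weaken[OF runs_push]) auto
  have 5: "runs (drain 3 [2]) ?s4 (6 * length ?c + 3) ?s5"
    by (rule runs_weaken[OF runs_drain[where w = ?c and r = "s 3"]]) (use code_symbols in \<open>auto simp: fun_eq_iff\<close>)
  have 6: "runs (drain 2 [0]) ?s5 (6 * length ?c + 3) (above (?c @ ?c) s)"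
    by (rule runs_weaken[OF runs_drain[where w = "rev ?c" and r = "s 2"]]) (use code_symbols' in \<open>auto simp: fun_eq_iff\<close>)
  show ?thesis
    unfolding duplicate_def
    by (rule runs_weaken[OF runs_Seq[OF 1 runs_Seq[OF 2 runs_Seq[OF 3 runs_Seq[OF 4 runs_Seq[OF 5 6]]]]]]) auto
qed

lemma runs_swap:
  "runs swap (above (code t @ code u) s) (18 * (length (code t) + length (code u)) + 39) (above (code u @ code t) s)"
proof -
  let ?s1 = "s(0 := code u @ s 0, 2 := rev (code t) @ 5 # s 2)"
  let ?s2 = "s(2 := rev (code t) @ 5 # s 2, 3 := rev (code u) @ 5 # s 3)"
  let ?s3 = "s(0 := code t @ s 0, 3 := rev (code u) @ 5 # s 3)"
  have 1: "runs (move_tree 2) (above (code t @ code u) s) (12 * length (code t) + 15) ?s1"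
    by (rule runs_weaken[OF runs_move_tree]) auto
  have 2: "runs (move_tree 3) ?s1 (12 * length (code u) + 15) ?s2"
    by (rule runs_weaken[OF runs_move_tree]) auto
  have 3: "runs (drain 2 [0]) ?s2 (6 * length (code t) + 3) ?s3"
    by (rule runs_weaken[OF runs_drain[where w = "rev (code t)" and r = "s 2"]]) (use code_symbols' in \<open>auto simp: fun_eq_iff\<close>)
  have 4: "runs (drain 3 [0]) ?s3 (6 * length (code u) + 3) (above (code u @ code t) s)"
    by (rule runs_weaken[OF runs_drain[where w = "rev (code u)" and r = "s 3"]]) (use code_symbols' in \<open>auto simp: fun_eq_iff\<close>)
  show ?thesis
    unfolding swap_def
    by (rule runs_weaken[OF runs_Seq[OF 1 runs_Seq[OF 2 runs_Seq[OF 3 4]]]]) auto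
qed

lemma runs_discard: "runs discard (above (code t) s) (14 * length (code t) + 19) s"
proof -
  let ?s1 = "s(2 := rev (code t) @ 5 # s 2)"
  have 1: "runs (move_tree 2) (above (code t) s) (12 * length (code t) + 15) ?s1"
    by (rule runs_weaken[OF runs_move_tree]) auto
  have 2: "runs (drain 2 []) ?s1 (2 * length (code t) + 3) s"
    by (rule runs_weaken[OF runs_drain[where w = "rev (code t)" and r = "s 2"]]) (use code_symbols' in \<open>auto simp: fun_eq_iff\<close>)
  show ?thesis
    unfolding discard_def by (rule runs_weaken[OF runs_Seq[OF 1 2]]) auto
qed


section \<open>Polynomial bounds\<close>

text \<open>The base \<open>n + 2\<close> is at least \<open>2\<close>, so constants and sums are
  absorbed by a larger exponent, and the bound is monotone in \<open>n\<close>.\<close>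

definition poly_bounded :: "(nat \<Rightarrow> nat) \<Rightarrow> bool" where
  "poly_bounded g \<longleftrightarrow> (\<exists>k. \<forall>n. g n \<le> (n + 2) ^ k)"

named_theorems poly_intros

lemma poly_bounded_const [poly_intros]: "poly_bounded (\<lambda>n. c)"
proof -
  have "c \<le> (n + 2) ^ c" for n
    using less_exp[of c] power_mono[of 2 "n + 2" c] by simp
  then show ?thesis unfolding poly_bounded_def by blast
qed

lemma poly_bounded_id [poly_intros]: "poly_bounded (\<lambda>n. n)"
  unfolding poly_bounded_def by (rule exI[of _ 1]) simp

lemma poly_bounded_mult [poly_intros]:
  assumes "poly_bounded f" "poly_bounded g"
  shows "poly_bounded (\<lambda>n. f n * g n)"
proof -
  obtain a b where "\<And>n. f n \<le> (n + 2) ^ a" "\<And>n. g n \<le> (n + 2) ^ b"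
    using assms unfolding poly_bounded_def by blast
  then have "f n * g n \<le> (n + 2) ^ (a + b)" for n
    by (simp add: power_add mult_mono)
  then show ?thesis unfolding poly_bounded_def by blast
qed

lemma poly_bounded_add [poly_intros]:
  assumes "poly_bounded f" "poly_bounded g"
  shows "poly_bounded (\<lambda>n. f n + g n)"
proof -
  obtain a b where ab: "\<And>n. f n \<le> (n + 2) ^ a" "\<And>n. g n \<le> (n + 2) ^ b"
    using assms unfolding poly_bounded_def by blast
  have "f n + g n \<le> (n + 2) ^ (1 + (a + b))" for n
  proof -
    have *: "x + y \<le> 2 * (x * y)" if "1 \<le> x" "1 \<le> y" for x y :: nat
    proof -
      have "x \<le> x * y" "y \<le> x * y" using that by simp_all
      then show ?thesis by linarith
    qed
    have "f n + g n \<le> (n + 2) ^ a + (n + 2) ^ b" using ab by (intro add_mono)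
    also have "\<dots> \<le> 2 * ((n + 2) ^ a * (n + 2) ^ b)" by (rule *) simp_all
    also have "\<dots> \<le> (n + 2) * ((n + 2) ^ a * (n + 2) ^ b)" by (rule mult_le_mono1) simp
    finally show ?thesis by (simp add: power_add)
  qed
  then show ?thesis unfolding poly_bounded_def by blast
qed

lemma poly_bounded_power [poly_intros]: "poly_bounded f \<Longrightarrow> poly_bounded (\<lambda>n. f n ^ k)"
  by (induction k) (auto intro: poly_intros)

section \<open>Encodable types and polynomial-time functions\<close>

class enc =
  fixes enc :: "'a \<Rightarrow> tree"

definition cd :: "'a::enc \<Rightarrow> nat list" where
  "cd x = code (enc x)"

definition sz :: "'a::enc \<Rightarrow> nat" where
  "sz x = length (cd x)"

text \<open>One exponent bounds both the size of the result and the time. Quantifying over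
  \<open>s\<close> says that the program works on top of any other data and leaves it intact, which
  is what makes programs composable. Outside \<open>D\<close> nothing is promised.\<close>

definition fp_on :: "'a set \<Rightarrow> ('a::enc \<Rightarrow> 'b::enc) \<Rightarrow> bool" where
  "fp_on D f \<longleftrightarrow> (\<exists>P k. \<forall>x\<in>D. sz (f x) \<le> (sz x + 2) ^ k \<and>
     (\<forall>s. runs P (above (cd x) s) ((sz x + 2) ^ k) (above (cd (f x)) s)))"

abbreviation fp :: "('a::enc \<Rightarrow> 'b::enc) \<Rightarrow> bool" where
  "fp \<equiv> fp_on UNIV"

named_theorems fp_intros

lemma sz_pos: "0 < sz x"
  using length_code_pos by (simp only: sz_def cd_def)

lemma runs_dup: "runs duplicate (above (cd x) s) (34 * sz x + 35) (above (cd x @ cd x) s)"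
  unfolding cd_def sz_def by (rule runs_duplicate)

lemma runs_swp: "runs swap (above (cd x @ cd y) s) (18 * (sz x + sz y) + 39) (above (cd y @ cd x) s)"
  unfolding cd_def sz_def by (rule runs_swap)

lemma runs_dsc: "runs discard (above (cd x) s) (14 * sz x + 19) s"
  unfolding cd_def sz_def by (rule runs_discard)

lemma runs_dsc_above: "runs discard (above (cd x @ w) s) (14 * sz x + 19) (above w s)"
  using runs_dsc[where x = x and s = "above w s"] by simp

lemma fp_onI:
  assumes "poly_bounded T"
    and "\<And>x. x \<in> D \<Longrightarrow> sz (f x) \<le> T (sz x)"
    and "\<And>x s. x \<in> D \<Longrightarrow> runs P (above (cd x) s) (T (sz x)) (above (cd (f x)) s)"
  shows "fp_on D f"
proof -
  obtain k where k: "T n \<le> (n + 2) ^ k" for n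
    using assms(1) unfolding poly_bounded_def by blast
  show ?thesis
    unfolding fp_on_def
    by (intro exI[of _ P] exI[of _ k] ballI conjI allI) (use assms(2,3) k in \<open>blast intro: le_trans runs_weaken\<close>)+
qed

lemma fp_onE:
  assumes "fp_on D f"
  obtains P k where "\<And>x. x \<in> D \<Longrightarrow> sz (f x) \<le> (sz x + 2) ^ k"
    and "\<And>x s. x \<in> D \<Longrightarrow> runs P (above (cd x) s) ((sz x + 2) ^ k) (above (cd (f x)) s)"
    and "\<And>x s w. x \<in> D \<Longrightarrow> runs P (above (cd x @ w) s) ((sz x + 2) ^ k) (above (cd (f x) @ w) s)"
proof -
  obtain P k where P: "\<forall>x\<in>D. sz (f x) \<le> (sz x + 2) ^ k \<and>
     (\<forall>s. runs P (above (cd x) s) ((sz x + 2) ^ k) (above (cd (f x)) s))"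
    using assms unfolding fp_on_def by blast
  then have "runs P (above (cd x @ w) s) ((sz x + 2) ^ k) (above (cd (f x) @ w) s)" if "x \<in> D" for x w s
    using that P[rule_format, of x, THEN conjunct2, rule_format, of "above w s"] by simp
  then show ?thesis using that P by blast
qed

lemma fp_on_subset: "fp_on D f \<Longrightarrow> E \<subseteq> D \<Longrightarrow> fp_on E f"
  unfolding fp_on_def by blast

lemma fp_fp_on: "fp f \<Longrightarrow> fp_on D f"
  by (rule fp_on_subset) auto

text \<open>Only encodings matter, so values of different types with the same tree can be exchanged
  at no cost. This gives constructors, destructors and conversions without new programs.\<close>

lemma fp_on_cong: "fp_on D f \<Longrightarrow> (\<And>x. x \<in> D \<Longrightarrow> enc (g x) = enc (f x)) \<Longrightarrow> fp_on D g"
  unfolding fp_on_def sz_def cd_def by simp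

lemma fp_on_comp:
  assumes "fp_on E g" "fp_on D f" "\<And>x. x \<in> D \<Longrightarrow> f x \<in> E"
  shows "fp_on D (\<lambda>x. g (f x))"
proof -
  obtain P k where P: "\<And>x. x \<in> D \<Longrightarrow> sz (f x) \<le> (sz x + 2) ^ k"
    "\<And>x s. x \<in> D \<Longrightarrow> runs P (above (cd x) s) ((sz x + 2) ^ k) (above (cd (f x)) s)"
    using assms(2) by (rule fp_onE) (rule that; assumption)
  obtain R l where R: "\<And>y. y \<in> E \<Longrightarrow> sz (g y) \<le> (sz y + 2) ^ l"
    "\<And>y s. y \<in> E \<Longrightarrow> runs R (above (cd y) s) ((sz y + 2) ^ l) (above (cd (g y)) s)"
    using assms(1) by (rule fp_onE) (rule that; assumption)
  show ?thesis
  proof (rule fp_onI[where P = "Seq P R"])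
    show "poly_bounded (\<lambda>n. 1 + (n + 2) ^ k + ((n + 2) ^ k + 2) ^ l)"
      by (intro poly_intros)
    fix x assume x: "x \<in> D"
    have *: "(sz (f x) + 2) ^ l \<le> ((sz x + 2) ^ k + 2) ^ l"
      using P(1)[OF x] by (intro power_mono) auto
    show "sz (g (f x)) \<le> 1 + (sz x + 2) ^ k + ((sz x + 2) ^ k + 2) ^ l"
      using R(1)[OF assms(3)[OF x]] * by simp
    show "runs (Seq P R) (above (cd x) s) (1 + (sz x + 2) ^ k + ((sz x + 2) ^ k + 2) ^ l) (above (cd (g (f x))) s)" for s
      by (rule runs_weaken[OF runs_Seq[OF P(2)[OF x] R(2)[OF assms(3)[OF x]]]]) (use * in auto)
  qed
qed

lemma fp_comp: "fp g \<Longrightarrow> fp f \<Longrightarrow> fp (\<lambda>x. g (f x))"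
  by (rule fp_on_comp) auto

text \<open>The program language has no empty program; a push followed by a pop on stack
  \<open>2\<close> takes its place.\<close>

lemma fp_on_recode:
  assumes "\<And>x. x \<in> D \<Longrightarrow> enc (f x) = enc x"
  shows "fp_on D f"
proof (rule fp_onI[where P = "Seq (push 2 1) (pop 2)"])
  show "poly_bounded (\<lambda>n. n + 5)" by (intro poly_intros)
  show "runs (Seq (push 2 1) (pop 2)) (above (cd x) s) (sz x + 5) (above (cd (f x)) s)" if "x \<in> D" for x s
    by (rule runs_weaken[OF runs_Seq[OF runs_push runs_pop]]) (use that assms in \<open>auto simp: cd_def\<close>)
qed (auto simp: sz_def cd_def assms)

lemma fp_id [fp_intros]: "fp (\<lambda>x. x)"
  by (rule fp_on_recode) simp

instantiation prod :: (enc, enc) enc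
begin
definition enc_prod :: "'a \<times> 'b \<Rightarrow> tree" where
  "enc_prod p = Node (enc (fst p)) (enc (snd p))"
instance ..
end

instantiation bool :: enc
begin
definition enc_bool :: "bool \<Rightarrow> tree" where
  "enc_bool b = (if b then L2 else L1)"
instance ..
end

instantiation list :: (enc) enc
begin
primrec enc_list :: "'a list \<Rightarrow> tree" where
  "enc_list [] = L1"
| "enc_list (x # xs) = Node (enc x) (enc_list xs)"
instance ..
end

text \<open>Unary, so that a polynomial size bound is a polynomial bound on the value. The tree of
  \<open>Suc n\<close> is that of the pair \<open>(False, n)\<close>, and \<open>n\<close> has the
  tree of a list of \<open>n\<close> entries \<open>False\<close>.\<close>

instantiation nat :: enc
begin
primrec enc_nat :: "nat \<Rightarrow> tree" where
  "enc_nat 0 = L1"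
| "enc_nat (Suc n) = Node L1 (enc_nat n)"
instance ..
end

lemma cd_pair: "cd (x, y) = 4 # cd x @ cd y"
  by (simp add: cd_def enc_prod_def)

lemma sz_simps [simp]:
  "sz (x, y) = 1 + sz x + sz y"
  "sz b = 1"
  "sz ([] :: 'a::enc list) = 1"
  "sz (z # zs) = 1 + sz z + sz zs"
  "sz n = 2 * n + 1" for b :: bool and n :: nat and z :: "'a::enc"
  by (simp_all add: sz_def cd_def enc_prod_def enc_bool_def) (induction n, auto)

lemma fp_on_Pair:
  assumes "fp_on D f" "fp_on D g"
  shows "fp_on D (\<lambda>x. (f x, g x))"
proof -
  obtain P k where P: "\<And>x. x \<in> D \<Longrightarrow> sz (f x) \<le> (sz x + 2) ^ k"
    "\<And>x s w. x \<in> D \<Longrightarrow> runs P (above (cd x @ w) s) ((sz x + 2) ^ k) (above (cd (f x) @ w) s)"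
    using assms(1) by (rule fp_onE) (rule that; assumption)
  obtain R l where R: "\<And>x. x \<in> D \<Longrightarrow> sz (g x) \<le> (sz x + 2) ^ l"
    "\<And>x s w. x \<in> D \<Longrightarrow> runs R (above (cd x @ w) s) ((sz x + 2) ^ l) (above (cd (g x) @ w) s)"
    using assms(2) by (rule fp_onE) (rule that; assumption)
  let ?T = "\<lambda>n. 200 + 52 * n + (n + 2) ^ k + (n + 2) ^ l + 18 * ((n + 2) ^ k + n) + 18 * ((n + 2) ^ k + (n + 2) ^ l)"
  show ?thesis
  proof (rule fp_onI[where P = "Seq duplicate (Seq P (Seq swap (Seq R (Seq swap (push 0 4)))))"])
    show "poly_bounded ?T" by (intro poly_intros)
    fix x assume x: "x \<in> D"
    show "sz (f x, g x) \<le> ?T (sz x)"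
      using P(1)[OF x] R(1)[OF x] by simp
    have push: "runs (push 0 4) (above (cd (f x) @ cd (g x)) s) 3 (above (cd (f x, g x)) s)" for s
      by (rule runs_weaken[OF runs_push]) (auto simp: cd_pair)
    show "runs (Seq duplicate (Seq P (Seq swap (Seq R (Seq swap (push 0 4))))))
       (above (cd x) s) (?T (sz x)) (above (cd (f x, g x)) s)" for s
      by (rule runs_weaken[OF runs_Seq[OF runs_dup runs_Seq[OF P(2)[OF x] runs_Seq[OF runs_swp
            runs_Seq[OF R(2)[OF x] runs_Seq[OF runs_swp push]]]]]])
        (use P(1)[OF x] R(1)[OF x] in auto)
  qed
qed

lemmas fp_Pair [fp_intros] = fp_on_Pair[of UNIV]

lemma fp_fst_prim: "fp fst"
proof (rule fp_onI[where P = "Seq (pop 0) (Seq swap discard)"])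
  show "poly_bounded (\<lambda>n. 200 + 100 * n)" by (intro poly_intros)
  fix p :: "'a \<times> 'b"
  show "sz (fst p) \<le> 200 + 100 * sz p" by (cases p) simp
  show "runs (Seq (pop 0) (Seq swap discard)) (above (cd p) s) (200 + 100 * sz p) (above (cd (fst p)) s)" for s
  proof -
    have 1: "runs (pop 0) (above (cd p) s) 1 (above (cd (fst p) @ cd (snd p)) s)"
      by (rule runs_weaken[OF runs_pop]) (auto simp: cd_def enc_prod_def)
    show ?thesis
      by (rule runs_weaken[OF runs_Seq[OF 1 runs_Seq[OF runs_swp runs_dsc_above]]]) (cases p, auto)
  qed
qed

lemma fp_snd_prim: "fp snd"
proof (rule fp_onI[where P = "Seq (pop 0) discard"])
  show "poly_bounded (\<lambda>n. 200 + 100 * n)" by (intro poly_intros)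
  fix p :: "'a \<times> 'b"
  show "sz (snd p) \<le> 200 + 100 * sz p" by (cases p) simp
  show "runs (Seq (pop 0) discard) (above (cd p) s) (200 + 100 * sz p) (above (cd (snd p)) s)" for s
  proof -
    have 1: "runs (pop 0) (above (cd p) s) 1 (above (cd (fst p) @ cd (snd p)) s)"
      by (rule runs_weaken[OF runs_pop]) (auto simp: cd_def enc_prod_def)
    show ?thesis
      by (rule runs_weaken[OF runs_Seq[OF 1 runs_dsc_above]]) (cases p, auto)
  qed
qed

lemmas fp_fst [fp_intros] = fp_comp[OF fp_fst_prim]
lemmas fp_snd [fp_intros] = fp_comp[OF fp_snd_prim]

lemma fp_case_prod [fp_intros]:
  "fp (\<lambda>x. h x (fst (p x)) (snd (p x))) \<Longrightarrow> fp (\<lambda>x. case p x of (a, b) \<Rightarrow> h x a b)"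
  by (simp add: case_prod_beta)

fun push_word :: "nat list \<Rightarrow> com" where
  "push_word [] = Seq (push 2 1) (pop 2)"
| "push_word (a # w) = Seq (push_word w) (push 0 a)"

lemma runs_push_word: "set w \<subseteq> {..<6} \<Longrightarrow> runs (push_word w) s (5 + 4 * length w) (above w s)"
proof (induction w)
  case Nil
  show ?case unfolding push_word.simps
    by (rule runs_weaken[OF runs_Seq[OF runs_push runs_pop]]) auto
next
  case (Cons a w)
  have "runs (push_word w) s (5 + 4 * length w) (above w s)" by (rule Cons.IH) (use Cons.prems in simp)
  moreover have "runs (push 0 a) (above w s) 3 (above (a # w) s)"
    by (rule runs_weaken[OF runs_push]) (use Cons.prems in auto)
  ultimately show ?case
    unfolding push_word.simps by (rule runs_weaken[OF runs_Seq]) auto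
qed

lemma fp_const [fp_intros]: "fp (\<lambda>x. c)"
proof (rule fp_onI[where P = "Seq discard (push_word (cd c))"])
  show "poly_bounded (\<lambda>n. 200 + 100 * n + 5 * sz c)" by (intro poly_intros)
  have "set (cd c) \<subseteq> {..<6}" using code_symbols[of "enc c"] by (auto simp: cd_def)
  note push = runs_push_word[OF this, folded sz_def]
  show "runs (Seq discard (push_word (cd c))) (above (cd x) s) (200 + 100 * sz x + 5 * sz c) (above (cd c) s)" for x :: 'a and s
    by (rule runs_weaken[OF runs_Seq[OF runs_dsc push]]) auto
qed auto

text \<open>The test \<open>c\<close> runs on a copy of the input, and only the first symbol of its
  result is inspected before the result is discarded. Each branch needs to be polynomial only on the
  inputs that reach it.\<close>

lemma fp_on_branch:
  assumes c: "fp_on D c" and f: "fp_on (D \<inter> {x. b x}) f" and g: "fp_on (D \<inter> {x. \<not> b x}) g"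
    and X: "\<And>x. x \<in> D \<Longrightarrow> hd (cd (c x)) \<in> X \<longleftrightarrow> b x"
  shows "fp_on D (\<lambda>x. if b x then f x else g x)"
proof -
  obtain C j where C: "\<And>x. x \<in> D \<Longrightarrow> sz (c x) \<le> (sz x + 2) ^ j"
    "\<And>x s w. x \<in> D \<Longrightarrow> runs C (above (cd x @ w) s) ((sz x + 2) ^ j) (above (cd (c x) @ w) s)"
    using c by (rule fp_onE) (rule that; assumption)
  obtain P k where P: "\<And>x. x \<in> D \<inter> {x. b x} \<Longrightarrow> sz (f x) \<le> (sz x + 2) ^ k"
    "\<And>x s. x \<in> D \<inter> {x. b x} \<Longrightarrow> runs P (above (cd x) s) ((sz x + 2) ^ k) (above (cd (f x)) s)"
    using f by (rule fp_onE) (rule that; assumption)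
  obtain R l where R: "\<And>x. x \<in> D \<inter> {x. \<not> b x} \<Longrightarrow> sz (g x) \<le> (sz x + 2) ^ l"
    "\<And>x s. x \<in> D \<inter> {x. \<not> b x} \<Longrightarrow> runs R (above (cd x) s) ((sz x + 2) ^ l) (above (cd (g x)) s)"
    using g by (rule fp_onE) (rule that; assumption)
  let ?T = "\<lambda>n. 200 + 50 * n + 15 * (n + 2) ^ j + (n + 2) ^ k + (n + 2) ^ l"
  show ?thesis
  proof (rule fp_onI[where P = "Seq duplicate (Seq C (on_top 0 X (Seq discard P) (Seq discard R)))"])
    show "poly_bounded ?T" by (intro poly_intros)
    fix x assume x: "x \<in> D"
    show "sz (if b x then f x else g x) \<le> ?T (sz x)"
      using P(1)[of x] R(1)[of x] x by (cases "b x") simp_all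
    have ne: "cd (c x) \<noteq> []" using sz_pos[of "c x"] by (auto simp: sz_def)
    show "runs (Seq duplicate (Seq C (on_top 0 X (Seq discard P) (Seq discard R))))
       (above (cd x) s) (?T (sz x)) (above (cd (if b x then f x else g x)) s)" for s
    proof -
      have "top_sym ((above (cd (c x) @ cd x) s) 0) \<in> X \<longleftrightarrow> b x"
        using X[OF x] ne by (cases "cd (c x)") auto
      moreover have "runs (Seq discard P) (above (cd (c x) @ cd x) s) (1 + (14 * sz (c x) + 19) + (sz x + 2) ^ k) (above (cd (f x)) s)" if "b x"
        using P(2)[of x] x that by (intro runs_Seq[OF runs_dsc_above]) auto
      moreover have "runs (Seq discard R) (above (cd (c x) @ cd x) s) (1 + (14 * sz (c x) + 19) + (sz x + 2) ^ l) (above (cd (g x)) s)" if "\<not> b x"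
        using R(2)[of x] x that by (intro runs_Seq[OF runs_dsc_above]) auto
      ultimately have "runs (if top_sym ((above (cd (c x) @ cd x) s) 0) \<in> X then Seq discard P else Seq discard R)
          (above (cd (c x) @ cd x) s) (1 + (14 * sz (c x) + 19) + ((sz x + 2) ^ k + (sz x + 2) ^ l))
          (above (cd (if b x then f x else g x)) s)"
        by (cases "b x") (auto intro: runs_weaken)
      note 1 = runs_on_top[OF _ this]
      show ?thesis
        by (rule runs_weaken[OF runs_Seq[OF runs_dup runs_Seq[OF C(2)[OF x] 1]]])
          (use C(1)[OF x] in auto)
    qed
  qed
qed

lemma fp_if [fp_intros]: "fp b \<Longrightarrow> fp f \<Longrightarrow> fp g \<Longrightarrow> fp (\<lambda>x. if b x then f x else g x)"
  by (rule fp_on_branch[where X = "{2}" and c = b]) (auto simp: cd_def enc_bool_def intro: fp_fp_on)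

lemma hd_cd_list: "hd (cd xs) = 1 \<longleftrightarrow> xs = []" for xs :: "'a::enc list"
  by (cases xs) (simp_all add: cd_def)

lemma hd_cd_nat: "hd (cd n) = 1 \<longleftrightarrow> n = 0" for n :: nat
  by (cases n) (simp_all add: cd_def)

lemma fp_case_list [fp_intros]:
  assumes l: "fp l" and g: "fp g" and h: "fp (\<lambda>z. h (fst z) (fst (snd z)) (snd (snd z)))"
  shows "fp (\<lambda>x. case l x of [] \<Rightarrow> g x | y # ys \<Rightarrow> h x y ys)"
proof -
  let ?D = "UNIV \<inter> {x. l x \<noteq> []}"
  have "fp_on ?D (\<lambda>x. (x, (hd (l x), tl (l x))))"
  proof (rule fp_on_Pair)
    \<comment> \<open>A nonempty list has the same tree as the pair of its head and its
      tail.\<close>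
    show "fp_on ?D (\<lambda>x. (hd (l x), tl (l x)))"
      by (rule fp_on_cong[OF fp_fp_on[OF l]]) (auto simp: enc_prod_def neq_Nil_conv)
  qed (rule fp_fp_on[OF fp_id])
  from fp_on_comp[OF h this] have "fp_on ?D (\<lambda>x. h x (hd (l x)) (tl (l x)))" by simp
  then have "fp (\<lambda>x. if l x = [] then g x else h x (hd (l x)) (tl (l x)))"
    by (intro fp_on_branch[where X = "{1}" and c = l] l fp_fp_on[OF g]) (simp_all add: hd_cd_list[simplified])
  then show ?thesis
    by (rule fp_on_cong) (auto split: list.splits)
qed

lemma fp_case_nat [fp_intros]:
  assumes l: "fp l" and g: "fp g" and h: "fp (\<lambda>z. h (fst z) (snd z))"
  shows "fp (\<lambda>x. case l x of 0 \<Rightarrow> g x | Suc n \<Rightarrow> h x n)"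
proof -
  let ?D = "UNIV \<inter> {x. l x \<noteq> 0}"
  \<comment> \<open>A positive number has the same tree as the pair of \<open>False\<close> and its
    predecessor.\<close>
  have "fp_on ?D (\<lambda>x. (False, l x - 1))"
    by (rule fp_on_cong[OF fp_fp_on[OF l]]) (auto simp: enc_prod_def enc_bool_def gr0_conv_Suc)
  from fp_on_comp[OF fp_snd_prim this] have "fp_on ?D (\<lambda>x. (x, l x - 1))"
    by (intro fp_on_Pair fp_fp_on[OF fp_id]) simp_all
  from fp_on_comp[OF h this] have "fp_on ?D (\<lambda>x. h x (l x - 1))" by simp
  then have "fp (\<lambda>x. if l x = 0 then g x else h x (l x - 1))"
    by (intro fp_on_branch[where X = "{1}" and c = l] l fp_fp_on[OF g]) (simp_all add: hd_cd_nat[simplified])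
  then show ?thesis
    by (rule fp_on_cong) (auto split: nat.splits)
qed

lemma fp_Cons [fp_intros]: "fp f \<Longrightarrow> fp g \<Longrightarrow> fp (\<lambda>x. f x # g x)"
  by (rule fp_on_cong[OF fp_Pair]) (auto simp: enc_prod_def)

lemma fp_Suc [fp_intros]: "fp f \<Longrightarrow> fp (\<lambda>x. Suc (f x))"
  by (rule fp_on_cong[OF fp_Pair[OF fp_const[of False]]]) (auto simp: enc_prod_def enc_bool_def)

subsection \<open>Iteration\<close>

text \<open>The number \<open>n x\<close> is never computed: the loop stops by testing
  \<open>c\<close>, and \<open>n x\<close> only counts its rounds. The size bound is demanded of
  every iterate, since each of them is processed by \<open>c\<close> and \<open>f\<close>.\<close>

lemma fp_on_while:
  fixes f :: "'a::enc \<Rightarrow> 'a"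
  assumes c: "fp c" and f: "fp f"
    and cont: "\<And>x i. x \<in> D \<Longrightarrow> i < n x \<Longrightarrow> c ((f ^^ i) x)"
    and stop: "\<And>x. x \<in> D \<Longrightarrow> \<not> c ((f ^^ n x) x)"
    and N: "poly_bounded N" "\<And>x. x \<in> D \<Longrightarrow> n x \<le> N (sz x)"
    and S: "poly_bounded S" "\<And>x i. x \<in> D \<Longrightarrow> i \<le> n x \<Longrightarrow> sz ((f ^^ i) x) \<le> S (sz x)"
  shows "fp_on D (\<lambda>x. (f ^^ n x) x)"
proof -
  obtain C j where C: "\<And>x. x \<in> UNIV \<Longrightarrow> sz (c x) \<le> (sz x + 2) ^ j"
    "\<And>x s w. x \<in> UNIV \<Longrightarrow> runs C (above (cd x @ w) s) ((sz x + 2) ^ j) (above (cd (c x) @ w) s)"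
    using c by (rule fp_onE) (rule that; assumption)
  obtain P k where P: "\<And>x. x \<in> UNIV \<Longrightarrow> sz (f x) \<le> (sz x + 2) ^ k"
    "\<And>x s. x \<in> UNIV \<Longrightarrow> runs P (above (cd x) s) ((sz x + 2) ^ k) (above (cd (f x)) s)"
    using f by (rule fp_onE) (rule that; assumption)
  let ?body = "Seq discard (Seq P (Seq duplicate C))"
  let ?W = "while_top 0 {2} ?body"
  define B :: "nat \<Rightarrow> nat" where "B m = 200 + 50 * m + (m + 2) ^ j + (m + 2) ^ k" for m
  define T where "T m = (N m + 2) * (B (S m) + 1)" for m
  have B_mono: "B m \<le> B m'" if "m \<le> m'" for m m'
    unfolding B_def using that by (intro add_mono mult_le_mono power_mono) auto
  have test: "runs (Seq duplicate C) (above (cd x) s) (1 + (34 * sz x + 35) + (sz x + 2) ^ j)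
      (above (cd (c x) @ cd x) s)" for x s
    by (rule runs_Seq[OF runs_dup C(2)]) simp
  have top: "top_sym ((above (cd (c x) @ cd x) s) 0) \<in> {2} \<longleftrightarrow> c x" for x s
    by (auto simp: cd_def enc_bool_def)
  show ?thesis
  proof (rule fp_onI[where P = "Seq (Seq duplicate C) (Seq ?W discard)" and T = T])
    show "poly_bounded T" unfolding T_def B_def by (intro poly_intros N S)
    fix x assume x: "x \<in> D"
    let ?m = "S (sz x)"
    \<comment> \<open>Induction on the number \<open>i\<close> of rounds still to go; the outcome of
      the latest test lies on top of the current iterate.\<close>
    have loop: "runs ?W (above (cd (c ((f ^^ (n x - i)) x)) @ cd ((f ^^ (n x - i)) x)) s)
        (1 + i * (1 + B ?m)) (above (cd False @ cd ((f ^^ n x) x)) s)" if "i \<le> n x" for i s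
      using that
    proof (induction i)
      case 0
      have "runs ?W (above (cd False @ cd ((f ^^ n x) x)) s) 1 (above (cd False @ cd ((f ^^ n x) x)) s)"
        by (rule runs_while_stop) (auto simp: cd_def enc_bool_def)
      moreover have "c ((f ^^ n x) x) = False" using stop[OF x] by simp
      ultimately show ?case by (simp only: diff_zero mult_0 add_0_right)
    next
      case (Suc i)
      let ?y = "(f ^^ (n x - Suc i)) x"
      have "n x - i = Suc (n x - Suc i)" using Suc.prems by simp
      then have y: "c ?y" "f ?y = (f ^^ (n x - i)) x"
        using cont[OF x, of "n x - Suc i"] Suc.prems by simp_all
      have sy: "sz ?y \<le> ?m" "sz (f ?y) \<le> ?m"
        using S(2)[OF x] y(2) by auto
      have "runs ?body (above (cd (c ?y) @ cd ?y) s)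
        (1 + (14 * sz (c ?y) + 19) + (1 + (sz ?y + 2) ^ k + (1 + (34 * sz (f ?y) + 35) + (sz (f ?y) + 2) ^ j)))
        (above (cd (c (f ?y)) @ cd (f ?y)) s)"
        by (rule runs_Seq[OF runs_dsc_above runs_Seq[OF P(2) test]]) simp
      moreover have "1 + (14 * sz (c ?y) + 19) + (1 + (sz ?y + 2) ^ k + (1 + (34 * sz (f ?y) + 35) + (sz (f ?y) + 2) ^ j)) \<le> B ?m"
        using power_mono[of "sz ?y + 2" "?m + 2" k] power_mono[of "sz (f ?y) + 2" "?m + 2" j] sy
        by (simp add: B_def)
      ultimately have "runs ?body (above (cd (c ?y) @ cd ?y) s) (B ?m) (above (cd (c (f ?y)) @ cd (f ?y)) s)"
        using runs_weaken by blast
      moreover have "runs ?W (above (cd (c (f ?y)) @ cd (f ?y)) s) (1 + i * (1 + B ?m)) (above (cd False @ cd ((f ^^ n x) x)) s)"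
        unfolding y(2) by (rule Suc.IH) (use Suc.prems in simp)
      moreover have "top_sym ((above (cd (c ?y) @ cd ?y) s) 0) \<in> {2}"
        using top y(1) by blast
      ultimately have "runs ?W (above (cd (c ?y) @ cd ?y) s) (1 + B ?m + (1 + i * (1 + B ?m))) (above (cd False @ cd ((f ^^ n x) x)) s)"
        by (intro runs_while_step[of 0]) simp_all
      then show ?case by (rule runs_weaken[OF _ _ refl]) simp
    qed
    have sx: "sz x \<le> ?m" "sz ((f ^^ n x) x) \<le> ?m"
      using S(2)[OF x, of 0] S(2)[OF x, of "n x"] by auto
    have "1 + n x * (1 + B ?m) + 2 * B ?m \<le> (n x + 2) * (B ?m + 1)"
      by (simp add: algebra_simps)
    also have "\<dots> \<le> T (sz x)" unfolding T_def using N(2)[OF x] by (intro mult_le_mono) auto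
    finally have T: "1 + n x * (1 + B ?m) + 2 * B ?m \<le> T (sz x)" .
    moreover have "?m \<le> B ?m" by (simp add: B_def)
    ultimately show "sz ((f ^^ n x) x) \<le> T (sz x)"
      using sx(2) by linarith
    have 1: "runs ?W (above (cd (c x) @ cd x) s) (1 + n x * (1 + B ?m)) (above (cd False @ cd ((f ^^ n x) x)) s)" for s
      using loop[of "n x"] by (simp only: diff_self_eq_0 funpow_0 order_refl simp_thms)
    have "(1 + (1 + (34 * sz x + 35) + (sz x + 2) ^ j) + (1 + (1 + n x * (1 + B ?m)) + (14 * sz False + 19)))
       \<le> T (sz x)"
      using T power_mono[of "sz x + 2" "?m + 2" j] sx(1) by (simp add: B_def)
    then show "runs (Seq (Seq duplicate C) (Seq ?W discard)) (above (cd x) s) (T (sz x)) (above (cd ((f ^^ n x) x)) s)" for s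
      by (rule runs_weaken[OF runs_Seq[OF test runs_Seq[OF 1 runs_dsc_above]] _ refl])
  qed
qed


section \<open>Sizes, bounded folds, lists and unary arithmetic\<close>

lemma sz_prod: "sz z = 1 + sz (fst z) + sz (snd z)"
  by (cases z) simp

lemma sz_le_mem: "y \<in> set ys \<Longrightarrow> sz y \<le> sz ys"
  by (induction ys) auto

lemma sz_drop_le: "sz (drop i ys) \<le> sz ys"
proof (induction ys arbitrary: i)
  case (Cons y ys)
  show ?case using Cons.IH[of "i - 1"] by (cases i) auto
qed simp

lemma length_le_sz: "length ys \<le> sz ys"
  by (induction ys) auto

lemma fp_not [fp_intros]: "fp b \<Longrightarrow> fp (\<lambda>x. \<not> b x)"
proof -
  assume "fp b"
  then have "fp (\<lambda>x. if b x then False else True)" by (intro fp_intros)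
  then show ?thesis by (rule fp_on_cong) auto
qed

lemma fp_conj [fp_intros]: "fp a \<Longrightarrow> fp b \<Longrightarrow> fp (\<lambda>x. a x \<and> b x)"
proof -
  assume "fp a" "fp b"
  then have "fp (\<lambda>x. if a x then b x else False)" by (intro fp_intros)
  then show ?thesis by (rule fp_on_cong) auto
qed

lemma fp_disj [fp_intros]: "fp a \<Longrightarrow> fp b \<Longrightarrow> fp (\<lambda>x. a x \<or> b x)"
proof -
  assume "fp a" "fp b"
  then have "fp (\<lambda>x. if a x then True else b x)" by (intro fp_intros)
  then show ?thesis by (rule fp_on_cong) auto
qed

lemma fp_eq_bool [fp_intros]: "fp a \<Longrightarrow> fp b \<Longrightarrow> fp (\<lambda>x. a x = (b x :: bool))"
proof -
  assume "fp a" "fp b"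
  then have "fp (\<lambda>x. if a x then b x else \<not> b x)" by (intro fp_intros)
  then show ?thesis by (rule fp_on_cong) auto
qed

lemma fp_is_Nil [fp_intros]: "fp l \<Longrightarrow> fp (\<lambda>x. l x = [])"
proof -
  assume "fp l"
  then have "fp (\<lambda>x. case l x of [] \<Rightarrow> True | y # ys \<Rightarrow> False)" by (intro fp_intros)
  then show ?thesis by (rule fp_on_cong) (auto split: list.splits)
qed

lemma fp_is_0 [fp_intros]: "fp l \<Longrightarrow> fp (\<lambda>x. l x = (0::nat))"
proof -
  assume "fp l"
  then have "fp (\<lambda>x. case l x of 0 \<Rightarrow> True | Suc n \<Rightarrow> False)" by (intro fp_intros)
  then show ?thesis by (rule fp_on_cong) (auto split: nat.splits)
qed

lemma fp_foldl:
  fixes F :: "'x::enc \<Rightarrow> 'a::enc \<Rightarrow> 'y::enc \<Rightarrow> 'a"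
  assumes F: "fp (\<lambda>z. F (fst z) (fst (snd z)) (snd (snd z)))" and l: "fp l" and a: "fp a"
    and S: "poly_bounded S"
      "\<And>x i. i \<le> length (l x) \<Longrightarrow> sz (foldl (F x) (a x) (take i (l x))) \<le> S (sz x)"
  shows "fp (\<lambda>x. foldl (F x) (a x) (l x))"
proof -
  define c :: "'y list \<times> 'a \<times> 'x \<Rightarrow> bool" where "c = (\<lambda>z. \<not> fst z = [])"
  define f :: "'y list \<times> 'a \<times> 'x \<Rightarrow> 'y list \<times> 'a \<times> 'x" where
    "f = (\<lambda>z. case fst z of [] \<Rightarrow> z | y # ys \<Rightarrow> (ys, F (snd (snd z)) (fst (snd z)) y, snd (snd z)))"
  \<comment> \<open>The loop carries the remaining list, the accumulator and the parameter. Only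
    start states of this shape are considered, since the bound \<open>S\<close> speaks about the
    accumulators that arise from them.\<close>
  define D where "D = range (\<lambda>x. (l x, a x, x))"
  obtain k where k: "S m \<le> (m + 2) ^ k" for m
    using S(1) unfolding poly_bounded_def by blast
  have fF: "fp (\<lambda>x. F (g x) (h x) (j x))" if "fp g" "fp h" "fp j" for g h j
    using fp_comp[OF F fp_Pair[OF that(1) fp_Pair[OF that(2,3)]]] by simp
  have iter: "(f ^^ i) (ys, b, x) = (drop i ys, foldl (F x) b (take i ys), x)" if "i \<le> length ys" for i ys b x
    using that
  proof (induction i)
    case (Suc i)
    then have "drop i ys = ys ! i # drop (Suc i) ys" "take (Suc i) ys = take i ys @ [ys ! i]"
      by (simp_all add: Cons_nth_drop_Suc take_Suc_conv_app_nth)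
    then show ?case using Suc by (simp add: f_def)
  qed simp
  have "fp c" unfolding c_def by (intro fp_intros)
  moreover have "fp f" unfolding f_def by (intro fp_intros fF)
  ultimately have "fp_on D (\<lambda>z. (f ^^ length (fst z)) z)"
  proof (rule fp_on_while[where N = "\<lambda>m. m" and S = "\<lambda>m. 2 + 2 * m + (m + 2) ^ k"])
    fix z i assume z: "z \<in> D"
    then obtain x where zx: "z = (l x, a x, x)" by (auto simp: D_def)
    show "c ((f ^^ i) z)" if "i < length (fst z)"
      using that by (auto simp: zx iter c_def)
    show "\<not> c ((f ^^ length (fst z)) z)"
      by (auto simp: zx iter c_def)
    show "length (fst z) \<le> sz z"
      using length_le_sz[of "l x"] by (simp add: zx)
    assume i: "i \<le> length (fst z)"
    have "sz (foldl (F x) (a x) (take i (l x))) \<le> (sz x + 2) ^ k"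
      using S(2)[of i x] i k[of "sz x"] by (auto simp: zx)
    also have "\<dots> \<le> (sz z + 2) ^ k" by (rule power_mono) (auto simp: zx)
    finally show "sz ((f ^^ i) z) \<le> 2 + 2 * sz z + (sz z + 2) ^ k"
      using i sz_drop_le[of i "l x"] by (simp add: zx iter)
  qed (intro poly_intros)+
  moreover have "fp (\<lambda>x. (l x, a x, x))" by (intro fp_intros l a)
  ultimately have "fp (\<lambda>x. (f ^^ length (fst (l x, a x, x))) (l x, a x, x))"
    by (rule fp_on_comp[where E = D]) (auto simp: D_def)
  then have "fp (\<lambda>x. fst (snd ((f ^^ length (fst (l x, a x, x))) (l x, a x, x))))"
    by (intro fp_intros)
  then show ?thesis by (simp add: iter)
qed

text \<open>For accumulators whose size is not additive although an equivalent measure is: the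
  linear comparison between \<open>sz\<close> and the measure is used only once, at the end, so its
  factor \<open>c\<close> does not accumulate over the rounds.\<close>

lemma fp_foldl_measure:
  fixes F :: "'x::enc \<Rightarrow> 'a::enc \<Rightarrow> 'y::enc \<Rightarrow> 'a"
  assumes F: "fp (\<lambda>z. F (fst z) (fst (snd z)) (snd (snd z)))" and l: "fp l" and a: "fp a"
    and \<mu>: "\<And>b. \<mu> b \<le> sz b" "\<And>b. sz b \<le> c * \<mu> b + c"
    and h: "poly_bounded h" "\<And>x b y. \<mu> (F x b y) \<le> \<mu> b + h (sz x + sz y)"
  shows "fp (\<lambda>x. foldl (F x) (a x) (l x))"
proof -
  obtain k where k: "h m \<le> (m + 2) ^ k" for m
    using h(1) unfolding poly_bounded_def by blast
  obtain k1 where k1: "\<And>x. sz (a x) \<le> (sz x + 2) ^ k1"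
    using a by (rule fp_onE) blast
  obtain k2 where k2: "\<And>x. sz (l x) \<le> (sz x + 2) ^ k2"
    using l by (rule fp_onE) blast
  let ?S = "\<lambda>n. c * ((n + 2) ^ k1 + (n + 2) ^ k2 * ((n + (n + 2) ^ k2) + 2) ^ k) + c"
  show ?thesis
  proof (rule fp_foldl[OF F l a])
    show "poly_bounded ?S" by (intro poly_intros)
    fix x i assume i: "i \<le> length (l x)"
    have *: "\<mu> (foldl (F x) b ys) \<le> \<mu> b + length ys * (sz x + sz (l x) + 2) ^ k" if "set ys \<subseteq> set (l x)" for b ys
      using that
    proof (induction ys arbitrary: b)
      case (Cons y ys)
      have "\<mu> (foldl (F x) (F x b y) ys) \<le> \<mu> (F x b y) + length ys * (sz x + sz (l x) + 2) ^ k"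
        using Cons by auto
      also have "\<mu> (F x b y) \<le> \<mu> b + (sz x + sz y + 2) ^ k"
        using h(2)[of x b y] k[of "sz x + sz y"] by linarith
      also have "(sz x + sz y + 2) ^ k \<le> (sz x + sz (l x) + 2) ^ k"
        using sz_le_mem[of y "l x"] Cons.prems by (intro power_mono) auto
      finally show ?case by simp
    qed simp
    have "\<mu> (foldl (F x) (a x) (take i (l x))) \<le> \<mu> (a x) + length (take i (l x)) * (sz x + sz (l x) + 2) ^ k"
      by (rule *) (rule set_take_subset)
    also have "\<dots> \<le> (sz x + 2) ^ k1 + (sz x + 2) ^ k2 * ((sz x + (sz x + 2) ^ k2) + 2) ^ k"
    proof (intro add_mono mult_le_mono power_mono)
      show "\<mu> (a x) \<le> (sz x + 2) ^ k1" using \<mu>(1) k1 le_trans by blast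
      show "length (take i (l x)) \<le> (sz x + 2) ^ k2"
        using length_le_sz[of "l x"] k2[of x] by auto
    qed (use k2 in auto)
    finally show "sz (foldl (F x) (a x) (take i (l x))) \<le> ?S (sz x)"
      using \<mu>(2) by (meson add_le_mono1 le_trans mult_le_mono2)
  qed
qed

lemma fp_foldl_additive:
  fixes F :: "'x::enc \<Rightarrow> 'a::enc \<Rightarrow> 'y::enc \<Rightarrow> 'a"
  assumes "fp (\<lambda>z. F (fst z) (fst (snd z)) (snd (snd z)))" "fp l" "fp a"
    and "poly_bounded h" "\<And>x b y. sz (F x b y) \<le> sz b + h (sz x + sz y)"
  shows "fp (\<lambda>x. foldl (F x) (a x) (l x))"
  by (rule fp_foldl_measure[OF assms(1-3), where \<mu> = sz and c = 1]) (use assms in auto)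

lemma fp_rev [fp_intros]: "fp l \<Longrightarrow> fp (\<lambda>x. rev (l x))"
proof -
  assume l: "fp l"
  have "fp (\<lambda>x. foldl (\<lambda>a y. y # a) [] (l x))"
    by (rule fp_foldl_additive[where h = "\<lambda>n. n + 1"]) ((intro fp_intros poly_intros l)+, simp)
  moreover have "foldl (\<lambda>a y. y # a) b ys = rev ys @ b" for b ys :: "'b list"
    by (induction ys arbitrary: b) auto
  ultimately show ?thesis by simp
qed

lemma fp_append [fp_intros]: "fp l \<Longrightarrow> fp m \<Longrightarrow> fp (\<lambda>x. l x @ m x)"
proof -
  assume l: "fp l" "fp m"
  have "fp (\<lambda>x. foldl (\<lambda>a y. y # a) (m x) (rev (l x)))"
    by (rule fp_foldl_additive[where h = "\<lambda>n. n + 1"]) ((intro fp_intros poly_intros l)+, simp)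
  moreover have "foldl (\<lambda>a y. y # a) b ys = rev ys @ b" for b ys :: "'b list"
    by (induction ys arbitrary: b) auto
  ultimately show ?thesis by simp
qed

lemma fp_length [fp_intros]: "fp l \<Longrightarrow> fp (\<lambda>x. length (l x))"
proof -
  assume l: "fp l"
  have "fp (\<lambda>x. foldl (\<lambda>a y. Suc a) 0 (l x))"
    by (rule fp_foldl_additive[where h = "\<lambda>n. n + 2"]) ((intro fp_intros poly_intros l)+, simp)
  moreover have "foldl (\<lambda>a y. Suc a) b ys = b + length ys" for b and ys :: "'b list"
    by (induction ys arbitrary: b) auto
  ultimately show ?thesis by simp
qed

lemma fp_map [fp_intros]:
  assumes F: "fp (\<lambda>z. F (fst z) (snd z))" and l: "fp l"
  shows "fp (\<lambda>x. map (F x) (l x))"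
proof -
  obtain k where k: "\<And>z. sz (F (fst z) (snd z)) \<le> (sz z + 2) ^ k"
    using F by (rule fp_onE) blast
  have fF: "fp (\<lambda>x. F (g x) (h x))" if "fp g" "fp h" for g h
    using fp_comp[OF F fp_Pair[OF that]] by simp
  have "fp (\<lambda>x. rev (foldl (\<lambda>a y. F x y # a) [] (l x)))"
  proof (intro fp_rev fp_foldl_additive[where h = "\<lambda>n. 1 + (n + 3) ^ k"])
    show "sz (F x y # b) \<le> sz b + (1 + (sz x + sz y + 3) ^ k)" for x y b
      using k[of "(x, y)"] by (simp add: add_ac eval_nat_numeral)
  qed (intro fp_intros poly_intros l fF)+
  moreover have "foldl (\<lambda>a y. F x y # a) b ys = rev (map (F x) ys) @ b" for x b ys
    by (induction ys arbitrary: b) auto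
  ultimately show ?thesis by simp
qed

lemma fp_zip [fp_intros]:
  assumes "fp l" "fp m"
  shows "fp (\<lambda>x. zip (l x) (m x))"
proof -
  define F where "F = (\<lambda>(p :: ('b \<times> 'c) list \<times> 'c list) (y :: 'b).
    case snd p of [] \<Rightarrow> p | z # zs \<Rightarrow> ((y, z) # fst p, zs))"
  have "fp (\<lambda>x. rev (fst (foldl F ([], m x) (l x))))"
  proof (intro fp_rev fp_fst fp_foldl_additive[where h = "\<lambda>n. n + 2"])
    show "sz (F p y) \<le> sz p + (sz x + sz y + 2)" for x :: 'a and p y
      by (cases p) (auto simp: F_def split: list.splits)
  qed (unfold F_def, (intro fp_intros poly_intros assms)+)
  moreover have "rev (fst (foldl F (a, zs) ys)) = rev a @ zip ys zs" for a ys zs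
    by (induction ys arbitrary: a zs) (auto simp: F_def split: list.splits)
  ultimately show ?thesis by simp
qed

text \<open>Unary numbers and lists of \<open>False\<close> have the same trees, so iterating a
  given number of times becomes a fold.\<close>

lemma fp_replicate_False: "fp n \<Longrightarrow> fp (\<lambda>x. replicate (n x) False)"
proof -
  assume n: "fp n"
  have "enc (replicate m False) = enc m" for m
    by (induction m) (auto simp: enc_bool_def)
  then show ?thesis by (intro fp_on_cong[OF n]) auto
qed

lemma fp_add [fp_intros]: "fp m \<Longrightarrow> fp n \<Longrightarrow> fp (\<lambda>x. m x + n x :: nat)"
proof -
  assume l: "fp m" "fp n"
  have "fp (\<lambda>x. foldl (\<lambda>a y. Suc a) (m x) (replicate (n x) False))"
    by (rule fp_foldl_additive[where h = "\<lambda>n. n + 2"]) ((intro fp_intros poly_intros fp_replicate_False l)+, simp)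
  moreover have "foldl (\<lambda>a y. Suc a) b ys = b + length ys" for b and ys :: "bool list"
    by (induction ys arbitrary: b) auto
  ultimately show ?thesis by simp
qed

lemma fp_mult [fp_intros]:
  assumes "fp m" "fp n"
  shows "fp (\<lambda>x. m x * n x :: nat)"
proof -
  have "fp (\<lambda>z :: nat \<times> nat. foldl (\<lambda>a y. a + snd z) 0 (replicate (fst z) False))"
  proof (rule fp_foldl_additive[where h = "\<lambda>n. n"])
    show "fp (\<lambda>z :: (nat \<times> nat) \<times> nat \<times> bool. fst (snd z) + snd (fst z))" by (intro fp_intros)
    show "fp (\<lambda>z :: nat \<times> nat. replicate (fst z) False)" by (intro fp_intros fp_replicate_False)
  qed ((intro fp_intros poly_intros)+, auto)
  moreover have "foldl (\<lambda>a y. a + k) b ys = b + length ys * k" for b k :: nat and ys :: "bool list"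
    by (induction ys arbitrary: b) auto
  ultimately have "fp (\<lambda>z. fst z * snd z :: nat)" by simp
  from fp_comp[OF this fp_Pair[OF assms]] show ?thesis by simp
qed

lemma fp_diff [fp_intros]:
  assumes "fp m" "fp n"
  shows "fp (\<lambda>x. m x - n x :: nat)"
proof -
  have "fp (\<lambda>x. foldl (\<lambda>a y. case a of 0 \<Rightarrow> 0 | Suc k \<Rightarrow> k) (m x) (replicate (n x) False))"
    by (rule fp_foldl_additive[where h = "\<lambda>n. n"])
      ((intro fp_intros poly_intros fp_replicate_False assms)+, auto split: nat.splits)
  moreover have "foldl (\<lambda>a y. case a of 0 \<Rightarrow> 0 | Suc k \<Rightarrow> k) b ys = b - length ys" for b and ys :: "bool list"
    by (induction ys arbitrary: b) (auto split: nat.splits)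
  ultimately show ?thesis by simp
qed

lemma fp_eq_nat [fp_intros]: "fp m \<Longrightarrow> fp n \<Longrightarrow> fp (\<lambda>x. m x = (n x :: nat))"
proof -
  assume "fp m" "fp n"
  then have "fp (\<lambda>x. m x - n x = 0 \<and> n x - m x = 0)" by (intro fp_intros)
  then show ?thesis by (rule fp_on_cong) (auto intro!: arg_cong[where f = enc])
qed

text \<open>Counting up to \<open>m x\<close> with a wrap-around at \<open>n x\<close> gives the
  remainder without any division; the successor keeps the modulus positive.\<close>

lemma fp_mod_Suc [fp_intros]:
  assumes "fp m" "fp n"
  shows "fp (\<lambda>x. m x mod Suc (n x))"
proof -
  have "fp (\<lambda>x. foldl (\<lambda>a y. if a = n x then 0 else Suc a) 0 (replicate (m x) False))"
  proof (rule fp_foldl_additive[where h = "\<lambda>n. 2"])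
    show "fp (\<lambda>z. if fst (snd z) = n (fst z) then 0 else Suc (fst (snd z)))"
      by (intro fp_intros fp_comp[OF assms(2)])
  qed ((intro fp_intros poly_intros fp_replicate_False assms)+, auto)
  moreover have "foldl (\<lambda>a y. if a = k then 0 else Suc a) (b mod Suc k) ys = (b + length ys) mod Suc k"
    for b k :: nat and ys :: "bool list"
  proof (induction ys arbitrary: b)
    case (Cons y ys)
    have "(if b mod Suc k = k then 0 else Suc (b mod Suc k)) = Suc b mod Suc k"
      by (simp add: mod_Suc)
    then show ?case using Cons[of "Suc b"] by simp
  qed simp
  from this[of _ 0] have "foldl (\<lambda>a y. if a = k then 0 else Suc a) 0 ys = length ys mod Suc k" for k and ys :: "bool list"
    by simp
  ultimately show ?thesis by simp
qed

lemma fp_foldr_additive: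
  assumes F: "fp (\<lambda>z. F (fst z) (fst (snd z)) (snd (snd z)))" and l: "fp l" and a: "fp a"
    and h: "poly_bounded h" "\<And>x b y. sz (F x y b) \<le> sz b + h (sz x + sz y)"
  shows "fp (\<lambda>x. foldr (F x) (l x) (a x))"
proof -
  have "fp (\<lambda>x. foldl (\<lambda>b y. F x y b) (a x) (rev (l x)))"
  proof (rule fp_foldl_additive[where h = h])
    show "fp (\<lambda>z. F (fst z) (snd (snd z)) (fst (snd z)))"
      using fp_comp[OF F, of "\<lambda>z. (fst z, (snd (snd z), fst (snd z)))"]
      by (simp add: fp_intros)
  qed (use assms in \<open>auto intro: fp_intros\<close>)
  then show ?thesis by (simp add: foldl_conv_foldr)
qed


section \<open>From functions on words to Turing machines\<close>

datatype symbol = S1 | S2 | S3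

primrec sym_val :: "symbol \<Rightarrow> nat" where
  "sym_val S1 = 1"
| "sym_val S2 = 2"
| "sym_val S3 = 3"

instantiation symbol :: enc
begin
primrec enc_symbol :: "symbol \<Rightarrow> tree" where
  "enc_symbol S1 = L1"
| "enc_symbol S2 = L2"
| "enc_symbol S3 = L3"
instance ..
end

lemma cd_symbol: "cd a = [sym_val a]" for a :: symbol
  by (cases a) (simp_all add: cd_def)

lemma cd_Nil: "cd ([] :: 'a::enc list) = [1]"
  by (simp add: cd_def)

lemma cd_Cons: "cd (x # xs) = 4 # cd x @ cd xs"
  by (simp add: cd_def)

lemma sym_val_range: "sym_val a \<in> {1..<4}"
  by (cases a) auto

lemma sym_val_less: "sym_val a < 6"
  by (cases a) auto

lemma sz_symbol [simp]: "sz a = 1" for a :: symbol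
  by (simp add: sz_def cd_symbol)

lemma sz_word: "sz w = 2 * length w + 1" for w :: "symbol list"
  by (induction w) auto

text \<open>A word and its tree code differ only by a \<open>4\<close> before each letter and a
  final \<open>1\<close>. The code is assembled in reverse on stack \<open>2\<close>; letters are
  nonzero, so the first blank marks the end of the input.\<close>

definition read_input :: com where
  "read_input = Seq (push 2 5) (Seq (while_top 0 (- {0}) (Seq (push 2 4) (Seq (copy_top 0 2) (pop 0))))
     (Seq (push 2 1) (drain 2 [0])))"

lemma runs_read_input:
  "runs read_input ((\<lambda>i::nat. [])(0 := map sym_val w)) (40 * length w + 40) ((\<lambda>i::nat. [])(0 := cd w))"
proof -
  let ?body = "Seq (push 2 4) (Seq (copy_top 0 2) (pop 0))"
  let ?W = "while_top 0 (- {0}) ?body"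
  let ?f = "\<lambda>w. concat (map (\<lambda>a. [4, sym_val a]) w)"
  have loop: "runs ?W ((\<lambda>i::nat. [])(0 := map sym_val w, 2 := r)) (10 * length w + 1) ((\<lambda>i::nat. [])(2 := rev (?f w) @ r))" for w r
  proof (induction w arbitrary: r)
    case Nil
    have "runs ?W ((\<lambda>i::nat. [])(2 := r)) 1 ((\<lambda>i::nat. [])(2 := r))"
      by (rule runs_while_stop) auto
    then show ?case by (simp add: fun_upd_def cong: if_cong)
  next
    case (Cons a w)
    let ?s = "(\<lambda>i::nat. [])(0 := map sym_val (a # w), 2 := r)"
    let ?s1 = "(\<lambda>i::nat. [])(0 := map sym_val (a # w), 2 := 4 # r)"
    let ?s2 = "(\<lambda>i::nat. [])(0 := map sym_val (a # w), 2 := sym_val a # 4 # r)"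
    let ?s3 = "(\<lambda>i::nat. [])(0 := map sym_val w, 2 := sym_val a # 4 # r)"
    have 1: "runs (push 2 4) ?s 3 ?s1"
      by (rule runs_weaken[OF runs_push]) auto
    have 2: "runs (copy_top 0 2) ?s1 3 ?s2"
      by (rule runs_weaken[OF runs_copy_top]) (use sym_val_range[of a] in auto)
    have 3: "runs (pop 0) ?s2 1 ?s3"
      by (rule runs_weaken[OF runs_pop]) (auto simp: fun_eq_iff)
    have "top_sym (?s 0) \<in> - {0}" using sym_val_range[of a] by auto
    from runs_while_step[OF _ this runs_Seq[OF 1 runs_Seq[OF 2 3]] Cons.IH]
    show ?case by (rule runs_weaken) (auto simp: fun_eq_iff)
  qed
  have f: "?f w @ [1] = cd w"
    by (induction w) (simp_all add: cd_Nil cd_Cons cd_symbol)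
  have range: "set (cd w) \<subseteq> {1..<5}"
    unfolding cd_def by (rule code_symbols)
  let ?s = "(\<lambda>i::nat. [])(0 := map sym_val w)"
  have 1: "runs (push 2 5) ?s 3 (?s(2 := [5]))"
    by (rule runs_weaken[OF runs_push]) auto
  have 2: "runs ?W (?s(2 := [5])) (10 * length w + 1) ((\<lambda>i::nat. [])(2 := rev (?f w) @ [5]))"
    by (rule loop)
  have 3: "runs (push 2 1) ((\<lambda>i::nat. [])(2 := rev (?f w) @ [5])) 3 ((\<lambda>i::nat. [])(2 := rev (cd w) @ [5]))"
    by (rule runs_weaken[OF runs_push]) (auto simp flip: f)
  have 4: "runs (drain 2 [0]) ((\<lambda>i::nat. [])(2 := rev (cd w) @ [5])) (6 * sz w + 3) ((\<lambda>i::nat. [])(0 := cd w))"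
    by (rule runs_weaken[OF runs_drain[where w = "rev (cd w)" and r = "[]"]])
      (use range in \<open>auto simp: fun_eq_iff sz_def\<close>)
  show ?thesis
    unfolding read_input_def
    by (rule runs_weaken[OF runs_Seq[OF 1 runs_Seq[OF 2 runs_Seq[OF 3 4]]]]) (auto simp: sz_word)
qed

definition write_output :: com where
  "write_output = While (\<lambda>ss. ss ! 0 \<in> {4}) (Seq (pop 0) (Seq (Act 1 (\<lambda>ss. ss ! 0) Right) (pop 0)))"

lemma word_cells_snoc: "(word_cells u)(int (length u) := a) = word_cells (u @ [a])"
  by (auto simp: word_cells_def fun_eq_iff nth_append)

text \<open>Stated for an arbitrary word \<open>u\<close> that is already written, with the output
  head just behind it: this is the loop invariant. The notion \<open>runs\<close> does not apply
  here because the output tape changes.\<close>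

lemma exec_write_output:
  "holds ts (word_cells u, int (length u)) ((\<lambda>i::nat. [])(0 := cd w)) \<Longrightarrow>
   \<exists>t \<le> 6 * length w + 1. \<exists>ts'. exec write_output ts t ts' \<and> fst (ts' ! 1) = word_cells (u @ map sym_val w)"
proof (induction w arbitrary: u ts)
  case Nil
  have "exec write_output ts 1 ts"
    unfolding write_output_def
    by (rule exec_WhileF) (use read_heads_top[OF Nil, of 0] in \<open>simp add: cd_Nil\<close>)
  moreover have "fst (ts ! 1) = word_cells u" using Nil by (simp add: holds_def)
  ultimately show ?case by auto
next
  case (Cons a w)
  let ?s = "(\<lambda>i::nat. [])(0 := cd (a # w))"
  let ?s1 = "(\<lambda>i::nat. [])(0 := sym_val a # cd w)"
  have "runs (pop 0) ?s 1 ?s1"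
    by (rule runs_weaken[OF runs_pop]) (auto simp: cd_Cons cd_symbol)
  then obtain t1 ts1 where 1: "t1 \<le> 1" "exec (pop 0) ts t1 ts1" "holds ts1 (word_cells u, int (length u)) ?s1"
    using Cons.prems unfolding runs_def by blast
  define ts2 where "ts2 = do_act 1 (\<lambda>ss. ss ! 0) Right ts1"
  have "read_heads ts1 ! 0 = sym_val a"
    using read_heads_top[OF 1(3), of 0] by simp
  then have "ts2 = ts1[1 := (word_cells (u @ [sym_val a]), int (length (u @ [sym_val a])))]"
    using 1(3) sym_val_range[of a]
    by (simp add: ts2_def do_act_def act_def holds_def word_cells_snoc add.commute)
  then have 2: "holds ts2 (word_cells (u @ [sym_val a]), int (length (u @ [sym_val a]))) ?s1"
    using 1(3) by (auto simp: holds_def stack_ids_def)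
  have "runs (pop 0) ?s1 1 ((\<lambda>i::nat. [])(0 := cd w))"
    by (rule runs_weaken[OF runs_pop]) auto
  then obtain t3 ts3 where 3: "t3 \<le> 1" "exec (pop 0) ts2 t3 ts3"
    "holds ts3 (word_cells (u @ [sym_val a]), int (length (u @ [sym_val a]))) ((\<lambda>i::nat. [])(0 := cd w))"
    using 2 unfolding runs_def by blast
  from Cons.IH[OF 3(3)] obtain t4 ts4 where 4: "t4 \<le> 6 * length w + 1" "exec write_output ts3 t4 ts4"
    "fst (ts4 ! 1) = word_cells (u @ map sym_val (a # w))" by auto
  have "exec (Seq (pop 0) (Seq (Act 1 (\<lambda>ss. ss ! 0) Right) (pop 0))) ts (1 + t1 + (1 + 1 + t3)) ts3"
    by (intro exec_Seq[OF 1(2)] exec_Seq[OF exec_Act] 3(2)[unfolded ts2_def])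
  moreover have "read_heads ts ! 0 \<in> {4}"
    using read_heads_top[OF Cons.prems, of 0] by (simp add: cd_Cons)
  ultimately have "exec write_output ts (1 + (1 + t1 + (1 + 1 + t3)) + t4) ts4"
    using 4(2) unfolding write_output_def by (intro exec_WhileT)
  moreover have "1 + (1 + t1 + (1 + 1 + t3)) + t4 \<le> 6 * length (a # w) + 1"
    using 1(1) 3(1) 4(1) by simp
  ultimately show ?case using 4(3) by blast
qed

theorem fp_poly_time_solvable:
  fixes f :: "symbol list \<Rightarrow> symbol list"
  assumes f: "fp f"
    and correct: "\<And>x. x \<in> I \<Longrightarrow> \<exists>w y. enc_in x = map sym_val w \<and> correct x y \<and> enc_out x y = map sym_val (f w)"
  shows "poly_time_solvable I correct enc_in enc_out"
proof -
  obtain P k where P: "\<And>w. w \<in> UNIV \<Longrightarrow> sz (f w) \<le> (sz w + 2) ^ k"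
    "\<And>w s. w \<in> UNIV \<Longrightarrow> runs P (above (cd w) s) ((sz w + 2) ^ k) (above (cd (f w)) s)"
    using f by (rule fp_onE) (rule that; assumption)
  define c where "c = Seq read_input (Seq P write_output)"
  obtain M where M: "wf_tm M" "num_tapes M = 5"
    "\<And>ts t ts'. exec c ts t ts' \<Longrightarrow> length ts = 5 \<Longrightarrow> (step M ^^ t) (0, ts) = (num_states M, ts')"
    using compile[of 5 c] by auto
  \<comment> \<open>\<open>2 n + 3\<close> is the size of an input of length \<open>n\<close>, plus
    \<open>2\<close>. Seven copies of the power leave room for the run of \<open>P\<close> and for
    six steps per output letter.\<close>
  define p :: "nat poly" where "p = [:50, 50:] + (\<Sum>i\<in>{..(6::nat)}. [:3, 2:] ^ k)"
  have poly_p: "50 + 50 * n + 7 * (2 * n + 3) ^ k = poly p n" for n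
    by (simp add: p_def algebra_simps)
  have "computes_within M (map sym_val w) (map sym_val (f w)) (poly p (length w))" for w
  proof -
    let ?ts = "snd (init_config M (map sym_val w))"
    have init: "?ts = (word_cells (map sym_val w), 0) # replicate 4 (word_cells [], 0)"
      by (simp add: init_config_def M(2))
    have "holds ?ts (word_cells [], 0) ((\<lambda>i::nat. [])(0 := map sym_val w))"
      unfolding holds_def init
      using sym_val_less by (auto simp: stack_ids_def is_stack_def nth_Cons' subset_iff)
    then obtain t1 ts1 where 1: "t1 \<le> 40 * length w + 40" "exec read_input ?ts t1 ts1"
      "holds ts1 (word_cells [], 0) ((\<lambda>i::nat. [])(0 := cd w))"
      using runs_read_input unfolding runs_def by blast
    have "runs P ((\<lambda>i::nat. [])(0 := cd w)) ((sz w + 2) ^ k) ((\<lambda>i::nat. [])(0 := cd (f w)))"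
      using P(2)[of w "\<lambda>i::nat. []"] by simp
    then obtain t2 ts2 where 2: "t2 \<le> (sz w + 2) ^ k" "exec P ts1 t2 ts2"
      "holds ts2 (word_cells [], int (length ([] :: nat list))) ((\<lambda>i::nat. [])(0 := cd (f w)))"
      using 1(3) unfolding runs_def by force
    obtain t3 ts3 where 3: "t3 \<le> 6 * length (f w) + 1" "exec write_output ts2 t3 ts3"
      "fst (ts3 ! 1) = word_cells (map sym_val (f w))"
      using exec_write_output[OF 2(3)] by auto
    let ?t = "1 + t1 + (1 + t2 + t3)"
    have "exec c ?ts ?t ts3"
      unfolding c_def by (intro exec_Seq[OF 1(2)] exec_Seq[OF 2(2)] 3(2))
    then have "(step M ^^ ?t) (init_config M (map sym_val w)) = (num_states M, ts3)"
      using M(3)[of ?ts ?t ts3] init by (simp add: init_config_def)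
    moreover have "?t \<le> 50 + 50 * length w + 7 * (2 * length w + 3) ^ k"
      using 1(1) 2(1) 3(1) P(1)[of w] by (simp add: sz_word eval_nat_numeral)
    then have "?t \<le> poly p (length w)" unfolding poly_p .
    ultimately show ?thesis
      unfolding computes_within_def using 3(3) by (intro exI[of _ ?t]) auto
  qed
  then have "\<exists>y. correct x y \<and> computes_within M (enc_in x) (enc_out x y) (poly p (length (enc_in x)))"
    if "x \<in> I" for x
    using correct[OF that] by (metis length_map)
  then show ?thesis
    unfolding poly_time_solvable_def using M(1) by blast
qed


section \<open>Many small primes\<close>

text \<open>With \<open>g m k = k! (m - 1)! / (m + k)!\<close> one has \<open>g m 0 = 1 / m\<close> and
  \<open>g m (k + 1) = g m k - g (m + 1) k\<close>, so a common multiple of \<open>1, \<dots>, n\<close> times \<open>g m k\<close> is an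
  integer whenever \<open>m + k \<le> n\<close>.\<close>

lemma common_multiple_integral:
  fixes L :: nat
  assumes L: "\<And>i. 1 \<le> i \<Longrightarrow> i \<le> n \<Longrightarrow> i dvd L"
  shows "1 \<le> m \<Longrightarrow> m + k \<le> n \<Longrightarrow> real L * (fact k * fact (m - 1) / fact (m + k)) \<in> \<int>"
proof (induction k arbitrary: m)
  case 0
  then obtain q where q: "L = m * q" using L[of m] by auto
  obtain m' where "m = Suc m'" using 0 by (cases m) auto
  then have "real L * (fact 0 * fact (m - 1) / fact (m + 0)) = real q"
    by (simp add: q del: of_nat_Suc) (simp add: divide_simps algebra_simps)
  then show ?case by simp
next
  case (Suc k)
  obtain m' where m': "m = Suc m'" using Suc by (cases m) auto
  have "fact k * fact m' / fact (Suc m' + k) - fact k * fact (Suc m') / fact (Suc (Suc m') + k)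
     = (fact (Suc k) * fact m' / fact (Suc m' + Suc k) :: real)"
  proof -
    have "(fact (Suc (Suc m') + k) :: real) = (real m' + real k + 2) * fact (Suc m' + k)"
      by (simp add: algebra_simps)
    moreover have "(fact (Suc k) :: real) = (real k + 1) * fact k"
      by (simp add: algebra_simps)
    moreover have "(fact (Suc m') :: real) = (real m' + 1) * fact m'"
      by (simp add: algebra_simps)
    moreover have "Suc m' + Suc k = Suc (Suc m') + k" by simp
    moreover have "real m' + real k + 2 \<noteq> 0" by linarith
    moreover have "(fact (Suc m' + k) :: real) \<noteq> 0" by simp
    ultimately show ?thesis
      by (simp only:) (simp add: divide_simps del: fact_Suc, simp add: algebra_simps)
  qed
  moreover have "real L * (fact k * fact m' / fact (Suc m' + k)) \<in> \<int>"
    using Suc.IH[of "Suc m'"] Suc.prems m' by simp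
  moreover have "real L * (fact k * fact (Suc m') / fact (Suc (Suc m') + k)) \<in> \<int>"
    using Suc.IH[of "Suc (Suc m')"] Suc.prems m' by (simp del: fact_Suc)
  ultimately show ?case
    by (metis (no_types, lifting) Ints_diff diff_Suc_1 m' right_diff_distrib)
qed

text \<open>\<open>L\<close> times \<open>t! (t - 1)! / (2 t)!\<close> is a positive integer, hence
  at least \<open>1\<close>. Replacing \<open>(t - 1)!\<close> by \<open>t!\<close> shows that
  \<open>L\<close> is at least the central binomial coefficient, which is at least
  \<open>4 ^ t / (2 t)\<close> and so at least \<open>2 ^ t\<close>.\<close>

lemma common_multiple_ge:
  fixes L :: nat
  assumes "\<And>i. 1 \<le> i \<Longrightarrow> i \<le> 2 * t \<Longrightarrow> i dvd L" "0 < L" "0 < t"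
  shows "2 ^ t \<le> L"
proof -
  let ?g = "fact t * fact (t - 1) / fact (t + t) :: real"
  have "real L * ?g \<in> \<int>"
    by (rule common_multiple_integral[where n = "2 * t"]) (use assms in auto)
  moreover have "0 < real L * ?g" using assms by simp
  ultimately have "1 \<le> real L * ?g"
    by (metis Ints_cases int_one_le_iff_zero_less of_int_0_less_iff of_int_1_le_iff)
  also have "?g \<le> fact t * fact t / fact (t + t)"
    by (intro divide_right_mono mult_left_mono fact_mono) auto
  finally have "1 \<le> real L * (fact t * fact t / fact (t + t))"
    using assms(2) by (simp add: mult_left_mono)
  moreover have "real ((2 * t) choose t) = fact (t + t) / (fact t * fact t)"
    by (subst binomial_fact) (auto simp: mult_2)
  moreover from calculation have "real ((2 * t) choose t) * 1
      \<le> real ((2 * t) choose t) * (real L * (fact t * fact t / fact (t + t)))"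
    by (intro mult_left_mono) auto
  ultimately have "real ((2 * t) choose t) \<le> real L" by simp
  moreover have "4 ^ t / (2 * real t) \<le> real ((2 * t) choose t)"
    using central_binomial_lower_bound[of t] assms(3) by simp
  moreover have "2 * t \<le> 2 ^ t"
    using assms(3)
  proof (induction t rule: nat_induct_non_zero)
    case (Suc n)
    then show ?case by (cases n) auto
  qed auto
  then have "2 ^ t \<le> (4 ^ t / (2 * real t))"
  proof -
    have "real (2 * t) \<le> real (2 ^ t)"
      using \<open>2 * t \<le> 2 ^ t\<close> by (simp only: of_nat_le_iff)
    then have "(2::real) ^ t * (2 * real t) \<le> 2 ^ t * 2 ^ t"
      by (intro mult_left_mono) simp_all
    also have "\<dots> = 4 ^ t" by (simp flip: power_mult_distrib)
    finally show ?thesis using assms(3) by (simp add: pos_le_divide_eq)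
  qed
  ultimately have "(2::real) ^ t \<le> real L" by linarith
  then show ?thesis by (metis of_nat_le_iff of_nat_numeral of_nat_power)
qed

text \<open>\<open>N ^ e\<close> is a common multiple of \<open>1, ..., 2 t\<close>: a prime power
  dividing some \<open>i\<close> in this range has exponent below \<open>e\<close>, because
  \<open>i < 2 ^ e\<close>, while the prime divides \<open>N\<close> and therefore divides
  \<open>N ^ e\<close> at least \<open>e\<close> times.\<close>

lemma all_small_primes_divide:
  fixes N :: nat
  assumes primes: "\<And>p. prime p \<Longrightarrow> p \<le> 2 * t \<Longrightarrow> p dvd N" and "0 < N" "0 < t" "2 * t < 2 ^ e"
  shows "2 ^ t \<le> N ^ e"
proof (rule common_multiple_ge)
  fix i assume i: "1 \<le> i" "i \<le> 2 * t"
  show "i dvd N ^ e"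
  proof (rule multiplicity_le_imp_dvd)
    fix p :: nat assume p: "prime p"
    show "multiplicity p i \<le> multiplicity p (N ^ e)"
    proof (cases "p dvd i")
      case True
      then have "p \<le> 2 * t" using i dvd_imp_le[of p i] by linarith
      then have "1 \<le> multiplicity p N"
        using primes[OF p] assms(2) p by (simp add: Suc_le_eq prime_multiplicity_gt_zero_iff)
      have "2 ^ multiplicity p i \<le> p ^ multiplicity p i"
        using prime_ge_2_nat[OF p] by (intro power_mono) auto
      also have "\<dots> \<le> i" using i by (intro dvd_imp_le multiplicity_dvd) auto
      also have "\<dots> < 2 ^ e" using i assms(4) by linarith
      finally have "multiplicity p i < e" by simp
      also have "e \<le> e * multiplicity p N" using \<open>1 \<le> multiplicity p N\<close> by simp
      also have "\<dots> = multiplicity p (N ^ e)"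
        using p assms(2) by (simp add: prime_elem_multiplicity_power_distrib)
      finally show ?thesis by simp
    qed (simp add: not_dvd_imp_multiplicity_0)
  qed (use i in auto)
qed (use assms in auto)

section \<open>Elimination modulo small numbers\<close>

text \<open>The list pairs the pivot row with the row to be reduced, so the result carries the
  entries of both rows in the pivot column and no column index is needed. The default arises only
  for a zero pivot row.\<close>

definition pivot_entry :: "(nat \<times> nat) list \<Rightarrow> nat \<times> nat" where
  "pivot_entry zs = foldr (\<lambda>z a. if fst z = 0 then a else z) zs (0, 0)"

text \<open>\<open>m - snd z\<close> represents the negative of \<open>snd z\<close> modulo
  \<open>m\<close> among the natural numbers. Each row is multiplied by the pivot instead of being
  divided by it, so the pivot need not be invertible.\<close>

definition eliminate :: "nat \<Rightarrow> nat list \<Rightarrow> nat list \<Rightarrow> nat list" where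
  "eliminate m b r = (let z = pivot_entry (zip b r) in
     map (\<lambda>(y, x). (fst z * x + (m - snd z) * y) mod m) (zip b r))"

fun independent_mod :: "nat \<Rightarrow> nat list list \<Rightarrow> bool" where
  "independent_mod m [] = True"
| "independent_mod m (b # rs) = (list_ex (\<lambda>y. y \<noteq> 0) b \<and> independent_mod m (map (eliminate m b) rs))"

definition rows_ok :: "nat \<Rightarrow> nat \<Rightarrow> nat list list \<Rightarrow> bool" where
  "rows_ok m n rs \<longleftrightarrow> (\<forall>r \<in> set rs. length r = n \<and> set r \<subseteq> {..<m})"

lemma pivot_entry:
  assumes "length b = length r" "list_ex (\<lambda>y. y \<noteq> 0) b"
  shows "\<exists>c < length b. pivot_entry (zip b r) = (b ! c, r ! c) \<and> b ! c \<noteq> 0 \<and> (\<forall>i<c. b ! i = 0)"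
  using assms
proof (induction b r rule: list_induct2)
  case (Cons y b x r)
  show ?case
  proof (cases "y = 0")
    case True
    then obtain c where "c < length b" "pivot_entry (zip b r) = (b ! c, r ! c)" "b ! c \<noteq> 0" "\<forall>i<c. b ! i = 0"
      using Cons by auto
    then show ?thesis using True
      by (intro exI[of _ "Suc c"]) (auto simp: pivot_entry_def less_Suc_eq_0_disj)
  qed (auto simp: pivot_entry_def)
qed simp

lemma eliminate_column:
  assumes b: "length b = n" "list_ex (\<lambda>y. y \<noteq> 0) b"
  obtains c where "c < n" "b ! c \<noteq> 0" "\<And>r. length r = n \<Longrightarrow> eliminate m b r =
     map (\<lambda>i. (b ! c * r ! i + (m - r ! c) * b ! i) mod m) [0..<n]"
proof -
  define c where "c = (LEAST c. c < n \<and> b ! c \<noteq> 0)"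
  have c: "c < n \<and> b ! c \<noteq> 0"
  proof -
    have "\<exists>c. c < n \<and> b ! c \<noteq> 0" using b by (auto simp: list_ex_length)
    from LeastI_ex[OF this] show ?thesis unfolding c_def .
  qed
  have "pivot_entry (zip b r) = (b ! c, r ! c)" if "length r = n" for r
  proof -
    have "\<exists>c < n. pivot_entry (zip b r) = (b ! c, r ! c) \<and> b ! c \<noteq> 0 \<and> (\<forall>i<c. b ! i = 0)"
      using pivot_entry[of b r] b that by simp
    then obtain c' where c': "c' < n" "pivot_entry (zip b r) = (b ! c', r ! c')" "b ! c' \<noteq> 0" "\<forall>i<c'. b ! i = 0"
      by blast
    moreover have "c = c'"
    proof (rule antisym)
      show "c \<le> c'" unfolding c_def by (rule Least_le) (use c' in simp)
      show "c' \<le> c" using c c'(4) by (metis not_less)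
    qed
    ultimately show ?thesis by simp
  qed
  then have "eliminate m b r = map (\<lambda>i. (b ! c * r ! i + (m - r ! c) * b ! i) mod m) [0..<n]"
    if "length r = n" for r
    using that by (intro nth_equalityI) (simp_all add: eliminate_def Let_def b)
  then show ?thesis using that c by blast
qed

lemma eliminate_ok:
  assumes "rows_ok m n (b # rs)" "0 < m"
  shows "rows_ok m n (map (eliminate m b) rs)"
  using assms by (auto simp: rows_ok_def eliminate_def Let_def)

text \<open>Rows are functions of the column over any commutative ring, so that residues, integer
  lifts and real vectors share one notion of linear combination.\<close>

definition comb :: "'a::comm_ring_1 list \<Rightarrow> (nat \<Rightarrow> 'a) list \<Rightarrow> nat \<Rightarrow> 'a" where
  "comb ls Rs j = sum_list (map2 (\<lambda>l R. l * R j) ls Rs)"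

lemma comb_simps [simp]:
  "comb [] Rs j = 0" "comb ls [] j = 0"
  "comb (l # ls) (R # Rs) j = l * R j + comb ls Rs j"
  by (simp_all add: comb_def)

lemma comb_eliminate:
  "comb ls (map (\<lambda>R i. P * R i - R c * d i) Rs) j = P * comb ls Rs j - comb ls Rs c * d j"
proof (induction ls arbitrary: Rs)
  case (Cons l ls)
  show ?case by (cases Rs) (simp_all add: Cons.IH algebra_simps)
qed simp

lemma dvd_diff_trans: "(m::int) dvd x - y \<Longrightarrow> m dvd y - z \<Longrightarrow> m dvd x - z"
  using dvd_add[of m "x - y" "y - z"] by simp

lemma dvd_diff_mult: "(m::int) dvd x - x' \<Longrightarrow> m dvd y - y' \<Longrightarrow> m dvd x * y - x' * y'"
proof -
  assume "m dvd x - x'" "m dvd y - y'"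
  then have "m dvd x * (y - y') + (x - x') * y'" by simp
  then show ?thesis by (simp add: algebra_simps)
qed

lemma dvd_diff_diff: "(m::int) dvd x - x' \<Longrightarrow> m dvd y - y' \<Longrightarrow> m dvd (x - y) - (x' - y')"
  using dvd_diff[of m "x - x'" "y - y'"] by (simp add: algebra_simps)

lemma dvd_diff_add: "(m::int) dvd x - x' \<Longrightarrow> m dvd y - y' \<Longrightarrow> m dvd (x + y) - (x' + y')"
  using dvd_add[of m "x - x'" "y - y'"] by (simp add: algebra_simps)

lemma eliminate_cong:
  assumes m: "0 < m" and "r ! c < m"
  shows "int m dvd int ((b ! c * r ! i + (m - r ! c) * b ! i) mod m) - (int (b ! c) * int (r ! i) - int (r ! c) * int (b ! i))"
proof -
  have "int m dvd int ((b ! c * r ! i + (m - r ! c) * b ! i) mod m) - int (b ! c * r ! i + (m - r ! c) * b ! i)"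
    by (simp add: zmod_int mod_eq_dvd_iff[symmetric])
  moreover have "int (b ! c * r ! i + (m - r ! c) * b ! i) - (int (b ! c) * int (r ! i) - int (r ! c) * int (b ! i)) = int m * int (b ! i)"
  proof -
    have "int (m - r ! c) = int m - int (r ! c)" using assms by simp
    then show ?thesis by (simp only: of_nat_add of_nat_mult) (simp add: algebra_simps)
  qed
  then have "int m dvd int (b ! c * r ! i + (m - r ! c) * b ! i) - (int (b ! c) * int (r ! i) - int (r ! c) * int (b ! i))"
    by simp
  ultimately show ?thesis by (rule dvd_diff_trans)
qed

text \<open>A real linear relation survives elimination on integer lifts of the rows, and a pivot that is
  nonzero modulo \<open>m\<close> is nonzero; so success for any modulus proves independence.\<close>

lemma independent_mod_sound:
  assumes "independent_mod m rs" "rows_ok m n rs" "0 < m" "length Rs = length rs"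
    and "\<And>i j. i < length rs \<Longrightarrow> j < n \<Longrightarrow> int m dvd ((Rs ! i) j - int (rs ! i ! j))"
    and "length ls = length rs" "\<And>j. j < n \<Longrightarrow> comb ls (map (\<lambda>R j. real_of_int (R j)) Rs) j = 0"
  shows "set ls \<subseteq> {0}"
  using assms
proof (induction m rs arbitrary: Rs ls rule: independent_mod.induct)
  case (2 m b rs)
  obtain R0 Rs' where Rs: "Rs = R0 # Rs'" "length Rs' = length rs" using 2(5) by (cases Rs) auto
  obtain l0 ls' where ls: "ls = l0 # ls'" "length ls' = length rs" using 2(7) by (cases ls) auto
  have nz: "list_ex (\<lambda>y. y \<noteq> 0) b" and ind: "independent_mod m (map (eliminate m b) rs)"
    using 2(2) by auto
  have b: "length b = n" "set b \<subseteq> {..<m}" using 2(3) by (auto simp: rows_ok_def)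
  obtain c where c: "c < n" "b ! c \<noteq> 0"
    and el: "\<And>r. length r = n \<Longrightarrow> eliminate m b r =
     map (\<lambda>i. (b ! c * r ! i + (m - r ! c) * b ! i) mod m) [0..<n]"
    using eliminate_column[OF b(1) nz, of m] by blast
  have cong0: "int m dvd R0 j - int (b ! j)" if "j < n" for j
    using 2(6)[of 0 j] that by (simp add: Rs)
  have congs: "int m dvd (Rs' ! i) j - int (rs ! i ! j)" if "i < length rs" "j < n" for i j
    using 2(6)[of "Suc i" j] that by (simp add: Rs)
  have "b ! c < m" using b c(1) nth_mem[of c b] by blast
  then have "R0 c \<noteq> 0"
    using cong0[OF c(1)] c(2) zdvd_not_zless[of "int (b ! c)" "int m"] by fastforce
  \<comment> \<open>The lifts are eliminated over the integers without reduction: the real relation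
    is then kept exactly, while the lifts stay congruent modulo \<open>m\<close> to the reduced
    rows. This is why the induction runs over arbitrary lifts.\<close>
  define Rs2 where "Rs2 = map (\<lambda>R i. R0 c * R i - R c * R0 i) Rs'"
  have comb0: "l0 * real_of_int (R0 j) + comb ls' (map (\<lambda>R j. real_of_int (R j)) Rs') j = 0" if "j < n" for j
    using 2(8)[OF that] by (simp add: Rs ls)
  have "set ls' \<subseteq> {0}"
  proof (rule 2(1)[OF ind eliminate_ok[OF 2(3) 2(4)] 2(4)])
    show "length Rs2 = length (map (eliminate m b) rs)" by (simp add: Rs2_def Rs)
    show "length ls' = length (map (eliminate m b) rs)" by (simp add: ls)
    fix j assume j: "j < n"
    have map2: "map (\<lambda>R j. real_of_int (R j)) Rs2 =
      map (\<lambda>R i. real_of_int (R0 c) * R i - R c * real_of_int (R0 i)) (map (\<lambda>R j. real_of_int (R j)) Rs')"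
      by (simp add: Rs2_def)
    have "comb ls' (map (\<lambda>R j. real_of_int (R j)) Rs2) j =
        real_of_int (R0 c) * comb ls' (map (\<lambda>R j. real_of_int (R j)) Rs') j
          - comb ls' (map (\<lambda>R j. real_of_int (R j)) Rs') c * real_of_int (R0 j)"
      unfolding map2 by (rule comb_eliminate)
    also have "\<dots> = real_of_int (R0 c) * (- l0 * real_of_int (R0 j)) - (- l0 * real_of_int (R0 c)) * real_of_int (R0 j)"
      using comb0[OF j] comb0[OF c(1)] by (simp add: add_eq_0_iff)
    finally show "comb ls' (map (\<lambda>R j. real_of_int (R j)) Rs2) j = 0" by simp
    fix i assume "i < length (map (eliminate m b) rs)"
    then have i: "i < length rs" by simp
    have r: "length (rs ! i) = n" "set (rs ! i) \<subseteq> {..<m}" using 2(3) i by (auto simp: rows_ok_def)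
    then have "rs ! i ! c < m" using c(1) nth_mem[of c "rs ! i"] by blast
    from eliminate_cong[OF 2(4) this, of b j]
    have e: "int m dvd int (map (eliminate m b) rs ! i ! j) - (int (b ! c) * int (rs ! i ! j) - int (rs ! i ! c) * int (b ! j))"
      using i j r by (simp add: el)
    have "int m dvd R0 c * (Rs' ! i) j - int (b ! c) * int (rs ! i ! j)"
      by (rule dvd_diff_mult[OF cong0[OF c(1)] congs[OF i j]])
    moreover have "int m dvd (Rs' ! i) c * R0 j - int (rs ! i ! c) * int (b ! j)"
      by (rule dvd_diff_mult[OF congs[OF i c(1)] cong0[OF j]])
    ultimately have "int m dvd (R0 c * (Rs' ! i) j - (Rs' ! i) c * R0 j) - (int (b ! c) * int (rs ! i ! j) - int (rs ! i ! c) * int (b ! j))"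
      by (rule dvd_diff_diff)
    then have "int m dvd (R0 c * (Rs' ! i) j - (Rs' ! i) c * R0 j) - int (map (eliminate m b) rs ! i ! j)"
      by (rule dvd_diff_trans) (use e in \<open>simp only: dvd_diff_commute\<close>)
    then show "int m dvd (Rs2 ! i) j - int (map (eliminate m b) rs ! i ! j)"
      using i Rs(2) by (simp add: Rs2_def)
  qed
  then have "comb ls' (map (\<lambda>R j. real_of_int (R j)) Rs') c = 0"
  proof (induction ls' arbitrary: Rs')
    case (Cons l ls)
    then show ?case by (cases Rs') auto
  qed simp
  then have "l0 = 0" using comb0[OF c(1)] \<open>R0 c \<noteq> 0\<close> by simp
  then show ?case using \<open>set ls' \<subseteq> {0}\<close> by (simp add: ls)
qed simp

text \<open>Failure produces a nontrivial relation modulo \<open>m\<close>. A zero pivot row is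
  itself such a relation; otherwise a relation among the eliminated rows is pulled back to the
  original ones. The pull-back multiplies the coefficients by the pivot, and primality of
  \<open>m\<close> keeps it nontrivial.\<close>

lemma independent_mod_complete:
  assumes "\<not> independent_mod m rs" "rows_ok m n rs" "prime m"
  shows "\<exists>ls. length ls = length rs \<and> (\<exists>l\<in>set ls. \<not> int m dvd l) \<and>
    (\<forall>j<n. int m dvd comb ls (map (\<lambda>r j. int (r ! j)) rs) j)"
  using assms
proof (induction m rs rule: independent_mod.induct)
  case (2 m b rs)
  have m: "0 < m" "1 < m" using prime_gt_1_nat[OF 2(4)] by auto
  have zero: "comb (replicate k (0::int)) Rs j = 0" for k Rs j
    by (induction k arbitrary: Rs) (simp, metis (no_types) comb_simps(2,3) list.exhaust mult_zero_left add_0 replicate_Suc)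
  have b: "length b = n" "set b \<subseteq> {..<m}" using 2(3) by (auto simp: rows_ok_def)
  show ?case
  proof (cases "list_ex (\<lambda>y. y \<noteq> 0) b")
    case False
    then have "b ! j = 0" if "j < n" for j using that b by (auto simp: list_ex_length)
    then show ?thesis
      using m zero by (intro exI[of _ "1 # replicate (length rs) 0"]) auto
  next
    case True
    then have ind: "\<not> independent_mod m (map (eliminate m b) rs)" using 2(2) by simp
    obtain c where c: "c < n" "b ! c \<noteq> 0"
      and el: "\<And>r. length r = n \<Longrightarrow> eliminate m b r =
       map (\<lambda>i. (b ! c * r ! i + (m - r ! c) * b ! i) mod m) [0..<n]"
      using eliminate_column[OF b(1) True, of m] by blast
    have "b ! c < m" using b c(1) nth_mem[of c b] by blast
    then have ndvd: "\<not> int m dvd int (b ! c)" using c(2) by (auto dest: dvd_imp_le)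
    obtain ls where ls: "length ls = length rs" "\<exists>l\<in>set ls. \<not> int m dvd l"
      "\<And>j. j < n \<Longrightarrow> int m dvd comb ls (map (\<lambda>r j. int (r ! j)) (map (eliminate m b) rs)) j"
      using 2(1)[OF ind eliminate_ok[OF 2(3) m(1)] 2(4)] by auto
    let ?Rs = "map (\<lambda>r j. int (r ! j)) rs"
    \<comment> \<open>Expanding the relation \<open>ls\<close> between rows
      \<open>b_c r - r_c b\<close> gives coefficient \<open>b_c l\<close> for each row
      \<open>r\<close> and minus the combination of the entries \<open>r_c\<close> for the pivot
      row.\<close>
    define ls2 where "ls2 = - comb ls ?Rs c # map (\<lambda>l. l * int (b ! c)) ls"
    have scale: "comb (map (\<lambda>l. l * d) ls) Rs j = d * comb ls Rs j" for d :: int and ls Rs j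
    proof (induction ls arbitrary: Rs)
      case (Cons l ls)
      show ?case by (cases Rs) (simp_all add: Cons.IH algebra_simps)
    qed simp
    have "int m dvd comb ls2 (map (\<lambda>r j. int (r ! j)) (b # rs)) j" if j: "j < n" for j
    proof -
      \<comment> \<open>Stated for all lists of rows taken from \<open>rs\<close>, because the
        induction on \<open>ls\<close> removes rows one at a time.\<close>
      have "int m dvd comb ls (map (\<lambda>r j. int (r ! j)) (map (eliminate m b) rs')) j
          - comb ls (map (\<lambda>R i. int (b ! c) * R i - R c * int (b ! i)) (map (\<lambda>r j. int (r ! j)) rs')) j"
        if "set rs' \<subseteq> set rs" for rs'
        using that
      proof (induction ls arbitrary: rs')
        case (Cons l ls)
        show ?case
        proof (cases rs')
          case (Cons r rs'')
          have r: "length r = n" "set r \<subseteq> {..<m}" using 2(3) Cons Cons.prems by (auto simp: rows_ok_def)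
          then have "r ! c < m" using c(1) nth_mem[of c r] by blast
          from eliminate_cong[OF m(1) this, of b j]
          have "int m dvd int (eliminate m b r ! j) - (int (b ! c) * int (r ! j) - int (r ! c) * int (b ! j))"
            using j r by (simp add: el)
          moreover have "set rs'' \<subseteq> set rs" using Cons Cons.prems by auto
          ultimately show ?thesis
            using dvd_diff_add[OF dvd_diff_mult[of _ l l] Cons.IH[of rs'']] by (simp add: Cons)
        qed simp
      qed simp
      from this[of rs] have "int m dvd comb ls (map (\<lambda>r j. int (r ! j)) (map (eliminate m b) rs)) j
          - (int (b ! c) * comb ls ?Rs j - comb ls ?Rs c * int (b ! j))"
        unfolding comb_eliminate by simp
      then have "int m dvd int (b ! c) * comb ls ?Rs j - comb ls ?Rs c * int (b ! j)"
        using ls(3)[OF j] by (metis dvd_diff_right_iff)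
      moreover have "comb ls2 (map (\<lambda>r j. int (r ! j)) (b # rs)) j = int (b ! c) * comb ls ?Rs j - comb ls ?Rs c * int (b ! j)"
        by (simp add: ls2_def scale)
      ultimately show ?thesis by simp
    qed
    moreover have "\<exists>l\<in>set ls2. \<not> int m dvd l"
      using ls(2) ndvd 2(4) by (auto simp: ls2_def prime_dvd_mult_iff)
    ultimately show ?thesis
      by (intro exI[of _ ls2]) (simp add: ls2_def ls(1))
  qed
qed simp


section \<open>Gram matrices and their determinants\<close>

lemma comb_eq_sum:
  "length ls = length Rs \<Longrightarrow> comb ls Rs j = (\<Sum>i = 0..<length Rs. ls ! i * (Rs ! i) j)"
  unfolding comb_def by (subst sum_list_sum_nth) (auto intro!: sum.cong)

lemma comb_append:
  "length ls = length Rs \<Longrightarrow> comb (ls @ ls') (Rs @ Rs') j = comb ls Rs j + comb ls' Rs' j"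
  by (simp add: comb_def)

definition row_mat :: "nat \<Rightarrow> nat list list \<Rightarrow> int mat" where
  "row_mat n rs = mat (length rs) n (\<lambda>(i, j). int (rs ! i ! j))"

definition gram_mat :: "nat \<Rightarrow> nat list list \<Rightarrow> int mat" where
  "gram_mat n rs = row_mat n rs * transpose_mat (row_mat n rs)"

lemma gram_mat_carrier: "gram_mat n rs \<in> carrier_mat (length rs) (length rs)"
  unfolding gram_mat_def row_mat_def by (rule mult_carrier_mat[where n = n]) auto

lemma transpose_row_mat_mult:
  assumes "length ls = length rs"
  shows "transpose_mat (row_mat n rs) *\<^sub>v vec_of_list ls = vec n (comb ls (map (\<lambda>r j. int (r ! j)) rs))"
proof (rule eq_vecI)
  fix j assume "j < dim_vec (vec n (comb ls (map (\<lambda>r j. int (r ! j)) rs)))"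
  then show "(transpose_mat (row_mat n rs) *\<^sub>v vec_of_list ls) $ j = vec n (comb ls (map (\<lambda>r j. int (r ! j)) rs)) $ j"
    using assms
    by (auto simp: row_mat_def scalar_prod_def comb_eq_sum vec_of_list_index intro!: sum.cong)
qed (simp add: row_mat_def)

text \<open>If \<open>v\<close> is the coefficient vector, then \<open>G v\<close> vanishes modulo
  \<open>p\<close>, and so does \<open>adj(G) G v = det(G) v\<close>. Some entry of \<open>v\<close>
  is not divisible by \<open>p\<close>, so \<open>p\<close> divides the determinant. The Gram matrix
  provides a square matrix for a rectangular family of rows.\<close>

lemma prime_dvd_det_gram:
  assumes p: "prime p" and ls: "length ls = length rs" "\<exists>l\<in>set ls. \<not> int p dvd l"
    and comb: "\<forall>j<n. int p dvd comb ls (map (\<lambda>r j. int (r ! j)) rs) j"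
  shows "int p dvd det (gram_mat n rs)"
proof -
  let ?r = "length rs" and ?A = "row_mat n rs" and ?G = "gram_mat n rs"
  let ?v = "vec_of_list ls"
  have A: "?A \<in> carrier_mat ?r n" by (simp add: row_mat_def)
  have v: "?v \<in> carrier_vec ?r" using ls(1) by (metis carrier_vec_dim_vec dim_vec_of_list)
  obtain i where i: "i < ?r" "\<not> int p dvd ls ! i"
    using ls by (auto simp: in_set_conv_nth)
  have dvd1: "int p dvd (?A *\<^sub>v (transpose_mat ?A *\<^sub>v ?v)) $ j" if "j < ?r" for j
    unfolding transpose_row_mat_mult[OF ls(1)] using that comb
    by (auto simp: row_mat_def scalar_prod_def intro!: dvd_sum)
  have Gv: "?G *\<^sub>v ?v = ?A *\<^sub>v (transpose_mat ?A *\<^sub>v ?v)"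
    unfolding gram_mat_def by (rule assoc_mult_mat_vec) (use A v in auto)
  have "int p dvd (adj_mat ?G *\<^sub>v (?G *\<^sub>v ?v)) $ i"
    using adj_mat(1)[OF gram_mat_carrier[of n rs]] i(1) dvd1 A unfolding Gv
    by (auto simp: scalar_prod_def intro!: dvd_sum)
  also have "adj_mat ?G *\<^sub>v (?G *\<^sub>v ?v) = (adj_mat ?G * ?G) *\<^sub>v ?v"
    by (rule assoc_mult_mat_vec[OF adj_mat(1)[OF gram_mat_carrier] gram_mat_carrier v, symmetric])
  also have "\<dots> = det ?G \<cdot>\<^sub>v ?v"
    unfolding adj_mat(3)[OF gram_mat_carrier]
  proof (rule eq_vecI)
    fix i assume "i < dim_vec (det ?G \<cdot>\<^sub>v ?v)"
    then have i: "i < ?r" using ls(1) by simp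
    have "((det ?G \<cdot>\<^sub>m 1\<^sub>m ?r) *\<^sub>v ?v) $ i = (det ?G \<cdot>\<^sub>v unit_vec ?r i) \<bullet> ?v"
      using i by simp
    also have "\<dots> = det ?G * ?v $ i"
      using v by (subst smult_scalar_prod_distrib) (use i in \<open>simp_all add: scalar_prod_left_unit\<close>)
    finally show "((det ?G \<cdot>\<^sub>m 1\<^sub>m ?r) *\<^sub>v ?v) $ i = (det ?G \<cdot>\<^sub>v ?v) $ i"
      using i v ls(1) by simp
  qed (use ls(1) in simp)
  also have "(det ?G \<cdot>\<^sub>v ?v) $ i = det ?G * ls ! i"
    using i(1) ls(1) by (simp add: vec_of_list_index)
  finally show ?thesis
    using i(2) p by (simp add: prime_dvd_mult_iff)
qed

text \<open>Leibniz expansion: the entries are inner products of vectors with entries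
  \<open>0\<close> and \<open>1\<close>, hence at most \<open>n\<close>.\<close>

lemma abs_det_gram_le:
  assumes "\<And>r j. r \<in> set rs \<Longrightarrow> j < n \<Longrightarrow> r ! j \<le> 1"
  shows "\<bar>det (gram_mat n rs)\<bar> \<le> fact (length rs) * int n ^ length rs"
proof -
  let ?G = "gram_mat n rs" and ?r = "length rs"
  let ?P = "{p. p permutes {0..<?r}}"
  have entry: "\<bar>?G $$ (i, j)\<bar> \<le> int n" if "i < ?r" "j < ?r" for i j
  proof -
    have "?G $$ (i, j) = (\<Sum>k = 0..<n. int (rs ! i ! k) * int (rs ! j ! k))"
      using that by (auto simp: gram_mat_def row_mat_def scalar_prod_def)
    moreover have "\<bar>\<Sum>k = 0..<n. int (rs ! i ! k) * int (rs ! j ! k)\<bar> \<le> (\<Sum>k = 0..<n. \<bar>int (rs ! i ! k) * int (rs ! j ! k)\<bar>)"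
      by (rule sum_abs)
    moreover have "\<dots> \<le> (\<Sum>k = 0..<n. 1)"
    proof (rule sum_mono)
      fix k assume "k \<in> {0..<n}"
      then have "rs ! i ! k * rs ! j ! k \<le> 1 * 1"
        using assms that by (intro mult_le_mono) auto
      then show "\<bar>int (rs ! i ! k) * int (rs ! j ! k)\<bar> \<le> 1"
        by (metis abs_of_nat nat_mult_1 of_nat_1 of_nat_le_iff of_nat_mult)
    qed
    ultimately show ?thesis by simp
  qed
  have "\<bar>det ?G\<bar> = \<bar>\<Sum>p\<in>?P. signof p * (\<Prod>i = 0..<?r. ?G $$ (i, p i))\<bar>"
    using gram_mat_carrier[of n rs] by (simp add: det_def)
  also have "\<dots> \<le> (\<Sum>p\<in>?P. \<bar>signof p * (\<Prod>i = 0..<?r. ?G $$ (i, p i))\<bar>)"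
    by (rule sum_abs)
  also have "\<dots> \<le> (\<Sum>p\<in>?P. int n ^ ?r)"
  proof (rule sum_mono)
    fix p assume "p \<in> ?P"
    then have p: "p permutes {0..<?r}" by simp
    have "\<bar>signof p * (\<Prod>i = 0..<?r. ?G $$ (i, p i))\<bar> = (\<Prod>i = 0..<?r. \<bar>?G $$ (i, p i)\<bar>)"
      by (simp add: abs_mult abs_prod sign_def)
    also have "\<dots> \<le> (\<Prod>i = 0..<?r. int n)"
    proof (rule prod_mono)
      fix i assume "i \<in> {0..<?r}"
      then show "0 \<le> \<bar>?G $$ (i, p i)\<bar> \<and> \<bar>?G $$ (i, p i)\<bar> \<le> int n"
        using entry permutes_in_image[OF p, of i] by auto
    qed
    finally show "\<bar>signof p * (\<Prod>i = 0..<?r. ?G $$ (i, p i))\<bar> \<le> int n ^ ?r" by simp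
  qed
  also have "\<dots> = fact ?r * int n ^ ?r"
    by (simp add: card_permutations)
  finally show ?thesis .
qed

lemma scalar_prod_self: "(w :: real vec) \<in> carrier_vec n \<Longrightarrow> w \<bullet> w = (\<Sum>j = 0..<n. (w $ j)\<^sup>2)"
  by (simp add: scalar_prod_def power2_eq_square)

text \<open>A kernel vector \<open>v\<close> of \<open>A A^T\<close> over the reals satisfies
  \<open>|A^T v|^2 = 0\<close>, so it is a linear relation between the rows.\<close>

lemma det_gram_nonzero:
  assumes ind: "\<And>ls :: real list. length ls = length rs \<Longrightarrow>
      (\<And>j. j < n \<Longrightarrow> comb ls (map (\<lambda>r j. real (r ! j)) rs) j = 0) \<Longrightarrow> set ls \<subseteq> {0}"
  shows "det (gram_mat n rs) \<noteq> 0"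
proof
  assume det0: "det (gram_mat n rs) = 0"
  let ?r = "length rs"
  let ?A = "map_mat real_of_int (row_mat n rs)" and ?G = "map_mat real_of_int (gram_mat n rs)"
  have A: "?A \<in> carrier_mat ?r n" by (simp add: row_mat_def)
  have G: "?G \<in> carrier_mat ?r ?r" using gram_mat_carrier by simp
  have "?G = ?A * map_mat real_of_int (transpose_mat (row_mat n rs))"
    unfolding gram_mat_def by (rule of_int_hom.mat_hom_mult) (auto simp: row_mat_def)
  also have "map_mat real_of_int (transpose_mat (row_mat n rs)) = transpose_mat ?A"
    by (rule eq_matI) auto
  finally have GA: "?G = ?A * transpose_mat ?A" .
  have "det ?G = 0" using det0 by simp
  then obtain v where v: "v \<in> carrier_vec ?r" "v \<noteq> 0\<^sub>v ?r" "?G *\<^sub>v v = 0\<^sub>v ?r"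
    using det_0_iff_vec_prod_zero_field[OF G] by blast
  let ?w = "transpose_mat ?A *\<^sub>v v"
  have w: "?w \<in> carrier_vec n"
    by (rule mult_mat_vec_carrier[OF transpose_carrier_mat[THEN iffD2, OF A] v(1)])
  have "?A *\<^sub>v ?w = 0\<^sub>v ?r"
    using v(3) A v(1) unfolding GA by (simp add: assoc_mult_mat_vec[of _ ?r n _ ?r])
  then have "v \<bullet> (?A *\<^sub>v ?w) = 0" using v(1) by simp
  moreover have "v \<bullet> (?A *\<^sub>v ?w) = ?w \<bullet> ?w"
    using transpose_vec_mult_scalar[OF A w v(1)] by simp
  ultimately have "(\<Sum>j = 0..<n. (?w $ j)\<^sup>2) = 0"
    using scalar_prod_self[OF w] by argo
  then have w0: "?w $ j = 0" if "j < n" for j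
    using that by (simp add: sum_nonneg_eq_0_iff)
  let ?ls = "list_of_vec v"
  have "set ?ls \<subseteq> {0}"
  proof (rule ind)
    show len: "length ?ls = ?r" using v(1) by simp
    fix j assume j: "j < n"
    have "comb ?ls (map (\<lambda>r j. real (r ! j)) rs) j = (\<Sum>i = 0..<?r. v $ i * real (rs ! i ! j))"
      using v(1) by (subst comb_eq_sum) (auto simp: list_of_vec_index intro!: sum.cong)
    also have "\<dots> = ?w $ j"
      using j v(1) by (auto simp: row_mat_def scalar_prod_def mult.commute intro!: sum.cong)
    finally show "comb ?ls (map (\<lambda>r j. real (r ! j)) rs) j = 0" using w0[OF j] by simp
  qed
  then have "v $ i = 0" if "i < ?r" for i
    using that v(1) by (metis carrier_vecD length_list_of_vec list_of_vec_index nth_mem singletonD subsetD)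
  then have "v = 0\<^sub>v ?r" using v(1) by (intro eq_vecI) auto
  then show False using v(2) by simp
qed

text \<open>Let \<open>t = y\<^sup>2\<close> with \<open>y = 8 s\<^sup>2\<close>. If all primes up to \<open>2 t\<close> divided the Gram determinant \<open>N\<close>, which is at
  most \<open>2\<close> to the power \<open>2 s\<^sup>2\<close>, then \<open>2 ^ t \<le> N ^ e\<close> for \<open>e = 2 y + 1\<close>, and this is false.\<close>

definition modulus_bound :: "nat \<Rightarrow> nat" where
  "modulus_bound s = 128 * (s * s * (s * s))"

lemma independent_mod_exists:
  assumes len: "\<And>r. r \<in> set rs \<Longrightarrow> length r = n \<and> set r \<subseteq> {..<2}"
    and size: "length rs \<le> s" "n \<le> s" "1 \<le> s"
    and ind: "\<And>ls :: real list. length ls = length rs \<Longrightarrow>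
      (\<And>j. j < n \<Longrightarrow> comb ls (map (\<lambda>r j. real (r ! j)) rs) j = 0) \<Longrightarrow> set ls \<subseteq> {0}"
  shows "\<exists>q < modulus_bound s. independent_mod (Suc (Suc q)) rs"
proof (rule ccontr)
  assume *: "\<not> ?thesis"
  define N where "N = nat \<bar>det (gram_mat n rs)\<bar>"
  define y where "y = 8 * (s * s)"
  define t where "t = y * y"
  define e where "e = 2 * y + 1"
  have bound: "modulus_bound s = 2 * t" by (simp add: modulus_bound_def t_def y_def)
  have N0: "0 < N" using det_gram_nonzero[OF ind] by (simp add: N_def)
  have "2 ^ t \<le> N ^ e"
  proof (rule all_small_primes_divide)
    fix p :: nat assume p: "prime p" "p \<le> 2 * t"
    \<comment> \<open>Moduli are written as \<open>q + 2\<close>, so that entries \<open>0\<close>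
      and \<open>1\<close> are always valid residues.\<close>
    have q: "p = Suc (Suc (p - 2))"
      using prime_ge_2_nat[OF p(1)] by simp
    have "p - 2 < modulus_bound s" using p(2) prime_ge_2_nat[OF p(1)] bound by simp
    then have "\<not> independent_mod p rs" using * q by metis
    moreover have "rows_ok p n rs"
      unfolding rows_ok_def
    proof
      fix r assume "r \<in> set rs"
      then show "length r = n \<and> set r \<subseteq> {..<p}"
        using len[of r] prime_ge_2_nat[OF p(1)] by auto
    qed
    ultimately have "int p dvd det (gram_mat n rs)"
      using independent_mod_complete[of p rs n] p(1) prime_dvd_det_gram[of p _ rs n] by blast
    then show "p dvd N" by (simp add: N_def)
  next
    \<comment> \<open>Squaring bounds \<open>t\<close> by \<open>2 ^ (2 y)\<close>; one more factor
      \<open>2\<close> explains \<open>e = 2 y + 1\<close>.\<close>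
    have "y < 2 ^ y" by (rule less_exp)
    then have "y * y < 2 ^ y * 2 ^ y" by (intro mult_strict_mono) auto
    then show "2 * t < 2 ^ e" by (simp add: t_def e_def mult_2 power_add)
  qed (use N0 size in \<open>auto simp: t_def y_def\<close>)
  moreover have "N ^ e < 2 ^ t"
  proof -
    have "r ! j \<le> 1" if "r \<in> set rs" "j < n" for r j
    proof -
      have "r ! j \<in> {..<2}" using len[OF that(1)] that(2) nth_mem[of j r] by blast
      then show ?thesis by simp
    qed
    then have "\<bar>det (gram_mat n rs)\<bar> \<le> fact (length rs) * int n ^ length rs"
      by (intro abs_det_gram_le) blast
    then have "int N \<le> int (fact (length rs) * n ^ length rs)" by (simp add: N_def)
    then have "N \<le> fact (length rs) * n ^ length rs" by (simp only: of_nat_le_iff)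
    also have "\<dots> \<le> s ^ s * s ^ s"
    proof (rule mult_le_mono)
      have "fact (length rs) \<le> (fact s :: nat)" using size(1) by (rule fact_mono_nat)
      also have "\<dots> \<le> s ^ s" by (metis fact_le_power le_refl of_nat_id)
      finally show "fact (length rs) \<le> s ^ s" .
      have "n ^ length rs \<le> s ^ length rs" using size by (intro power_mono) auto
      also have "\<dots> \<le> s ^ s" using size by (intro power_increasing) auto
      finally show "n ^ length rs \<le> s ^ s" .
    qed
    also have "\<dots> = s ^ (2 * s)" by (simp add: mult_2 power_add)
    also have "\<dots> \<le> (2 ^ s) ^ (2 * s)" by (rule power_mono[OF less_imp_le[OF less_exp]]) simp
    finally have "N ^ e \<le> ((2 ^ s) ^ (2 * s)) ^ e" by (intro power_mono) auto
    also have "\<dots> = 2 ^ (2 * (s * s) * e)" by (simp add: ac_simps flip: power_mult)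
    also have "\<dots> < 2 ^ t"
    proof (rule power_strict_increasing)
      have "1 \<le> s * s" using size(3) by simp
      \<comment> \<open>With \<open>z = s * s\<close> the claim is
        \<open>32 z^2 + 2 z < 64 z^2\<close>. The factor \<open>8\<close> in \<open>y\<close>
        provides this slack.\<close>
      have "2 * z * (2 * (8 * z) + 1) < 8 * z * (8 * z)" if "1 \<le> z" for z :: nat
      proof -
        have "z \<le> z * z" using that by simp
        then show ?thesis using that by (simp only: distrib_left mult_1_right)
      qed
      from this[OF \<open>1 \<le> s * s\<close>] show "2 * (s * s) * e < t" by (simp only: t_def e_def y_def)
    qed simp
    finally show ?thesis .
  qed
  ultimately show False by simp
qed

section \<open>Linear independence in the vector space\<close>

lemma comb_distinct:
  assumes "distinct vs"
  shows "comb (map a vs) (map (\<lambda>v j. v $ j) vs) j = (\<Sum>v\<in>set vs. a v * v $ j)"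
  using assms by (induction vs) auto

text \<open>Translates coefficient lists into the coefficient functions on sets that the vector
  space library uses.\<close>

lemma ex_map_distinct:
  assumes "distinct vs" "length ls = length vs"
  shows "\<exists>a. ls = map a vs"
  using assms(2,1)
proof (induction ls vs rule: list_induct2)
  case (Cons l ls v vs)
  then obtain a where "ls = map a vs" by auto
  then show ?case
    by (intro exI[of _ "a(v := l)"]) (use Cons.prems in auto)
qed simp

text \<open>In a relation of \<open>vs @ [v]\<close> a nonzero coefficient of \<open>v\<close> would
  express \<open>v\<close> through \<open>vs\<close>; once it is zero, independence of
  \<open>vs\<close> annihilates the rest. Conversely, \<open>v\<close> in the span gives a relation
  with coefficient \<open>-1\<close>. Lists are essential: for \<open>v\<close> among
  \<open>vs\<close> the repetition is a dependence that a set would hide.\<close>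

lemma not_in_span_iff:
  fixes v :: "real vec"
  assumes vs: "lin_indep_family n vs" "set vs \<subseteq> carrier_vec n" and v: "v \<in> carrier_vec n"
  shows "v \<notin> vec_span n (set vs) \<longleftrightarrow>
    (\<forall>ls. length ls = Suc (length vs) \<longrightarrow>
       (\<forall>j<n. comb ls (map (\<lambda>v j. v $ j) (vs @ [v])) j = 0) \<longrightarrow> set ls \<subseteq> {0})"
proof -
  interpret vec_space "TYPE(real)" n .
  have dist: "distinct vs" and ind: "\<not> lin_dep (set vs)"
    using vs(1) by (auto simp: lin_indep_family_def)
  have span: "vec_span n (set vs) = span (set vs)" by (simp add: vec_span_def)
  have fin: "finite (set vs)" by simp
  show ?thesis
  proof
    assume notin: "v \<notin> vec_span n (set vs)"
    show "\<forall>ls. length ls = Suc (length vs) \<longrightarrow>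
       (\<forall>j<n. comb ls (map (\<lambda>v j. v $ j) (vs @ [v])) j = 0) \<longrightarrow> set ls \<subseteq> {0}"
    proof (intro allI impI)
      fix ls assume len: "length ls = Suc (length vs)"
        and 0: "\<forall>j<n. comb ls (map (\<lambda>v j. v $ j) (vs @ [v])) j = 0"
      obtain ls' l where ls: "ls = ls' @ [l]" "length ls' = length vs"
        using len by (cases ls rule: rev_cases) auto
      obtain a where a: "ls' = map a vs" using ex_map_distinct[OF dist ls(2)] by blast
      have eq: "(\<Sum>w\<in>set vs. a w * w $ j) + l * v $ j = 0" if "j < n" for j
        using 0 that by (simp add: ls a comb_append comb_distinct[OF dist])
      have "l = 0"
      proof (rule ccontr)
        assume "l \<noteq> 0"
        have "v = lincomb (\<lambda>w. - a w / l) (set vs)"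
        proof (rule eq_vecI)
          have c: "lincomb (\<lambda>w. - a w / l) (set vs) \<in> carrier_vec n"
            using vs(2) by (rule lincomb_closed)
          then show "dim_vec v = dim_vec (lincomb (\<lambda>w. - a w / l) (set vs))" using v by auto
          fix j assume "j < dim_vec (lincomb (\<lambda>w. - a w / l) (set vs))"
          then have j: "j < n" using c by auto
          have "lincomb (\<lambda>w. - a w / l) (set vs) $ j = (\<Sum>w\<in>set vs. (- a w / l) * w $ j)"
            using j vs(2) by (intro lincomb_index)
          also have "\<dots> = - (\<Sum>w\<in>set vs. a w * w $ j) / l"
            by (simp add: sum_negf sum_divide_distrib)
          also have "\<dots> = v $ j" using eq[OF j] \<open>l \<noteq> 0\<close> by (simp add: field_simps)
          finally show "v $ j = lincomb (\<lambda>w. - a w / l) (set vs) $ j" ..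
        qed
        then have "v \<in> span (set vs)" unfolding span_def using fin by blast
        then show False using notin span by simp
      qed
      have "a w = 0" if "w \<in> set vs" for w
      proof (rule ccontr)
        assume "a w \<noteq> 0"
        have "lincomb a (set vs) = 0\<^sub>v n"
        proof (rule eq_vecI)
          have c: "lincomb a (set vs) \<in> carrier_vec n"
            using vs(2) by (rule lincomb_closed)
          then show "dim_vec (lincomb a (set vs)) = dim_vec (0\<^sub>v n)" by auto
          fix j assume "j < dim_vec (0\<^sub>v n :: real vec)"
          then have j: "j < n" by simp
          have "lincomb a (set vs) $ j = (\<Sum>w\<in>set vs. a w * w $ j)"
            using j vs(2) by (intro lincomb_index)
          then show "lincomb a (set vs) $ j = 0\<^sub>v n $ j" using eq[OF j] \<open>l = 0\<close> j by simp
        qed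
        then have "lin_dep (set vs)"
          unfolding lin_dep_def using that \<open>a w \<noteq> 0\<close> fin
          by (intro exI[of _ "set vs"] exI[of _ a] exI[of _ w]) (simp add: class_ring_simps)
        then show False using ind by simp
      qed
      then show "set ls \<subseteq> {0}" using \<open>l = 0\<close> by (auto simp: ls a)
    qed
  next
    assume R: "\<forall>ls. length ls = Suc (length vs) \<longrightarrow>
       (\<forall>j<n. comb ls (map (\<lambda>v j. v $ j) (vs @ [v])) j = 0) \<longrightarrow> set ls \<subseteq> {0}"
    show "v \<notin> vec_span n (set vs)"
    proof
      assume "v \<in> vec_span n (set vs)"
      then have "v \<in> span (set vs)" by (simp only: span)
      from finite_in_span[OF fin vs(2) this] obtain a where a: "v = lincomb a (set vs)" by blast
      have "comb (map a vs @ [-1]) (map (\<lambda>v j. v $ j) (vs @ [v])) j = 0" if "j < n" for j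
      proof -
        have "v $ j = (\<Sum>w\<in>set vs. a w * w $ j)"
          unfolding a by (rule lincomb_index[OF that vs(2)])
        then show ?thesis by (simp add: comb_append comb_distinct[OF dist])
      qed
      then have "set (map a vs @ [-1]) \<subseteq> {0}"
        by (intro R[rule_format]) auto
      then show False by simp
    qed
  qed
qed


section \<open>Binary arithmetic in polynomial time\<close>

text \<open>A wrapper type, since \<open>nat\<close> itself is already encoded in unary.\<close>

datatype bin = Bin (num_of: nat)

instantiation bin :: enc
begin
definition enc_bin :: "bin \<Rightarrow> tree" where
  "enc_bin b = enc (nat_bits (num_of b))"
instance ..
end

abbreviation blen :: "nat \<Rightarrow> nat" where
  "blen m \<equiv> length (nat_bits m)"

primrec bits_val :: "bool list \<Rightarrow> nat" where
  "bits_val [] = 0"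
| "bits_val (b # bs) = of_bool b + 2 * bits_val bs"

lemma nat_bits_0 [simp]: "nat_bits 0 = []"
  by (simp add: nat_bits.simps)

lemma nat_bits_rec: "0 < m \<Longrightarrow> nat_bits m = odd m # nat_bits (m div 2)"
  by (subst nat_bits.simps) simp

lemma bits_val_nat_bits [simp]: "bits_val (nat_bits m) = m"
proof (induction m rule: nat_bits.induct)
  case (1 m)
  then show ?case by (cases "m = 0") (auto simp: nat_bits_rec of_bool_odd_eq_mod_2)
qed

lemma nat_bits_bits_val_Cons:
  "nat_bits (bits_val (b # bs)) = (if b \<or> nat_bits (bits_val bs) \<noteq> [] then b # nat_bits (bits_val bs) else [])"
proof -
  have "nat_bits m = [] \<longleftrightarrow> m = 0" for m by (subst nat_bits.simps) simp
  then show ?thesis by (auto simp: nat_bits_rec)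
qed

lemma bits_val_less: "bits_val bs < 2 ^ length bs"
  by (induction bs) (auto simp: of_bool_def)

lemma less_two_power_blen: "m < 2 ^ blen m"
  using bits_val_less[of "nat_bits m"] by simp

lemma blen_le: "m < 2 ^ k \<Longrightarrow> blen m \<le> k"
proof (induction k arbitrary: m)
  case (Suc k)
  show ?case
  proof (cases "m = 0")
    case False
    then show ?thesis using Suc.IH[of "m div 2"] Suc.prems by (simp add: nat_bits_rec)
  qed simp
qed simp

lemma blen_add: "blen (m + n) \<le> Suc (max (blen m) (blen n))"
proof (rule blen_le)
  have "m < 2 ^ max (blen m) (blen n)" "n < 2 ^ max (blen m) (blen n)"
    using less_two_power_blen[of m] less_two_power_blen[of n]
    by (meson less_le_trans one_le_numeral power_increasing max.cobounded1 max.cobounded2)+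
  then show "m + n < 2 ^ Suc (max (blen m) (blen n))" by simp
qed

lemma blen_mult: "blen (m * n) \<le> blen m + blen n"
  by (rule blen_le) (simp add: power_add mult_strict_mono less_two_power_blen)

lemma sz_bool_list: "sz bs = 2 * length bs + 1" for bs :: "bool list"
  by (induction bs) auto

lemma sz_Bin: "sz b = 2 * blen (num_of b) + 1"
  using sz_bool_list[of "nat_bits (num_of b)"] by (simp add: sz_def cd_def enc_bin_def)

lemma fp_nat_bits [fp_intros]:
  assumes "fp f"
  shows "fp (\<lambda>x. nat_bits (num_of (f x)))"
  by (rule fp_on_cong[OF assms]) (simp only: enc_bin_def)

lemma fp_bits_val [fp_intros]:
  assumes l: "fp l"
  shows "fp (\<lambda>x. Bin (bits_val (l x)))"
proof -
  have "fp (\<lambda>x. foldr (\<lambda>b a. if b \<or> \<not> a = [] then b # a else []) (l x) [])"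
  proof (rule fp_foldr_additive[where h = "\<lambda>n. n + 2"])
    show "fp (\<lambda>z :: 'a \<times> bool \<times> bool list.
        if fst (snd z) \<or> \<not> snd (snd z) = [] then fst (snd z) # snd (snd z) else [])"
      by (intro fp_intros)
  qed ((intro fp_intros poly_intros l)+, auto)
  moreover have "foldr (\<lambda>b a. if b \<or> \<not> a = [] then b # a else []) bs [] = nat_bits (bits_val bs)" for bs
  proof (induction bs)
    case (Cons b bs)
    then show ?case unfolding nat_bits_bits_val_Cons by simp
  qed simp
  ultimately have "fp (\<lambda>x. nat_bits (bits_val (l x)))" by simp
  then show ?thesis by (rule fp_on_cong) (simp add: enc_bin_def)
qed

text \<open>A full adder: the nested equality is the exclusive or of the two bits and the carry, and
  the new carry is their majority.\<close>

fun add_bits :: "bool \<Rightarrow> (bool \<times> bool) list \<Rightarrow> bool list" where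
  "add_bits c [] = [c]"
| "add_bits c (z # zs) =
     ((fst z = snd z) = c) # add_bits (if fst z = snd z then fst z else c) zs"

lemma bits_val_add_bits:
  "bits_val (add_bits c zs) = of_bool c + bits_val (map fst zs) + bits_val (map snd zs)"
  by (induction zs arbitrary: c) auto

text \<open>Each list is padded by the length of the other, which makes the lengths equal without
  comparing them.\<close>

definition pad_zip :: "bool list \<Rightarrow> bool list \<Rightarrow> (bool \<times> bool) list" where
  "pad_zip xs ys = zip (xs @ map (\<lambda>_. False) ys) (ys @ map (\<lambda>_. False) xs)"

lemma bits_val_append_False: "bits_val (xs @ map (\<lambda>_. False) ys) = bits_val xs"
proof (induction xs)
  case Nil
  show ?case by (induction ys) auto
qed simp

lemma pad_zip_vals:
  "bits_val (map fst (pad_zip xs ys)) = bits_val xs" "bits_val (map snd (pad_zip xs ys)) = bits_val ys"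
  by (simp_all add: pad_zip_def bits_val_append_False)

lemma fp_pad_zip [fp_intros]: "fp f \<Longrightarrow> fp g \<Longrightarrow> fp (\<lambda>x. pad_zip (f x) (g x))"
  unfolding pad_zip_def by (intro fp_intros)

definition bin_add :: "bin \<Rightarrow> bin \<Rightarrow> bin" where
  "bin_add a b = Bin (num_of a + num_of b)"

lemma fp_bin_add [fp_intros]:
  assumes "fp f" "fp g"
  shows "fp (\<lambda>x. bin_add (f x) (g x))"
proof -
  define F :: "bool \<times> bool list \<Rightarrow> bool \<times> bool \<Rightarrow> bool \<times> bool list" where
    "F p z = (if fst z = snd z then fst z else fst p, ((fst z = snd z) = fst p) # snd p)" for p z
  have F: "rev (snd (foldl F (c, o') zs)) @ [fst (foldl F (c, o') zs)] = rev o' @ add_bits c zs" for c o' zs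
    by (induction zs arbitrary: c o') (auto simp: F_def)
  let ?zs = "\<lambda>x. pad_zip (nat_bits (num_of (f x))) (nat_bits (num_of (g x)))"
  have fold: "fp (\<lambda>x. foldl F (False, []) (?zs x))"
  proof (rule fp_foldl_additive[where h = "\<lambda>n. n + 2"])
    show "fp (\<lambda>z :: 'a \<times> (bool \<times> bool list) \<times> bool \<times> bool. F (fst (snd z)) (snd (snd z)))"
      unfolding F_def by (intro fp_intros)
    show "sz (F b y) \<le> sz b + (sz x + sz y + 2)" for x :: 'a and b y
      by (cases b) (auto simp: F_def)
  qed (intro fp_intros poly_intros assms)+
  have "fp (\<lambda>x. Bin (bits_val (rev (snd (foldl F (False, []) (?zs x))) @ [fst (foldl F (False, []) (?zs x))])))"
    by (intro fp_intros fold)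
  then show ?thesis
    by (simp add: F bits_val_add_bits pad_zip_vals bin_add_def)
qed

definition bin_mult :: "bin \<Rightarrow> bin \<Rightarrow> bin" where
  "bin_mult a b = Bin (num_of a * num_of b)"

text \<open>Horner's rule from the most significant bit: double, then add \<open>a\<close> or
  nothing.\<close>

lemma fp_bin_mult [fp_intros]:
  assumes "fp f" "fp g"
  shows "fp (\<lambda>x. bin_mult (f x) (g x))"
proof -
  define F where "F a p b = bin_add (bin_add p p) (if b then a else Bin 0)" for a p and b :: bool
  \<comment> \<open>Doubling is done by an addition of equal numbers, which lengthens the number by
    one bit at most; the second addition takes a maximum of lengths. Growth is therefore
    additive.\<close>
  have sz: "sz (F a p b) \<le> sz p + (2 * (sz a + sz b) + 10)" for a p b
  proof -
    let ?p = "num_of p"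
    have "blen (?p + ?p + n) \<le> Suc (max (Suc (blen ?p)) (blen n))" for n
      using blen_add[of "?p + ?p" n] blen_add[of ?p ?p] by simp
    from this[of "num_of (if b then a else Bin 0)"]
    show ?thesis by (auto simp: F_def sz_Bin bin_add_def)
  qed
  have F: "num_of (foldl (F a) p (rev bs)) = 2 ^ length bs * num_of p + bits_val bs * num_of a" for a p bs
    by (induction bs) (auto simp: F_def bin_add_def algebra_simps)
  have "fp (\<lambda>z. foldl (F (fst z)) (Bin 0) (rev (nat_bits (num_of (snd z)))))"
  proof (rule fp_foldl_additive[where h = "\<lambda>n. 2 * n + 10"])
    show "fp (\<lambda>z :: (bin \<times> bin) \<times> bin \<times> bool. F (fst (fst z)) (fst (snd z)) (snd (snd z)))"
      unfolding F_def by (intro fp_intros)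
    show "sz (F (fst z) p b) \<le> sz p + (2 * (sz z + sz b) + 10)" for z :: "bin \<times> bin" and p b
      using sz[of "fst z" p b] by (simp add: sz_prod)
  qed (intro fp_intros poly_intros)+
  from fp_comp[OF this fp_Pair[OF assms]] show ?thesis
    by (rule fp_on_cong) (simp add: bin_mult_def enc_bin_def F mult.commute)
qed

definition bin_less :: "bin \<Rightarrow> bin \<Rightarrow> bool" where
  "bin_less a b \<longleftrightarrow> num_of a < num_of b"

text \<open>The least significant bit comes first, so the last position where the numbers differ
  decides, and later verdicts overwrite earlier ones.\<close>

lemma fp_bin_less [fp_intros]:
  assumes "fp f" "fp g"
  shows "fp (\<lambda>x. bin_less (f x) (g x))"
proof -
  define F :: "bool \<Rightarrow> bool \<times> bool \<Rightarrow> bool" where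
    "F r z = (if fst z = snd z then r else snd z)" for r z
  have F: "foldl F r zs = (if bits_val (map fst zs) = bits_val (map snd zs) then r
      else bits_val (map fst zs) < bits_val (map snd zs))" for r zs
  proof (induction zs arbitrary: r)
    case (Cons z zs)
    show ?case
      unfolding foldl_Cons Cons.IH
      by (cases "fst z"; cases "snd z";
          cases "bits_val (map fst zs)" "bits_val (map snd zs)" rule: linorder_cases) (auto simp: F_def)
  qed simp
  have "fp (\<lambda>x. foldl F False (pad_zip (nat_bits (num_of (f x))) (nat_bits (num_of (g x)))))"
  proof (rule fp_foldl_additive[where h = "\<lambda>n. n"])
    show "fp (\<lambda>z :: 'a \<times> bool \<times> bool \<times> bool. F (fst (snd z)) (snd (snd z)))"
      unfolding F_def by (intro fp_intros)
  qed ((intro fp_intros poly_intros assms)+, simp)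
  then show ?thesis
    by (rule fp_on_cong) (auto simp: F pad_zip_vals bin_less_def)
qed


section \<open>The algorithm\<close>

lemma fp_comp2: "fp (\<lambda>z. h (fst z) (snd z)) \<Longrightarrow> fp f \<Longrightarrow> fp g \<Longrightarrow> fp (\<lambda>x. h (f x) (g x))"
  using fp_comp[OF _ fp_Pair, of "\<lambda>z. h (fst z) (snd z)" f g] by simp

lemma fp_comp3:
  assumes "fp (\<lambda>z. h (fst z) (fst (snd z)) (snd (snd z)))" "fp f" "fp g" "fp k"
  shows "fp (\<lambda>x. h (f x) (g x) (k x))"
  using fp_comp[OF assms(1) fp_Pair[OF assms(2) fp_Pair[OF assms(3,4)]]] by simp

lemma sz_append: "sz (xs @ ys) + 1 = sz xs + sz ys"
  by (induction xs) auto

lemma sz_rev [simp]: "sz (rev xs) = sz xs"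
proof (induction xs)
  case (Cons x xs)
  then show ?case using sz_append[of "rev xs" "[x]"] by simp
qed simp

lemma sz_list_le: "(\<And>x. x \<in> set xs \<Longrightarrow> sz x \<le> k) \<Longrightarrow> sz xs \<le> 1 + length xs * (1 + k)"
  by (induction xs) (auto simp: add_mono algebra_simps, fastforce)

lemma fp_tl [fp_intros]: "fp l \<Longrightarrow> fp (\<lambda>x. tl (l x))"
proof -
  assume "fp l"
  then have "fp (\<lambda>x. case l x of [] \<Rightarrow> [] | y # ys \<Rightarrow> ys)" by (intro fp_intros)
  then show ?thesis by (rule fp_on_cong) (auto split: list.splits)
qed

definition head :: "'a \<Rightarrow> 'a list \<Rightarrow> 'a" where
  "head d xs = (case xs of [] \<Rightarrow> d | x # _ \<Rightarrow> x)"

lemma head_simps [simp]: "head d [] = d" "head d (x # xs) = x"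
  by (simp_all add: head_def)

lemma fp_head [fp_intros]: "fp l \<Longrightarrow> fp (\<lambda>x. head d (l x))"
  unfolding head_def by (intro fp_intros)

lemma fp_list_ex [fp_intros]:
  assumes P: "fp (\<lambda>z. P (fst z) (snd z))" and l: "fp l"
  shows "fp (\<lambda>x. list_ex (P x) (l x))"
proof -
  have "fp (\<lambda>x. foldr (\<lambda>y a. P x y \<or> a) (l x) False)"
  proof (rule fp_foldr_additive[where h = "\<lambda>n. n"])
    show "fp (\<lambda>z :: 'a \<times> 'b \<times> bool. P (fst z) (fst (snd z)) \<or> snd (snd z))"
      by (intro fp_intros fp_comp2[OF P])
  qed ((intro fp_intros poly_intros l)+, simp)
  moreover have "foldr (\<lambda>y a. P x y \<or> a) ys False = list_ex (P x) ys" for x ys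
    by (induction ys) auto
  ultimately show ?thesis by simp
qed

subsection \<open>Independence\<close>

lemma fp_pivot_entry [fp_intros]:
  assumes "fp f"
  shows "fp (\<lambda>x. pivot_entry (f x))"
  unfolding pivot_entry_def
proof (rule fp_foldr_additive[where h = "\<lambda>n. n"])
  show "fp (\<lambda>z :: 'a \<times> (nat \<times> nat) \<times> nat \<times> nat. if fst (fst (snd z)) = 0 then snd (snd z) else fst (snd z))"
    by (intro fp_intros)
qed ((intro fp_intros poly_intros assms)+, auto)

lemma fp_eliminate [fp_intros]:
  assumes "fp q" "fp b" "fp r"
  shows "fp (\<lambda>x. eliminate (Suc (q x)) (b x) (r x))"
proof (rule fp_comp3[where h = "\<lambda>q. eliminate (Suc q)", OF _ assms])
  show "fp (\<lambda>z :: nat \<times> nat list \<times> nat list. eliminate (Suc (fst z)) (fst (snd z)) (snd (snd z)))"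
    unfolding eliminate_def Let_def by (intro fp_intros)
qed

text \<open>One round of \<open>independent_mod\<close> on a pair of verdict and remaining rows. The
  original list of rows serves as the clock for the fold.\<close>

definition independent_step :: "nat \<Rightarrow> bool \<times> nat list list \<Rightarrow> bool \<times> nat list list" where
  "independent_step m p = (case snd p of [] \<Rightarrow> p
     | b # rs \<Rightarrow> (fst p \<and> list_ex (\<lambda>y. \<not> y = 0) b, map (eliminate m b) rs))"

lemma independent_step_foldl:
  "length zs = length rs \<Longrightarrow>
     fst (foldl (\<lambda>p _. independent_step m p) (c, rs) zs) = (c \<and> independent_mod m rs)"
proof (induction zs arbitrary: c rs)
  case (Cons z zs)
  then show ?case by (cases rs) (auto simp: independent_step_def)
qed simp

text \<open>The invariant behind the running time: elimination creates no new rows or columns, and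
  new entries are remainders, so one absolute bound \<open>k\<close> survives all rounds.\<close>

definition small_rows :: "nat \<Rightarrow> nat list list \<Rightarrow> bool" where
  "small_rows k rs \<longleftrightarrow> length rs \<le> k \<and> (\<forall>r\<in>set rs. length r \<le> k \<and> set r \<subseteq> {..k})"

lemma small_rows_eliminate:
  "small_rows k (b # rs) \<Longrightarrow> q \<le> k \<Longrightarrow> small_rows k (map (eliminate (Suc q) b) rs)"
proof -
  have "x mod Suc q \<le> q" for x
    using mod_less_divisor[of "Suc q" x] by simp
  then have "x mod Suc q \<le> k" if "q \<le> k" for x
    using that le_trans by blast
  then show "small_rows k (b # rs) \<Longrightarrow> q \<le> k \<Longrightarrow> ?thesis"
    by (auto simp: small_rows_def eliminate_def Let_def)
qed

lemma small_rows_foldl: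
  "small_rows k rs \<Longrightarrow> q \<le> k \<Longrightarrow> small_rows k (snd (foldl (\<lambda>p _. independent_step (Suc q) p) (c, rs) zs))"
proof (induction zs arbitrary: c rs)
  case (Cons z zs)
  show ?case
  proof (cases rs)
    case Nil
    then show ?thesis using Cons by (simp add: independent_step_def)
  next
    case (Cons b rs')
    then show ?thesis
      using Cons.IH[OF small_rows_eliminate[of k b rs' q]] Cons.prems by (simp add: independent_step_def)
  qed
qed simp

lemma small_rows_sz: "small_rows k rs \<Longrightarrow> sz rs \<le> 1 + k * (1 + (1 + k * (1 + (2 * k + 1))))"
proof -
  assume *: "small_rows k rs"
  have "sz r \<le> 1 + k * (1 + (2 * k + 1))" if "r \<in> set rs" for r
  proof -
    have "sz r \<le> 1 + length r * (1 + (2 * k + 1))"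
      by (rule sz_list_le) (use * that in \<open>auto simp: small_rows_def\<close>)
    also have "\<dots> \<le> 1 + k * (1 + (2 * k + 1))"
      using * that by (intro add_left_mono mult_le_mono1) (auto simp: small_rows_def)
    finally show ?thesis .
  qed
  then have "sz rs \<le> 1 + length rs * (1 + (1 + k * (1 + (2 * k + 1))))"
    by (rule sz_list_le)
  also have "\<dots> \<le> 1 + k * (1 + (1 + k * (1 + (2 * k + 1))))"
    using * by (intro add_left_mono mult_le_mono1) (auto simp: small_rows_def)
  finally show ?thesis .
qed

lemma nat_le_sz: "n \<in> set r \<Longrightarrow> n \<le> sz r" for r :: "nat list"
  using sz_le_mem[of n r] by simp

lemma small_rows_self: "small_rows (q + sz rs) rs"
  unfolding small_rows_def
proof (intro conjI ballI)
  show "length rs \<le> q + sz rs" using length_le_sz[of rs] by simp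
  fix r assume r: "r \<in> set rs"
  show "length r \<le> q + sz rs" using length_le_sz[of r] sz_le_mem[OF r] by simp
  show "set r \<subseteq> {..q + sz rs}" using nat_le_sz[of _ r] sz_le_mem[OF r] by fastforce
qed

lemma fp_independent_mod [fp_intros]:
  assumes "fp q" "fp rs"
  shows "fp (\<lambda>x. independent_mod (Suc (q x)) (rs x))"
proof (rule fp_comp2[where h = "\<lambda>q. independent_mod (Suc q)", OF _ assms])
  let ?S = "\<lambda>n. 2 + (1 + n * (1 + (1 + n * (1 + (2 * n + 1)))))"
  have "fp (\<lambda>z. foldl (\<lambda>p _. independent_step (Suc (fst z)) p) (True, snd z) (snd z))"
  proof (rule fp_foldl[where S = ?S])
    show "fp (\<lambda>z :: (nat \<times> nat list list) \<times> (bool \<times> nat list list) \<times> nat list.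
        independent_step (Suc (fst (fst z))) (fst (snd z)))"
      unfolding independent_step_def by (intro fp_intros)
    show "poly_bounded ?S" by (intro poly_intros)
    fix z :: "nat \<times> nat list list" and i
    obtain q rs where z: "z = (q, rs)" by force
    let ?r = "foldl (\<lambda>p _. independent_step (Suc q) p) (True, rs) (take i rs)"
    have "small_rows (sz z) rs"
      using small_rows_self[of q rs] by (fastforce simp: z small_rows_def)
    then have "small_rows (sz z) (snd ?r)"
      by (rule small_rows_foldl) (simp add: z)
    from small_rows_sz[OF this]
    show "sz (foldl (\<lambda>p _. independent_step (Suc (fst z)) p) (True, snd z) (take i (snd z))) \<le> ?S (sz z)"
      by (cases ?r) (simp add: z)
  qed (intro fp_intros)+
  then have "fp (\<lambda>z. fst (foldl (\<lambda>p _. independent_step (Suc (fst z)) p) (True, snd z) (snd z)))"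
    by (intro fp_intros)
  then show "fp (\<lambda>z. independent_mod (Suc (fst z)) (snd z))"
    by (simp add: independent_step_foldl)
qed

text \<open>At most \<open>n\<close> given sets and one new row make at most \<open>Suc n\<close>
  rows, hence the argument of the bound.\<close>

definition independent :: "nat \<Rightarrow> nat list list \<Rightarrow> bool" where
  "independent n rs \<longleftrightarrow> (\<exists>q < modulus_bound (Suc n). independent_mod (Suc (Suc q)) rs)"

lemma fp_independent [fp_intros]:
  assumes "fp n" "fp rs"
  shows "fp (\<lambda>x. independent (n x) (rs x))"
proof (rule fp_comp2[OF _ assms])
  define F where "F = (\<lambda>(z :: nat \<times> nat list list) (p :: nat \<times> bool) (_ :: bool).
    (Suc (fst p), snd p \<or> independent_mod (Suc (Suc (fst p))) (snd z)))"
  have F: "foldl (F z) (q, c) zs = (q + length zs, c \<or> (\<exists>q'. q \<le> q' \<and> q' < q + length zs \<and> independent_mod (Suc (Suc q')) (snd z)))" for z q c zs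
  proof (induction zs arbitrary: q c)
    case (Cons y zs)
    have "foldl (F z) (q, c) (y # zs) = foldl (F z) (Suc q, c \<or> independent_mod (Suc (Suc q)) (snd z)) zs"
      by (simp add: F_def)
    moreover have "(\<exists>q'. q \<le> q' \<and> q' < q + length (y # zs) \<and> independent_mod (Suc (Suc q')) (snd z)) \<longleftrightarrow>
        independent_mod (Suc (Suc q)) (snd z) \<or> (\<exists>q'. Suc q \<le> q' \<and> q' < Suc q + length zs \<and> independent_mod (Suc (Suc q')) (snd z))"
      by (metis (no_types, lifting) Suc_leD Suc_le_eq add_Suc_right add_Suc_shift le_add1 le_eq_less_or_eq length_Cons less_Suc_eq_le)
    ultimately show ?case using Cons.IH[of "Suc q"] by auto
  qed auto
  have "fp (\<lambda>z. foldl (F z) (0, False) (replicate (modulus_bound (Suc (fst z))) False))"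
  proof (rule fp_foldl_additive[where h = "\<lambda>n. 2"])
    show "fp (\<lambda>z :: (nat \<times> nat list list) \<times> (nat \<times> bool) \<times> bool. F (fst z) (fst (snd z)) (snd (snd z)))"
      unfolding F_def by (intro fp_intros)
    show "fp (\<lambda>z :: nat \<times> nat list list. replicate (modulus_bound (Suc (fst z))) False)"
      unfolding modulus_bound_def by (intro fp_intros fp_replicate_False)
    show "sz (F x b y) \<le> sz b + 2" for x b y
      by (cases b) (simp add: F_def)
  qed (intro fp_intros poly_intros)+
  then have "fp (\<lambda>z. snd (foldl (F z) (0, False) (replicate (modulus_bound (Suc (fst z))) False)))"
    by (intro fp_intros)
  then show "fp (\<lambda>z. independent (fst z) (snd z))"
    by (simp add: F independent_def)
qed

subsection \<open>Signs of sums of fractions\<close>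

text \<open>A term \<open>(sg, z, d)\<close> stands for \<open>z / d\<close> or, if \<open>sg\<close> holds, \<open>- z / d\<close>; a triple
  \<open>(P, N, D)\<close> stands for \<open>(P - N) / D\<close>.\<close>

definition sum_step :: "bin \<times> bin \<times> bin \<Rightarrow> bool \<times> bin \<times> bin \<Rightarrow> bin \<times> bin \<times> bin" where
  "sum_step = (\<lambda>(P, N, D) (sg, z, d).
     if sg then (bin_mult P d, bin_add (bin_mult N d) (bin_mult z D), bin_mult D d)
     else (bin_add (bin_mult P d) (bin_mult z D), bin_mult N d, bin_mult D d))"

definition sum_negative :: "(bool \<times> bin \<times> bin) list \<Rightarrow> bool" where
  "sum_negative ts = (case foldl sum_step (Bin 0, Bin 0, Bin 1) ts of (P, N, D) \<Rightarrow> bin_less P N)"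

text \<open>The total size of a triple can jump, since a short numerator may become as long as the
  common denominator. The maximum of the three bit lengths, however, grows at most by the lengths of
  the new term and one carry.\<close>

lemma fp_sum_negative [fp_intros]:
  assumes "fp f"
  shows "fp (\<lambda>x. sum_negative (f x))"
proof -
  define \<mu> where "\<mu> = (\<lambda>(P, N, D). max (blen (num_of P)) (max (blen (num_of N)) (blen (num_of D))))"
  have "fp (\<lambda>x. foldl sum_step (Bin 0, Bin 0, Bin 1) (f x))"
  proof (rule fp_foldl_measure[where \<mu> = \<mu> and c = 6 and h = "\<lambda>n. n + 1"])
    show "fp (\<lambda>z :: 'a \<times> (bin \<times> bin \<times> bin) \<times> bool \<times> bin \<times> bin. sum_step (fst (snd z)) (snd (snd z)))"
      unfolding sum_step_def case_prod_beta by (intro fp_intros)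
    show "\<mu> b \<le> sz b" for b
      by (cases b) (auto simp: \<mu>_def sz_Bin)
    show "sz b \<le> 6 * \<mu> b + 6" for b
      by (cases b) (auto simp: \<mu>_def sz_Bin)
    show "\<mu> (sum_step b y) \<le> \<mu> b + (sz x + sz y + 1)" for x :: 'a and b y
    proof -
      obtain P N D where b: "b = (P, N, D)" by (cases b) auto
      obtain sg z d where y: "y = (sg, z, d)" by (cases y) auto
      let ?k = "\<mu> b + blen (num_of z) + blen (num_of d)"
      have le: "blen (num_of P) \<le> \<mu> b" "blen (num_of N) \<le> \<mu> b" "blen (num_of D) \<le> \<mu> b"
        by (auto simp: b \<mu>_def)
      have m: "blen (num_of a * num_of d) \<le> ?k" "blen (num_of z * num_of a) \<le> ?k"
        if "blen (num_of a) \<le> \<mu> b" for a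
        using blen_mult[of "num_of a" "num_of d"] blen_mult[of "num_of z" "num_of a"] that by linarith+
      have a: "blen (num_of a * num_of d + num_of z * num_of D) \<le> Suc ?k"
        if "blen (num_of a) \<le> \<mu> b" for a
        using blen_add[of "num_of a * num_of d" "num_of z * num_of D"] m(1)[OF that] m(2)[OF le(3)] by linarith
      have "\<mu> (sum_step b y) \<le> Suc ?k"
        using m(1)[OF le(1)] m(1)[OF le(2)] m(1)[OF le(3)] a[OF le(1)] a[OF le(2)]
        unfolding \<mu>_def by (auto simp: b y sum_step_def bin_add_def bin_mult_def)
      then show ?thesis by (simp add: y sz_Bin)
    qed
  qed (intro fp_intros poly_intros assms)+
  then show ?thesis unfolding sum_negative_def by (intro fp_intros)
qed

subsection \<open>Reading the input\<close>

lemma fp_eq_symbol [fp_intros]: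
  assumes "fp f"
  shows "fp (\<lambda>x. f x = (a :: symbol))"
proof -
  have "fp (\<lambda>x. if f x = a then True else False)"
  proof (rule fp_on_branch[where X = "{sym_val a}", OF assms])
    show "hd (cd (f x)) \<in> {sym_val a} \<longleftrightarrow> f x = a" for x
      by (cases "f x"; cases a) (auto simp: cd_symbol)
  qed (auto intro: fp_fp_on fp_const)
  then show ?thesis by (rule fp_on_cong) auto
qed

definition chunk_step :: "bool list list \<times> bool list \<Rightarrow> symbol \<Rightarrow> bool list list \<times> bool list" where
  "chunk_step p a = (if a = S3 then (rev (snd p) # fst p, []) else (fst p, (a = S2) # snd p))"

definition chunks :: "symbol list \<Rightarrow> bool list list" where
  "chunks w = rev (fst (foldl chunk_step ([], []) w))"

definition bit_symbol :: "bool \<Rightarrow> symbol" where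
  "bit_symbol b = (if b then S2 else S1)"

definition unchunk :: "bool list \<Rightarrow> symbol list" where
  "unchunk bs = map bit_symbol bs @ [S3]"

lemma fp_chunks [fp_intros]:
  assumes "fp f"
  shows "fp (\<lambda>x. chunks (f x))"
proof -
  have "fp (\<lambda>x. foldl chunk_step ([], []) (f x))"
  proof (rule fp_foldl_additive[where h = "\<lambda>n. n + 2"])
    show "fp (\<lambda>z :: 'a \<times> (bool list list \<times> bool list) \<times> symbol. chunk_step (fst (snd z)) (snd (snd z)))"
      unfolding chunk_step_def by (intro fp_intros)
    show "sz (chunk_step b y) \<le> sz b + (sz x + sz y + 2)" for x :: 'a and b y
      by (cases b) (auto simp: chunk_step_def)
  qed (intro fp_intros poly_intros assms)+
  then show ?thesis unfolding chunks_def by (intro fp_intros)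
qed

lemma chunks_unchunk: "chunks (concat (map unchunk bss)) = bss"
proof -
  have 1: "foldl chunk_step (ds, cur) (map bit_symbol bs) = (ds, rev bs @ cur)" for ds cur bs
    by (induction bs arbitrary: cur) (auto simp: chunk_step_def bit_symbol_def)
  have "foldl chunk_step (ds, []) (concat (map unchunk bss)) = (rev bss @ ds, [])" for ds
    by (induction bss arbitrary: ds) (auto simp: unchunk_def 1, simp add: chunk_step_def)
  then show ?thesis by (simp add: chunks_def)
qed

text \<open>A rational occupies two chunks, because the sign bit is followed by the numerator
  without a separator.\<close>

definition read_rat :: "bool list list \<Rightarrow> bool \<times> bin \<times> bin" where
  "read_rat cs = (head False (head [] cs), Bin (bits_val (tl (head [] cs))), Bin (bits_val (head [] (tl cs))))"

lemma fp_read_rat [fp_intros]: "fp f \<Longrightarrow> fp (\<lambda>x. read_rat (f x))"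
  unfolding read_rat_def by (intro fp_intros)

type_synonym item = "bool \<times> bool \<times> bin \<times> bin"

text \<open>Elements outside \<open>R\<close> receive the flag \<open>False\<close> and the weight
  \<open>0 / 1\<close>, so that items stay aligned with bit vectors over the whole ground set; only
  elements of \<open>R\<close> consume chunks.\<close>

definition item_step :: "item list \<times> bool list list \<Rightarrow> bool \<Rightarrow> item list \<times> bool list list" where
  "item_step p r = (if r then ((True, read_rat (snd p)) # fst p, tl (tl (snd p)))
     else ((False, False, Bin 0, Bin 1) # fst p, snd p))"

definition read_items :: "bool list \<Rightarrow> bool list list \<Rightarrow> item list \<times> bool list list" where
  "read_items R cs = (case foldl item_step ([], cs) R of (its, cs') \<Rightarrow> (rev its, cs'))"

text \<open>The two consumed chunks pay for the number that is read, so a round of the fold adds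
  only a constant.\<close>

lemma sz_read_rat: "sz (read_rat cs) + sz (tl (tl cs)) \<le> sz cs + 20"
proof -
  have bv: "sz (Bin (bits_val bs)) \<le> sz bs" for bs
    using blen_le[OF bits_val_less[of bs]] by (simp add: sz_Bin sz_bool_list)
  have Nil: "sz (Bin 0) = 1" by (simp add: sz_Bin)
  have tl: "sz (tl bs) \<le> sz bs" for bs :: "bool list" by (cases bs) auto
  show ?thesis
  proof (cases cs)
    case (Cons c cs')
    show ?thesis
      using bv[of "tl c"] tl[of c] bv[of "head [] cs'"]
      by (cases cs') (auto simp: Cons read_rat_def Nil)
  qed (simp add: read_rat_def Nil)
qed

lemma fp_read_items [fp_intros]:
  assumes "fp f" "fp g"
  shows "fp (\<lambda>x. read_items (f x) (g x))"
proof -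
  have "fp (\<lambda>x. foldl item_step ([], g x) (f x))"
  proof (rule fp_foldl_additive[where h = "\<lambda>n. 50"])
    show "fp (\<lambda>z :: 'a \<times> (item list \<times> bool list list) \<times> bool. item_step (fst (snd z)) (snd (snd z)))"
      unfolding item_step_def by (intro fp_intros)
    show "sz (item_step b y) \<le> sz b + 50" for b y
      using sz_read_rat[of "snd b"] by (cases b) (auto simp: item_step_def sz_Bin nat_bits_rec)
  qed (intro fp_intros poly_intros assms)+
  then show ?thesis unfolding read_items_def by (intro fp_intros)
qed

subsection \<open>Candidates\<close>

text \<open>The first component of each pair marks membership in \<open>R\<close>. An unmarked
  position is not flipped, so all candidates remain inside \<open>R\<close>.\<close>

definition flip_at :: "nat \<Rightarrow> (bool \<times> bool) list \<Rightarrow> bool list" where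
  "flip_at i zs = rev (snd (foldl (\<lambda>p z.
     (Suc (fst p), (if fst p = i \<and> fst z then \<not> snd z else snd z) # snd p)) (0, []) zs))"

lemma flip_at: "flip_at i zs = map (\<lambda>j. if j = i \<and> fst (zs ! j) then \<not> snd (zs ! j) else snd (zs ! j)) [0..<length zs]"
proof -
  let ?f = "\<lambda>j z. if j = i \<and> fst z then \<not> snd z else snd z"
  have "foldl (\<lambda>p z. (Suc (fst p), ?f (fst p) z # snd p)) (0, []) zs =
      (length zs, rev (map (\<lambda>j. ?f j (zs ! j)) [0..<length zs]))"
    by (induction zs rule: rev_induct) (auto simp: nth_append)
  then show ?thesis by (simp add: flip_at_def)
qed

lemma fp_flip_at [fp_intros]:
  assumes "fp f" "fp g"
  shows "fp (\<lambda>x. flip_at (f x) (g x))"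
proof (rule fp_comp2[OF _ assms])
  have "fp (\<lambda>x :: nat \<times> (bool \<times> bool) list. foldl (\<lambda>p z.
     (Suc (fst p), (if fst p = fst x \<and> fst z then \<not> snd z else snd z) # snd p)) (0 :: nat, []) (snd x))"
  proof (rule fp_foldl_additive[where h = "\<lambda>n. 4"])
    show "fp (\<lambda>z :: (nat \<times> (bool \<times> bool) list) \<times> (nat \<times> bool list) \<times> bool \<times> bool.
      (Suc (fst (fst (snd z))), (if fst (fst (snd z)) = fst (fst z) \<and> fst (snd (snd z))
         then \<not> snd (snd (snd z)) else snd (snd (snd z))) # snd (fst (snd z))))"
      by (intro fp_intros)
  qed ((intro fp_intros poly_intros)+, simp add: sz_prod)
  then show "fp (\<lambda>z. flip_at (fst z) (snd z))"
    unfolding flip_at_def by (intro fp_intros)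
qed

definition candidates :: "(bool \<times> bool) list \<Rightarrow> bool list list" where
  "candidates zs = map snd zs # snd (foldl (\<lambda>p _. (Suc (fst p), flip_at (fst p) zs # snd p)) (0, []) zs)"

lemma set_candidates: "set (candidates zs) = insert (map snd zs) ((\<lambda>i. flip_at i zs) ` {..<length zs})"
proof -
  have "foldl (\<lambda>p _. (Suc (fst p), flip_at (fst p) zs # snd p)) (0, []) ys =
      (length ys, rev (map (\<lambda>i. flip_at i zs) [0..<length ys]))" for ys :: "(bool \<times> bool) list"
    by (induction ys rule: rev_induct) auto
  then show ?thesis by (auto simp: candidates_def)
qed

lemma fp_candidates [fp_intros]:
  assumes "fp f"
  shows "fp (\<lambda>x. candidates (f x))"
proof (rule fp_comp[OF _ assms])
  have sz: "sz (flip_at i zs) \<le> sz zs" for i zs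
  proof -
    have "2 * length zs + 1 \<le> sz zs" for zs :: "(bool \<times> bool) list"
      by (induction zs) (auto simp: sz_prod)
    then show ?thesis by (simp add: flip_at sz_bool_list)
  qed
  have "fp (\<lambda>zs :: (bool \<times> bool) list. foldl (\<lambda>p _. (Suc (fst p), flip_at (fst p) zs # snd p)) (0 :: nat, []) zs)"
  proof (rule fp_foldl_additive[where h = "\<lambda>n. n + 3"])
    show "fp (\<lambda>z :: (bool \<times> bool) list \<times> (nat \<times> bool list list) \<times> bool \<times> bool.
      (Suc (fst (fst (snd z))), flip_at (fst (fst (snd z))) (fst z) # snd (fst (snd z))))"
      by (intro fp_intros)
    show "sz (Suc (fst p), flip_at (fst p) zs # snd p) \<le> sz p + (sz zs + sz y + 3)"
      for zs :: "(bool \<times> bool) list" and p :: "nat \<times> bool list list" and y :: "bool \<times> bool"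
      using sz[of "fst p" zs] by (cases p) simp
  qed (intro fp_intros poly_intros)+
  then show "fp candidates"
    unfolding candidates_def by (intro fp_intros)
qed

subsection \<open>The whole algorithm\<close>

text \<open>The leading term is the bound with reversed sign, so the test is whether the weight
  minus the bound is negative.\<close>

definition cheap :: "item list \<Rightarrow> bool \<times> bin \<times> bin \<Rightarrow> bool list \<Rightarrow> bool" where
  "cheap its b s = sum_negative ((\<not> fst b, snd b) #
     map (\<lambda>(it, c). (fst (snd it), if c then fst (snd (snd it)) else Bin 0, snd (snd (snd it)))) (zip its s))"

definition bit_row :: "bool list \<Rightarrow> nat list" where
  "bit_row bs = map (\<lambda>b. if b then 1 else 0) bs"

definition outside :: "bool list \<Rightarrow> bool list list \<Rightarrow> bool list \<Rightarrow> bool" where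
  "outside Q Ss s = independent (length Q) (map bit_row Ss @ [bit_row (map (\<lambda>(c, d). c \<or> d) (zip s Q))])"

text \<open>A list with at most one element serves as an encodable option type.\<close>

definition violating :: "bool list \<Rightarrow> bool list \<Rightarrow> bool list list \<Rightarrow> bool list list" where
  "violating Q R cs = (case read_items R cs of (its, cs') \<Rightarrow>
     foldr (\<lambda>s found. if cheap its (read_rat cs') s \<and> outside Q (tl (tl cs')) s then [s] else found)
       (candidates (map (\<lambda>it. (fst it, fst it \<and> fst (snd it))) its)) [])"

definition solve :: "symbol list \<Rightarrow> symbol list" where
  "solve w = (case violating (head [] (chunks w)) (head [] (tl (chunks w))) (tl (tl (chunks w))) of
     [] \<Rightarrow> [S2] | s # _ \<Rightarrow> S1 # unchunk s)"

lemma fp_cheap [fp_intros]: "fp f \<Longrightarrow> fp g \<Longrightarrow> fp h \<Longrightarrow> fp (\<lambda>x. cheap (f x) (g x) (h x))"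
  unfolding cheap_def by (intro fp_intros)

lemma fp_bit_row [fp_intros]: "fp f \<Longrightarrow> fp (\<lambda>x. bit_row (f x))"
  unfolding bit_row_def by (intro fp_intros)

lemma fp_outside [fp_intros]: "fp f \<Longrightarrow> fp g \<Longrightarrow> fp h \<Longrightarrow> fp (\<lambda>x. outside (f x) (g x) (h x))"
  unfolding outside_def by (intro fp_intros)

lemma fp_violating [fp_intros]:
  assumes "fp f" "fp g" "fp h"
  shows "fp (\<lambda>x. violating (f x) (g x) (h x))"
proof (rule fp_comp3[OF _ assms])
  define items where "items x = fst (read_items (fst (snd x)) (snd (snd x)))" for x :: "bool list \<times> bool list \<times> bool list list"
  define rest where "rest x = snd (read_items (fst (snd x)) (snd (snd x)))" for x :: "bool list \<times> bool list \<times> bool list list"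
  have "fp (\<lambda>x. foldr (\<lambda>s found. if cheap (items x) (read_rat (rest x)) s \<and> outside (fst x) (tl (tl (rest x))) s then [s] else found)
     (candidates (map (\<lambda>it. (fst it, fst it \<and> fst (snd it))) (items x))) [])"
  proof (rule fp_foldr_additive[where h = "\<lambda>n. n + 2"])
    show "fp (\<lambda>z :: (bool list \<times> bool list \<times> bool list list) \<times> bool list \<times> bool list list.
      if cheap (items (fst z)) (read_rat (rest (fst z))) (fst (snd z)) \<and> outside (fst (fst z)) (tl (tl (rest (fst z)))) (fst (snd z))
      then [fst (snd z)] else snd (snd z))"
      unfolding items_def rest_def by (intro fp_intros)
    show "fp (\<lambda>x. candidates (map (\<lambda>it. (fst it, fst it \<and> fst (snd it))) (items x)))"
      unfolding items_def by (intro fp_intros)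
  qed ((intro fp_intros poly_intros)+, simp)
  then show "fp (\<lambda>z. violating (fst z) (fst (snd z)) (snd (snd z)))"
    unfolding violating_def items_def rest_def case_prod_beta .
qed

lemma fp_unchunk [fp_intros]: "fp f \<Longrightarrow> fp (\<lambda>x. unchunk (f x))"
  unfolding unchunk_def bit_symbol_def by (intro fp_intros)

lemma fp_solve: "fp solve"
  unfolding solve_def by (intro fp_intros)


section \<open>Correctness\<close>

definition bits :: "nat \<Rightarrow> nat set \<Rightarrow> bool list" where
  "bits n A = map (\<lambda>i. i \<in> A) [0..<n]"

definition rat_chunks :: "rat \<Rightarrow> bool list list" where
  "rat_chunks r = (case quotient_of r of (z, d) \<Rightarrow> [(z < 0) # nat_bits (nat \<bar>z\<bar>), nat_bits (nat d)])"

definition rat_term :: "rat \<Rightarrow> bool \<times> bin \<times> bin" where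
  "rat_term r = (case quotient_of r of (z, d) \<Rightarrow> (z < 0, Bin (nat \<bar>z\<bar>), Bin (nat d)))"

lemma sym_val_bit_symbol: "sym_val (bit_symbol b) = enc_bit b"
  by (simp add: bit_symbol_def enc_bit_def)

lemma enc_set_unchunk: "enc_set n A = map sym_val (unchunk (bits n A))"
  by (simp add: enc_set_def unchunk_def bits_def sym_val_bit_symbol sep_def)

lemma enc_rat_unchunk: "enc_rat r = map sym_val (concat (map unchunk (rat_chunks r)))"
  by (simp add: enc_rat_def Defs.enc_nat_def unchunk_def rat_chunks_def sym_val_bit_symbol sep_def comp_def split: prod.splits)

lemma read_rat_chunks:
  "read_rat (rat_chunks r @ cs) = rat_term r" "tl (tl (rat_chunks r @ cs)) = cs"
  by (simp_all add: read_rat_def rat_chunks_def rat_term_def split: prod.splits)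

definition instance_chunks :: "problem_instance \<Rightarrow> bool list list" where
  "instance_chunks x = bits (ground_size x) (Q_set x) # bits (ground_size x) (R_set x) #
     concat (map (\<lambda>e. rat_chunks (weight x e)) (sorted_list_of_set (R_set x))) @
     rat_chunks (bound x) @ map (bits (ground_size x)) (S_sets x)"

lemma enc_instance_chunks:
  "enc_instance x = map sym_val (concat (map unchunk (instance_chunks x)))"
proof -
  have "concat (map (\<lambda>e. enc_rat (weight x e)) es) =
      map sym_val (concat (map unchunk (concat (map (\<lambda>e. rat_chunks (weight x e)) es))))" for es
    by (induction es) (simp_all add: enc_rat_unchunk)
  moreover have "concat (map (enc_set n) As) = map sym_val (concat (map unchunk (map (bits n) As)))" for n As
    by (induction As) (simp_all add: enc_set_unchunk)
  ultimately show ?thesis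
    by (simp add: enc_instance_def instance_chunks_def enc_set_unchunk enc_rat_unchunk)
qed

definition items :: "problem_instance \<Rightarrow> item list" where
  "items x = map (\<lambda>i. if i \<in> R_set x then (True, rat_term (weight x i)) else (False, False, Bin 0, Bin 1))
     [0..<ground_size x]"

text \<open>The weights arrive in increasing order of the elements, which is the order in which the
  bits of \<open>R\<close> are scanned; hence the rewriting of the sorted list as a filter of
  \<open>[0..<n]\<close>.\<close>

lemma read_items_chunks:
  assumes "R_set x \<subseteq> {..<ground_size x}"
  shows "read_items (bits (ground_size x) (R_set x))
     (concat (map (\<lambda>e. rat_chunks (weight x e)) (sorted_list_of_set (R_set x))) @ cs) = (items x, cs)"
proof -
  let ?R = "R_set x" and ?c = "\<lambda>e. rat_chunks (weight x e)"
  let ?it = "\<lambda>i. if i \<in> ?R then (True, rat_term (weight x i)) else (False, False, Bin 0, Bin 1)"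
  have sorted: "sorted_list_of_set ?R = filter (\<lambda>i. i \<in> ?R) [0..<ground_size x]"
  proof (rule sorted_distinct_set_unique)
    show "set (sorted_list_of_set ?R) = set (filter (\<lambda>i. i \<in> ?R) [0..<ground_size x])"
      using assms finite_subset[OF assms] by auto
  qed (use sorted_filter[of "\<lambda>x. x" "[0..<ground_size x]"] in auto)
  have "foldl item_step (its, concat (map ?c (filter (\<lambda>i. i \<in> ?R) is)) @ cs) (map (\<lambda>i. i \<in> ?R) is)
      = (rev (map ?it is) @ its, cs)" for its "is"
    by (induction "is" arbitrary: its) (auto simp: item_step_def read_rat_chunks)
  then show ?thesis
    unfolding sorted bits_def read_items_def items_def by simp
qed

subsection \<open>Weights\<close>

definition term_val :: "bool \<times> bin \<times> bin \<Rightarrow> rat" where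
  "term_val = (\<lambda>(sg, z, d). (if sg then - 1 else 1) * (of_nat (num_of z) / of_nat (num_of d)))"

lemma term_val_rat_term: "term_val (rat_term r) = r" "0 < num_of (snd (snd (rat_term r)))"
proof -
  obtain z d where q: "quotient_of r = (z, d)" by force
  have d: "0 < d" using quotient_of_denom_pos[OF q] .
  then show "0 < num_of (snd (snd (rat_term r)))" by (simp add: rat_term_def q)
  have "term_val (rat_term r) = (if z < 0 then - 1 else 1) * (of_int \<bar>z\<bar> / of_int d)"
    using d by (simp add: term_val_def rat_term_def q)
  also have "\<dots> = of_int z / of_int d" by auto
  also have "\<dots> = r" using quotient_of_div[OF q] by simp
  finally show "term_val (rat_term r) = r" .
qed

text \<open>Positive denominators are preserved by every step, so the sign of the fraction is that
  of its numerator \<open>P - N\<close>.\<close>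

lemma sum_negative_iff:
  assumes "\<And>t. t \<in> set ts \<Longrightarrow> 0 < num_of (snd (snd t))"
  shows "sum_negative ts \<longleftrightarrow> (\<Sum>t\<leftarrow>ts. term_val t) < 0"
proof -
  define v where "v = (\<lambda>(P, N, D). (rat_of_nat (num_of P) - of_nat (num_of N)) / of_nat (num_of D))"
  define pos where "pos = (\<lambda>(P :: bin, N :: bin, D). 0 < num_of D)"
  have step: "pos (sum_step p t) \<and> v (sum_step p t) = v p + term_val t"
    if "pos p" "0 < num_of (snd (snd t))" for p t
  proof -
    obtain P N D where p: "p = (P, N, D)" by (cases p) auto
    obtain sg z d where t: "t = (sg, z, d)" by (cases t) auto
    show ?thesis
      using that by (simp add: p t pos_def v_def term_val_def sum_step_def bin_add_def bin_mult_def field_simps)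
  qed
  have fold: "pos (foldl sum_step p ts) \<and> v (foldl sum_step p ts) = v p + (\<Sum>t\<leftarrow>ts. term_val t)"
    if "pos p" "\<And>t. t \<in> set ts \<Longrightarrow> 0 < num_of (snd (snd t))" for p ts
    using that
  proof (induction ts arbitrary: p)
    case (Cons t ts)
    then show ?case using step[of p t] Cons.IH[of "sum_step p t"] by simp
  qed simp
  obtain P N D where f: "foldl sum_step (Bin 0, Bin 0, Bin 1) ts = (P, N, D)"
    by (cases "foldl sum_step (Bin 0, Bin 0, Bin 1) ts") auto
  have "pos (Bin 0, Bin 0, Bin 1)" "v (Bin 0, Bin 0, Bin 1) = 0"
    by (simp_all add: pos_def v_def)
  then have "pos (P, N, D) \<and> v (P, N, D) = (\<Sum>t\<leftarrow>ts. term_val t)"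
    using fold[of "(Bin 0, Bin 0, Bin 1)" ts] assms f by simp
  then have "0 < num_of D"
    "(rat_of_nat (num_of P) - of_nat (num_of N)) / of_nat (num_of D) = (\<Sum>t\<leftarrow>ts. term_val t)"
    by (simp_all add: pos_def v_def)
  moreover have "(rat_of_nat (num_of P) - of_nat (num_of N)) / of_nat (num_of D) < 0 \<longleftrightarrow> num_of P < num_of N"
    using \<open>0 < num_of D\<close> by (simp add: divide_less_0_iff)
  ultimately show ?thesis unfolding sum_negative_def f prod.case bin_less_def by simp
qed

lemma cheap_iff:
  assumes R: "R_set x \<subseteq> {..<ground_size x}" and S: "S \<subseteq> R_set x"
  shows "cheap (items x) (rat_term (bound x)) (bits (ground_size x) S) \<longleftrightarrow> (\<Sum>e\<in>S. weight x e) < bound x"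
proof -
  let ?n = "ground_size x"
  let ?t = "\<lambda>(it, c). (fst (snd it), if c then fst (snd (snd it)) else Bin 0, snd (snd (snd it)))"
  let ?it = "\<lambda>i. if i \<in> R_set x then (True, rat_term (weight x i)) else (False, False, Bin 0, Bin 1)"
  let ?b = "rat_term (bound x)"
  let ?ts = "(\<not> fst ?b, snd ?b) # map ?t (zip (items x) (bits ?n S))"
  have ts: "map ?t (zip (items x) (bits ?n S)) = map (\<lambda>i. ?t (?it i, i \<in> S)) [0..<?n]"
    by (simp add: items_def bits_def zip_map_map comp_def zip_same_conv_map)
  have "term_val (\<not> fst ?b, snd ?b) = - term_val ?b"
    by (simp add: term_val_def split: prod.splits)
  then have b: "term_val (\<not> fst ?b, snd ?b) = - bound x"
    by (simp add: term_val_rat_term)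
  have i: "term_val (?t (?it i, i \<in> S)) = (if i \<in> S then weight x i else 0)" for i
  proof (cases "i \<in> S")
    case True
    then have "?t (?it i, i \<in> S) = rat_term (weight x i)" using S by auto
    then show ?thesis using True by (simp only: term_val_rat_term) simp
  qed (simp add: term_val_def)
  have "(\<Sum>t\<leftarrow>?ts. term_val t) = - bound x + (\<Sum>i = 0..<?n. if i \<in> S then weight x i else 0)"
    unfolding ts by (simp only: list.map sum_list.Cons b map_map comp_def i) (simp add: interv_sum_list_conv_sum_set_nat)
  also have "(\<Sum>i = 0..<?n. if i \<in> S then weight x i else 0) = (\<Sum>e\<in>S. weight x e)"
  proof -
    have "{0..<?n} \<inter> {i. i \<in> S} = S" using R S by auto
    then show ?thesis by (simp add: sum.If_cases)
  qed
  finally have "(\<Sum>t\<leftarrow>?ts. term_val t) = (\<Sum>e\<in>S. weight x e) - bound x" by simp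
  moreover have "sum_negative ?ts \<longleftrightarrow> (\<Sum>t\<leftarrow>?ts. term_val t) < 0"
  proof (rule sum_negative_iff)
    fix t assume "t \<in> set ?ts"
    then show "0 < num_of (snd (snd t))"
      unfolding ts using term_val_rat_term(2) by auto
  qed
  ultimately show ?thesis by (simp add: cheap_def)
qed

subsection \<open>The independence test\<close>

lemma bit_row_bits: "j < n \<Longrightarrow> real (bit_row (bits n A) ! j) = char_vector n A $ j"
  by (simp add: bit_row_def bits_def char_vector_def)

lemma comb_map_cong: "(\<And>x. x \<in> set xs \<Longrightarrow> f x j = g x j) \<Longrightarrow> comb ls (map f xs) j = comb ls (map g xs) j"
proof (induction ls arbitrary: xs)
  case (Cons l ls)
  then show ?case by (cases xs) auto
qed simp

text \<open>One direction is soundness of elimination for any modulus; the other is the existence of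
  a good modulus with \<open>s = Suc n\<close>, where the number of rows enters.\<close>

lemma independent_iff:
  assumes "length As \<le> Suc n"
  shows "independent n (map (\<lambda>A. bit_row (bits n A)) As) \<longleftrightarrow>
    (\<forall>ls. length ls = length As \<longrightarrow> (\<forall>j<n. comb ls (map (\<lambda>A j. char_vector n A $ j) As) j = 0) \<longrightarrow> set ls \<subseteq> {0})"
    (is "?L \<longleftrightarrow> ?R")
proof
  let ?rs = "map (\<lambda>A. bit_row (bits n A)) As"
  have comb: "comb ls (map (\<lambda>r j. real (r ! j)) ?rs) j = comb ls (map (\<lambda>A j. char_vector n A $ j) As) j"
    if "j < n" for ls j
    unfolding map_map comp_def using that by (intro comb_map_cong) (simp add: bit_row_bits)
  have row: "length r = n \<and> set r \<subseteq> {..<2}" if "r \<in> set ?rs" for r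
    using that by (auto simp: bit_row_def bits_def)
  {
    assume ?L
    then obtain q where q: "independent_mod (Suc (Suc q)) ?rs" by (auto simp: independent_def)
    show ?R
    proof (intro allI impI)
      fix ls :: "real list" assume ls: "length ls = length As"
        "\<forall>j<n. comb ls (map (\<lambda>A j. char_vector n A $ j) As) j = 0"
      show "set ls \<subseteq> {0}"
      proof (rule independent_mod_sound[OF q, where Rs = "map (\<lambda>r j. int (r ! j)) ?rs" and n = n])
        show "rows_ok (Suc (Suc q)) n ?rs"
          unfolding rows_ok_def using row by fastforce
        show "comb ls (map (\<lambda>R j. real_of_int (R j)) (map (\<lambda>r j. int (r ! j)) ?rs)) j = 0" if "j < n" for j
          using comb[OF that, of ls] ls(2) that by (simp add: comp_def)
      qed (use ls in auto)
    qed
  next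
    assume R: ?R
    show ?L
      unfolding independent_def
    proof (rule independent_mod_exists[OF row])
      fix ls :: "real list" assume "length ls = length ?rs"
        "\<And>j. j < n \<Longrightarrow> comb ls (map (\<lambda>r j. real (r ! j)) ?rs) j = 0"
      then show "set ls \<subseteq> {0}" using R comb by simp
    qed (use assms in auto)
  }
qed

lemma outside_iff:
  assumes "length Ss \<le> n" "lin_indep_family n (map (char_vector n) Ss)"
  shows "outside (bits n Q) (map (bits n) Ss) (bits n S) \<longleftrightarrow>
    char_vector n (S \<union> Q) \<notin> vec_span n (char_vector n ` set Ss)"
proof -
  have "map (\<lambda>(c, d). c \<or> d) (zip (bits n S) (bits n Q)) = bits n (S \<union> Q)"
    by (simp add: bits_def zip_map_map comp_def zip_same_conv_map)
  then have "outside (bits n Q) (map (bits n) Ss) (bits n S) \<longleftrightarrow>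
      independent n (map (\<lambda>A. bit_row (bits n A)) (Ss @ [S \<union> Q]))"
    by (simp add: outside_def comp_def) (simp add: bits_def)
  also have "\<dots> \<longleftrightarrow> (\<forall>ls. length ls = Suc (length Ss) \<longrightarrow>
      (\<forall>j<n. comb ls (map (\<lambda>v j. v $ j) (map (char_vector n) Ss @ [char_vector n (S \<union> Q)])) j = 0) \<longrightarrow> set ls \<subseteq> {0})"
    using assms(1) by (subst independent_iff) (simp_all add: comp_def)
  also have "\<dots> \<longleftrightarrow> char_vector n (S \<union> Q) \<notin> vec_span n (set (map (char_vector n) Ss))"
    by (subst not_in_span_iff[OF assms(2)]) (auto simp: char_vector_def)
  finally show ?thesis by simp
qed

subsection \<open>An optimal set among the candidates\<close>

lemma vec_span_combine:
  assumes "finite V" "V \<subseteq> carrier_vec n" "u \<in> vec_span n V" "v \<in> vec_span n V" "w \<in> vec_span n V"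
    and x: "x \<in> carrier_vec n" "\<And>j. j < n \<Longrightarrow> x $ j = u $ j + v $ j - w $ j"
  shows "x \<in> vec_span n V"
proof -
  interpret vec_space "TYPE(real)" n .
  have span: "vec_span n V = span V" by (simp add: vec_span_def)
  obtain a where a: "u = lincomb a V"
    using finite_in_span[OF assms(1,2)] assms(3) unfolding span by metis
  obtain b where b: "v = lincomb b V"
    using finite_in_span[OF assms(1,2)] assms(4) unfolding span by metis
  obtain c where c: "w = lincomb c V"
    using finite_in_span[OF assms(1,2)] assms(5) unfolding span by metis
  have "x = lincomb (\<lambda>y. a y + b y - c y) V"
  proof (rule eq_vecI)
    have l: "lincomb (\<lambda>y. a y + b y - c y) V \<in> carrier_vec n"
      using assms(2) by (rule lincomb_closed)
    then show "dim_vec x = dim_vec (lincomb (\<lambda>y. a y + b y - c y) V)" using x(1) by auto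
    fix j assume "j < dim_vec (lincomb (\<lambda>y. a y + b y - c y) V)"
    then have j: "j < n" using l by auto
    show "x $ j = lincomb (\<lambda>y. a y + b y - c y) V $ j"
      unfolding x(2)[OF j] a b c lincomb_index[OF j assms(2)]
      by (simp add: algebra_simps sum.distrib sum_subtractf)
  qed
  then show ?thesis unfolding span span_def using assms(1) by blast
qed

text \<open>Flips at different elements change different coordinates, so the vector after flipping
  \<open>F\<close> and a further \<open>e\<close> is the sum of the two separately flipped vectors
  minus the original one. Disjointness from \<open>Q\<close> guarantees that a flip is visible in
  the union with \<open>Q\<close>.\<close>

lemma sym_diff_in_span:
  assumes V: "finite V" "V \<subseteq> carrier_vec n" and "finite F"
    and S0: "char_vector n (S0 \<union> Q) \<in> vec_span n V"
    and one: "\<And>e. e \<in> F \<Longrightarrow> char_vector n (sym_diff S0 {e} \<union> Q) \<in> vec_span n V"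
    and Q: "F \<inter> Q = {}"
  shows "char_vector n (sym_diff S0 F \<union> Q) \<in> vec_span n V"
  using assms(3,5,6)
proof (induction F)
  case empty
  then show ?case using S0 by simp
next
  case (insert e F)
  then have "char_vector n (sym_diff S0 F \<union> Q) \<in> vec_span n V" by simp
  moreover have "char_vector n (sym_diff S0 {e} \<union> Q) \<in> vec_span n V" using insert by simp
  ultimately show ?case
    by (rule vec_span_combine[OF V _ _ S0]) (use insert in \<open>auto simp: char_vector_def\<close>)
qed

definition negative_part :: "problem_instance \<Rightarrow> nat set" where
  "negative_part x = {e \<in> R_set x. weight x e < 0}"

text \<open>Elements that leave the negative part have negative weight and those that enter have
  nonnegative weight, so every flip costs exactly the absolute value.\<close>

lemma weight_sym_diff:
  assumes "finite (R_set x)" "F \<subseteq> R_set x"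
  shows "(\<Sum>e\<in>sym_diff (negative_part x) F. weight x e) = (\<Sum>e\<in>negative_part x. weight x e) + (\<Sum>e\<in>F. \<bar>weight x e\<bar>)"
proof -
  let ?N = "negative_part x"
  have fin: "finite ?N" "finite F" using assms finite_subset by (auto simp: negative_part_def)
  have "(\<Sum>e\<in>sym_diff ?N F. weight x e) = (\<Sum>e\<in>?N - F. weight x e) + (\<Sum>e\<in>F - ?N. weight x e)"
    using fin by (intro sum.union_disjoint) auto
  moreover have "(\<Sum>e\<in>?N. weight x e) = (\<Sum>e\<in>?N - F. weight x e) + (\<Sum>e\<in>?N \<inter> F. weight x e)"
    using fin by (metis Int_commute add.commute sum.Int_Diff)
  moreover have "(\<Sum>e\<in>F. \<bar>weight x e\<bar>) = (\<Sum>e\<in>F - ?N. \<bar>weight x e\<bar>) + (\<Sum>e\<in>?N \<inter> F. \<bar>weight x e\<bar>)"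
    using fin by (metis Int_commute add.commute sum.Int_Diff)
  moreover have "(\<Sum>e\<in>F - ?N. \<bar>weight x e\<bar>) = (\<Sum>e\<in>F - ?N. weight x e)"
    using assms by (intro sum.cong) (auto simp: negative_part_def)
  moreover have "(\<Sum>e\<in>?N \<inter> F. \<bar>weight x e\<bar>) = - (\<Sum>e\<in>?N \<inter> F. weight x e)"
    by (subst sum_negf[symmetric], intro sum.cong) (auto simp: negative_part_def)
  ultimately show ?thesis by simp
qed

lemma exists_violating_candidate:
  assumes x: "x \<in> instances" and S: "admissible x S" "(\<Sum>e\<in>S. weight x e) < bound x"
  shows "\<exists>T. (T = negative_part x \<or> (\<exists>e\<in>R_set x. T = sym_diff (negative_part x) {e})) \<and>
    admissible x T \<and> (\<Sum>e\<in>T. weight x e) < bound x"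
proof -
  let ?N = "negative_part x" and ?n = "ground_size x"
  let ?V = "char_vector ?n ` set (S_sets x)"
  define F where "F = sym_diff S ?N"
  have "R_set x \<subseteq> {..<?n}" and disj: "Q_set x \<inter> R_set x = {}" using x by (auto simp: instances_def)
  then have fin: "finite (R_set x)" using finite_subset by blast
  have N: "?N \<subseteq> R_set x" by (auto simp: negative_part_def)
  have SR: "S \<subseteq> R_set x" using S(1) by (simp add: admissible_def)
  have F: "F \<subseteq> R_set x" "finite F" "S = sym_diff ?N F"
    using SR N finite_subset[OF SR fin] finite_subset[OF N fin] by (auto simp: F_def)
  have V: "finite ?V" "?V \<subseteq> carrier_vec ?n" by (auto simp: char_vector_def)
  have wS: "(\<Sum>e\<in>S. weight x e) = (\<Sum>e\<in>?N. weight x e) + (\<Sum>e\<in>F. \<bar>weight x e\<bar>)"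
    unfolding F(3) by (rule weight_sym_diff[OF fin F(1)])
  show ?thesis
  proof (cases "admissible x ?N")
    case True
    have "0 \<le> (\<Sum>e\<in>F. \<bar>weight x e\<bar>)" by (rule sum_nonneg) simp
    then have "(\<Sum>e\<in>?N. weight x e) < bound x" using wS S(2) by linarith
    with True show ?thesis by blast
  next
    case False
    then have "char_vector ?n (?N \<union> Q_set x) \<in> vec_span ?n ?V"
      using N by (simp add: admissible_def)
    moreover have "char_vector ?n (sym_diff ?N F \<union> Q_set x) \<notin> vec_span ?n ?V"
      using S(1) unfolding admissible_def F(3)[symmetric] by simp
    \<comment> \<open>If all single flips in \<open>F\<close> stayed in the span, so would the
      simultaneous flip, which is \<open>S\<close>.\<close>
    ultimately obtain e where e: "e \<in> F" "char_vector ?n (sym_diff ?N {e} \<union> Q_set x) \<notin> vec_span ?n ?V"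
      using sym_diff_in_span[OF V F(2), of ?N "Q_set x"] F(1) disj by blast
    then have "admissible x (sym_diff ?N {e})"
      using N F(1) by (auto simp: admissible_def)
    moreover have "(\<Sum>e\<in>sym_diff ?N {e}. weight x e) = (\<Sum>e\<in>?N. weight x e) + \<bar>weight x e\<bar>"
      using weight_sym_diff[OF fin, of "{e}"] e(1) F(1) by (simp only: sum.insert sum.empty finite.emptyI empty_iff not_False_eq_True add_0_right) blast
    moreover have "\<bar>weight x e\<bar> \<le> (\<Sum>e\<in>F. \<bar>weight x e\<bar>)"
      using F(2) e(1) by (intro member_le_sum) auto
    ultimately have "(\<Sum>e\<in>sym_diff ?N {e}. weight x e) < bound x" using wS S(2) by linarith
    with \<open>admissible x (sym_diff ?N {e})\<close> show ?thesis using e(1) F(1) by blast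
  qed
qed

lemma candidates_items:
  assumes "x \<in> instances"
  defines "zs \<equiv> map (\<lambda>it. (fst it, fst it \<and> fst (snd it))) (items x)"
  shows "s \<in> set (candidates zs) \<Longrightarrow> \<exists>S \<subseteq> R_set x. s = bits (ground_size x) S"
    and "bits (ground_size x) (negative_part x) \<in> set (candidates zs)"
    and "e \<in> R_set x \<Longrightarrow> bits (ground_size x) (sym_diff (negative_part x) {e}) \<in> set (candidates zs)"
proof -
  let ?n = "ground_size x" and ?N = "negative_part x"
  have R: "R_set x \<subseteq> {..<?n}" using assms(1) by (auto simp: instances_def)
  have neg: "fst (rat_term r) \<longleftrightarrow> r < 0" for r
  proof -
    obtain z d where q: "quotient_of r = (z, d)" by force
    then show ?thesis
      using quotient_of_denom_pos[OF q] quotient_of_div[OF q]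
      by (simp add: rat_term_def divide_less_0_iff)
  qed
  have zs: "zs = map (\<lambda>i. (i \<in> R_set x, i \<in> ?N)) [0..<?n]"
    by (auto simp: zs_def items_def negative_part_def neg)
  have flip: "flip_at i zs = bits ?n (if i \<in> R_set x then sym_diff ?N {i} else ?N)" for i
    unfolding flip_at by (auto simp: zs bits_def)
  have cand: "set (candidates zs) = insert (bits ?n ?N) ((\<lambda>i. bits ?n (if i \<in> R_set x then sym_diff ?N {i} else ?N)) ` {..<?n})"
    unfolding set_candidates flip by (simp add: zs bits_def comp_def)
  have N: "?N \<subseteq> R_set x" by (auto simp: negative_part_def)
  show "bits ?n ?N \<in> set (candidates zs)" by (simp add: cand)
  show "bits ?n (sym_diff ?N {e}) \<in> set (candidates zs)" if "e \<in> R_set x"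
    unfolding cand using that R by (intro insertI2 image_eqI[of _ _ e]) auto
  show "\<exists>S \<subseteq> R_set x. s = bits ?n S" if s: "s \<in> set (candidates zs)"
  proof -
    obtain i where "s = bits ?n ?N \<or> s = bits ?n (if i \<in> R_set x then sym_diff ?N {i} else ?N)"
      using s unfolding cand by blast
    then show ?thesis
    proof
      assume "s = bits ?n ?N"
      with N show ?thesis by blast
    next
      assume "s = bits ?n (if i \<in> R_set x then sym_diff ?N {i} else ?N)"
      with N show ?thesis
        by (intro exI[of _ "if i \<in> R_set x then sym_diff ?N {i} else ?N"]) auto
    qed
  qed
qed

lemma violating_correct:
  assumes x: "x \<in> instances"
  defines "v \<equiv> violating (bits (ground_size x) (Q_set x)) (bits (ground_size x) (R_set x)) (tl (tl (instance_chunks x)))"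
  shows "v = [] \<Longrightarrow> correct_answer x None"
    and "v \<noteq> [] \<Longrightarrow> \<exists>S. hd v = bits (ground_size x) S \<and> correct_answer x (Some S)"
proof -
  let ?n = "ground_size x"
  let ?c = "candidates (map (\<lambda>it. (fst it, fst it \<and> fst (snd it))) (items x))"
  let ?P = "\<lambda>s. cheap (items x) (rat_term (bound x)) s \<and> outside (bits ?n (Q_set x)) (map (bits ?n) (S_sets x)) s"
  have R: "R_set x \<subseteq> {..<?n}" and k: "length (S_sets x) \<le> ?n"
    and ind: "lin_indep_family ?n (map (char_vector ?n) (S_sets x))"
    using x by (auto simp: instances_def)
  have v: "v = foldr (\<lambda>s found. if ?P s then [s] else found) ?c []"
    unfolding v_def violating_def instance_chunks_def list.sel read_items_chunks[OF R] prod.case read_rat_chunks ..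
  have P: "?P (bits ?n S) \<longleftrightarrow> admissible x S \<and> (\<Sum>e\<in>S. weight x e) < bound x" if "S \<subseteq> R_set x" for S
    using cheap_iff[OF R that] outside_iff[OF k ind] that by (auto simp: admissible_def)
  \<comment> \<open>For an arbitrary predicate, the fold is a linear search: empty exactly reports
    failure on all elements, and otherwise its head is a hit.\<close>
  have find: "(foldr (\<lambda>s found. if p s then [s] else found) ss [] = [] \<longrightarrow> (\<forall>s\<in>set ss. \<not> p s)) \<and>
     (foldr (\<lambda>s found. if p s then [s] else found) ss [] \<noteq> [] \<longrightarrow>
       hd (foldr (\<lambda>s found. if p s then [s] else found) ss []) \<in> {s \<in> set ss. p s})" for p and ss :: "bool list list"
    by (induction ss) auto
  show "correct_answer x None" if "v = []"
  proof (rule ccontr)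
    assume "\<not> correct_answer x None"
    then obtain S where "admissible x S" "(\<Sum>e\<in>S. weight x e) < bound x"
      by (auto simp: correct_answer_def not_le)
    from exists_violating_candidate[OF x this] obtain T
      where T: "T = negative_part x \<or> (\<exists>e\<in>R_set x. T = sym_diff (negative_part x) {e})"
        "admissible x T" "(\<Sum>e\<in>T. weight x e) < bound x" by blast
    have "bits ?n T \<in> set ?c" using T(1) candidates_items(2,3)[OF x] by blast
    moreover have "?P (bits ?n T)" using P[of T] T(2,3) by (auto simp: admissible_def)
    ultimately show False using find[of ?P ?c] that unfolding v by blast
  qed
  show "\<exists>S. hd v = bits ?n S \<and> correct_answer x (Some S)" if "v \<noteq> []"
  proof -
    have h: "hd v \<in> set ?c" "?P (hd v)" using find[of ?P ?c] that unfolding v by blast+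
    then obtain S where "S \<subseteq> R_set x" "hd v = bits ?n S" using candidates_items(1)[OF x] by blast
    then show ?thesis using h(2) P[of S] by (auto simp: correct_answer_def)
  qed
qed

theorem mainTheorem3:
  shows "poly_time_solvable instances correct_answer enc_instance enc_answer"
proof (rule fp_poly_time_solvable[OF fp_solve])
  fix x assume x: "x \<in> instances"
  define w where "w = concat (map unchunk (instance_chunks x))"
  define v where "v = violating (bits (ground_size x) (Q_set x)) (bits (ground_size x) (R_set x)) (tl (tl (instance_chunks x)))"
  have w: "chunks w = instance_chunks x" by (simp add: w_def chunks_unchunk)
  have solve: "solve w = (case v of [] \<Rightarrow> [S2] | s # _ \<Rightarrow> S1 # unchunk s)"
    unfolding solve_def w v_def by (simp add: instance_chunks_def)
  have "\<exists>y. correct_answer x y \<and> enc_answer x y = map sym_val (solve w)"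
  proof (cases v)
    case Nil
    then show ?thesis
      using violating_correct(1)[OF x] unfolding solve
      by (intro exI[of _ None]) (auto simp: v_def enc_answer_def enc_bit_def)
  next
    case (Cons s ss)
    then obtain S where "s = bits (ground_size x) S" "correct_answer x (Some S)"
      using violating_correct(2)[OF x] by (auto simp: v_def)
    then show ?thesis
      unfolding solve Cons
      by (intro exI[of _ "Some S"]) (auto simp: enc_answer_def enc_bit_def enc_set_unchunk)
  qed
  then show "\<exists>w y. enc_instance x = map sym_val w \<and> correct_answer x y \<and> enc_answer x y = map sym_val (solve w)"
    using enc_instance_chunks[of x] unfolding w_def by blast
qed

end
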